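(* Let $V$ be a $C_2$-cofinite vertex operator superalgebra and $g$ an automorphism of $V$ of finite order. Then $V$ is $g$-rational if and only if $V$ is $g$-regular.
   Context: A vertex operator superalgebra (VOSA) $V=V_{\bar0}\oplus V_{\bar1}$ has the following structure. - Vertex operators $Y(v,z)=\sum v(n)z^{-n-1}$, vacuum $\mathbf1$, and conformal vector $\omega$ with $Y(\omega,z)=\sum L(n)z^{-n-2}$ (Virasoro). - The super Jacobi identity holds with sign $\epsilon_{u,v}=(-1)^{\tilde u\tilde v}$. - $V=\bigoplus_{n\in\frac12\mathbb Z}V_n$ by $L(0)$-weight, with $V_{\bar0}$ integral and $V_{\bar1}$ half-integral weights. Automorphisms fix $\mathbf1,\omega$ and satisfy $gY(v,z)g^{-1}=Y(gv,z)$. $\sigma$ is the parity automorphism. $C_2$-cofinite means $C_2(V)=\mathrm{span}\{u(-2)v:u,v\in V\}$ has finite codimension. For $g$ of order $T$, $T'$ the order of $g\sigma$, and $V^r=\{v:gv=e^{-2\pi ir/T}v\}$: a weak $g$-twisted module is a space $M$ with $Y_M(v,z)=\sum_{n\in r/T+\mathbb Z}v(n)z^{-n-1}$ for $v\in V^r$, such that $v(m)w=0$ for $m\gg0$, $Y_M(\mathbf1,z)=\mathrm{id}$, and $z_0^{-1}\delta(\frac{z_1-z_2}{z_0})Y_M(u,z_1)Y_M(v,z_2)-\epsilon_{u,v}z_0^{-1}\delta(\frac{z_2-z_1}{-z_0})Y_M(v,z_2)Y_M(u,z_1)=z_2^{-1}(\frac{z_1-z_0}{z_2})^{-r/T}\delta(\frac{z_1-z_0}{z_2})Y_M(Y(u,z_0)v,z_2)$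 for $\mathbb Z_2$-homogeneous $u\in V^r$. An admissible one has a grading $M=\bigoplus_{n\in\frac1{T'}\mathbb Z_{\ge0}}M(n)$ with $v(m)M(n)\subseteq M(n+\mathrm{wt}v-m-1)$. An (ordinary) one has finite-dimensional $L(0)$-eigenspaces $M_\lambda$, $M=\bigoplus M_\lambda$, with $M_{\lambda+n/T'}=0$ for $n\ll0$. $V$ is $g$-rational if every admissible $g$-twisted module is a direct sum of irreducible admissible $g$-twisted modules. $V$ is $g$-regular if every weak $g$-twisted module is a direct sum of irreducible ordinary $g$-twisted modules. *)

theory Defs
  imports Complex_Main
begin

text \<open>Finite sum of a finitely supported sequence (all sums below are finite by truncation).\<close>
definition fsum :: "(nat \<Rightarrow> 'a::comm_monoid_add) \<Rightarrow> 'a" where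
  "fsum f = sum f {i. f i \<noteq> 0}"

definition isign :: "int \<Rightarrow> complex" where
  "isign l = (if even l then 1 else -1)"

definition ssign :: "'v set \<Rightarrow> 'v \<Rightarrow> 'v \<Rightarrow> complex" where
  "ssign Vo u v = (if u \<in> Vo \<and> v \<in> Vo then -1 else 1)"

definition indep_family :: "(complex \<Rightarrow> 'm::ab_group_add \<Rightarrow> 'm) \<Rightarrow> 'm set set \<Rightarrow> bool" where
  "indep_family sc S \<longleftrightarrow>
     (\<forall>W\<in>S. W \<inter> module.span sc (\<Union>(S - {W})) = {0})"

definition is_dsum :: "(complex \<Rightarrow> 'm::ab_group_add \<Rightarrow> 'm) \<Rightarrow> 'm set \<Rightarrow> 'm set set \<Rightarrow> bool" where
  "is_dsum sc M S \<longleftrightarrow>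
     (\<forall>W\<in>S. module.subspace sc W \<and> W \<subseteq> M) \<and> M \<subseteq> module.span sc (\<Union>S) \<and> indep_family sc S"

definition fin_dim :: "(complex \<Rightarrow> 'm::ab_group_add \<Rightarrow> 'm) \<Rightarrow> 'm set \<Rightarrow> bool" where
  "fin_dim sc X \<longleftrightarrow> (\<exists>B. finite B \<and> X \<subseteq> module.span sc B)"

text \<open>Vertex operator superalgebra. Y u n v is the mode u(n)v; Vw n is the L(0)-weight space V_n.\<close>
definition is_VOSA ::
  "(complex \<Rightarrow> 'v::ab_group_add \<Rightarrow> 'v) \<Rightarrow> ('v \<Rightarrow> int \<Rightarrow> 'v \<Rightarrow> 'v) \<Rightarrow> 'v \<Rightarrow> 'v
   \<Rightarrow> 'v set \<Rightarrow> 'v set \<Rightarrow> (rat \<Rightarrow> 'v set) \<Rightarrow> bool" where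
  "is_VOSA sc Y vac om Ve Vo Vw \<longleftrightarrow>
     vector_space sc
   \<comment> \<open>bilinearity of the vertex operation\<close>
   \<and> (\<forall>a u u' n w. Y (sc a u + u') n w = sc a (Y u n w) + Y u' n w)
   \<and> (\<forall>a u n w w'. Y u n (sc a w + w') = sc a (Y u n w) + Y u n w')
   \<comment> \<open>truncation\<close>
   \<and> (\<forall>u w. \<exists>N. \<forall>n\<ge>N. Y u n w = 0)
   \<comment> \<open>vacuum: Y(1,z) = id, and creation property\<close>
   \<and> (\<forall>n w. Y vac n w = (if n = -1 then w else 0))
   \<and> (\<forall>u n. n \<ge> 0 \<longrightarrow> Y u n vac = 0)
   \<and> (\<forall>u. Y u (-1) vac = u)
   \<comment> \<open>weight grading, V = direct sum of V_n, n in (1/2)Z\<close>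
   \<and> (\<forall>n. module.subspace sc (Vw n))
   \<and> (\<forall>n. Vw n \<noteq> {0} \<longrightarrow> 2 * n \<in> \<int>)
   \<and> UNIV \<subseteq> module.span sc (\<Union>(range Vw))
   \<and> indep_family sc (range Vw)
   \<and> (\<forall>n. \<forall>v\<in>Vw n. Y om 1 v = sc (of_rat n) v)
   \<and> (\<forall>n. fin_dim sc (Vw n))
   \<and> (\<exists>N. \<forall>n<N. Vw n = {0})
   \<and> vac \<in> Vw 0 \<and> om \<in> Vw 2
   \<comment> \<open>Z2-grading: even part = integral weights, odd part = half-integral weights\<close>
   \<and> Ve = module.span sc (\<Union>n\<in>{n. n \<in> \<int>}. Vw n)
   \<and> Vo = module.span sc (\<Union>n\<in>{n. n - 1/2 \<in> \<int>}. Vw n)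
   \<and> (\<forall>u v n. (u \<in> Ve \<and> v \<in> Ve \<longrightarrow> Y u n v \<in> Ve) \<and> (u \<in> Ve \<and> v \<in> Vo \<longrightarrow> Y u n v \<in> Vo)
           \<and> (u \<in> Vo \<and> v \<in> Ve \<longrightarrow> Y u n v \<in> Vo) \<and> (u \<in> Vo \<and> v \<in> Vo \<longrightarrow> Y u n v \<in> Ve))
   \<comment> \<open>Virasoro relations for L(n) = om(n+1), with some central charge c\<close>
   \<and> (\<exists>c::complex. \<forall>m n v.
        Y om (m+1) (Y om (n+1) v) - Y om (n+1) (Y om (m+1) v)
        = sc (of_int (m - n)) (Y om (m+n+1) v)
          + (if m + n = 0 then sc ((of_int m ^ 3 - of_int m) / 12 * c) v else 0))
   \<comment> \<open>L(-1)-derivative property: Y(L(-1)u,z) = d/dz Y(u,z)\<close>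
   \<and> (\<forall>u n w. Y (Y om 0 u) n w = sc (- of_int n) (Y u (n - 1) w))
   \<comment> \<open>super Jacobi identity, in components (coefficient of z0^(-l-1) z1^(-m-1) z2^(-n-1))\<close>
   \<and> (\<forall>u v w l m n. u \<in> Ve \<union> Vo \<longrightarrow> v \<in> Ve \<union> Vo \<longrightarrow>
        fsum (\<lambda>i. sc ((-1) ^ i * ((of_int l :: complex) gchoose i))
                  (Y u (l + m - int i) (Y v (n + int i) w)
                   - sc (ssign Vo u v * isign l) (Y v (l + n - int i) (Y u (m + int i) w))))
      = fsum (\<lambda>i. sc ((of_int m :: complex) gchoose i) (Y (Y u (l + int i) v) (m + n - int i) w)))"

definition C2_cofinite :: "(complex \<Rightarrow> 'v::ab_group_add \<Rightarrow> 'v) \<Rightarrow> ('v \<Rightarrow> int \<Rightarrow> 'v \<Rightarrow> 'v) \<Rightarrow> bool" where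
  "C2_cofinite sc Y \<longleftrightarrow>
     (\<exists>F. finite F \<and> module.span sc (module.span sc {Y u (-2) v | u v. True} \<union> F) = UNIV)"

definition is_aut ::
  "(complex \<Rightarrow> 'v::ab_group_add \<Rightarrow> 'v) \<Rightarrow> ('v \<Rightarrow> int \<Rightarrow> 'v \<Rightarrow> 'v) \<Rightarrow> 'v \<Rightarrow> 'v \<Rightarrow> ('v \<Rightarrow> 'v) \<Rightarrow> bool" where
  "is_aut sc Y vac om g \<longleftrightarrow>
     bij g \<and> (\<forall>a u v. g (sc a u + v) = sc a (g u) + g v)
   \<and> g vac = vac \<and> g om = om \<and> (\<forall>u n v. g (Y u n v) = Y (g u) n (g v))"

definition aut_order :: "('v \<Rightarrow> 'v) \<Rightarrow> nat" where
  "aut_order g = (LEAST T. T > 0 \<and> g ^^ T = id)"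

definition par_aut :: "'v set \<Rightarrow> 'v set \<Rightarrow> 'v::ab_group_add \<Rightarrow> 'v" where
  "par_aut Ve Vo v = (THE x. \<exists>a b. a \<in> Ve \<and> b \<in> Vo \<and> v = a + b \<and> x = a - b)"

definition twsp :: "(complex \<Rightarrow> 'v \<Rightarrow> 'v) \<Rightarrow> ('v \<Rightarrow> 'v) \<Rightarrow> int \<Rightarrow> 'v set" where
  "twsp sc g r = {v. g v = sc (exp (- (2 * of_real pi * \<i> * of_int r / of_nat (aut_order g)))) v}"

text \<open>Weak g-twisted module on the subspace M of a vector space (scalar action scM).
  YM v m w is the mode v(m)w, m rational; for v in V^r only the modes m in r/T + Z can be nonzero.\<close>
definition weak_tw_module ::
  "(complex \<Rightarrow> 'v::ab_group_add \<Rightarrow> 'v) \<Rightarrow> ('v \<Rightarrow> int \<Rightarrow> 'v \<Rightarrow> 'v) \<Rightarrow> 'v \<Rightarrow> 'v set \<Rightarrow> 'v set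
   \<Rightarrow> ('v \<Rightarrow> 'v) \<Rightarrow> (complex \<Rightarrow> 'm::ab_group_add \<Rightarrow> 'm) \<Rightarrow> 'm set \<Rightarrow> ('v \<Rightarrow> rat \<Rightarrow> 'm \<Rightarrow> 'm) \<Rightarrow> bool" where
  "weak_tw_module sc Y vac Ve Vo g scM M YM \<longleftrightarrow>
     vector_space scM \<and> module.subspace scM M
   \<and> (\<forall>v m. \<forall>w\<in>M. YM v m w \<in> M)
   \<and> (\<forall>a u u' m. \<forall>w\<in>M. YM (sc a u + u') m w = scM a (YM u m w) + YM u' m w)
   \<and> (\<forall>v m a. \<forall>w\<in>M. \<forall>w'\<in>M. YM v m (scM a w + w') = scM a (YM v m w) + YM v m w')
   \<and> (\<forall>r. \<forall>v\<in>twsp sc g r. \<forall>m. m - of_int r / of_nat (aut_order g) \<notin> \<int> \<longrightarrow> (\<forall>w\<in>M. YM v m w = 0))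
   \<and> (\<forall>v. \<forall>w\<in>M. \<exists>N. \<forall>m\<ge>N. YM v m w = 0)
   \<and> (\<forall>m. \<forall>w\<in>M. YM vac m w = (if m = -1 then w else 0))
   \<and> (\<forall>r u v l m n. \<forall>w\<in>M. u \<in> twsp sc g r \<longrightarrow> u \<in> Ve \<union> Vo \<longrightarrow> v \<in> Ve \<union> Vo \<longrightarrow>
        m - of_int r / of_nat (aut_order g) \<in> \<int> \<longrightarrow>
        fsum (\<lambda>i. scM ((-1) ^ i * ((of_int l :: complex) gchoose i))
                  (YM u (of_int l + m - of_nat i) (YM v (n + of_nat i) w)
                   - scM (ssign Vo u v * isign l) (YM v (of_int l + n - of_nat i) (YM u (m + of_nat i) w))))
      = fsum (\<lambda>i. scM ((of_rat m :: complex) gchoose i) (YM (Y u (l + int i) v) (m + n - of_nat i) w)))"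

definition submodule :: "(complex \<Rightarrow> 'm::ab_group_add \<Rightarrow> 'm) \<Rightarrow> 'm set \<Rightarrow> ('v \<Rightarrow> rat \<Rightarrow> 'm \<Rightarrow> 'm) \<Rightarrow> 'm set \<Rightarrow> bool" where
  "submodule scM M YM W \<longleftrightarrow> module.subspace scM W \<and> W \<subseteq> M \<and> (\<forall>v m. \<forall>w\<in>W. YM v m w \<in> W)"

definition adm_grading ::
  "(complex \<Rightarrow> 'v::ab_group_add \<Rightarrow> 'v) \<Rightarrow> 'v set \<Rightarrow> 'v set \<Rightarrow> (rat \<Rightarrow> 'v set) \<Rightarrow> ('v \<Rightarrow> 'v)
   \<Rightarrow> (complex \<Rightarrow> 'm::ab_group_add \<Rightarrow> 'm) \<Rightarrow> 'm set \<Rightarrow> ('v \<Rightarrow> rat \<Rightarrow> 'm \<Rightarrow> 'm) \<Rightarrow> (rat \<Rightarrow> 'm set) \<Rightarrow> bool" where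
  "adm_grading sc Ve Vo Vw g scM M YM Mg \<longleftrightarrow>
     (\<forall>n. module.subspace scM (Mg n) \<and> Mg n \<subseteq> M)
   \<and> (\<forall>n. Mg n \<noteq> {0} \<longrightarrow> n \<ge> 0 \<and> n * of_nat (aut_order (g \<circ> par_aut Ve Vo)) \<in> \<int>)
   \<and> M \<subseteq> module.span scM (\<Union>(range Mg))
   \<and> (\<forall>n. Mg n \<inter> module.span scM (\<Union>k\<in>UNIV - {n}. Mg k) = {0})
   \<and> (\<forall>k v m n w. v \<in> Vw k \<longrightarrow> w \<in> Mg n \<longrightarrow> YM v m w \<in> Mg (n + k - m - 1))"

definition admissible_tw_module where
  "admissible_tw_module sc Y vac Ve Vo Vw g scM M YM Mg \<longleftrightarrow>
     weak_tw_module sc Y vac Ve Vo g scM M YM \<and> adm_grading sc Ve Vo Vw g scM M YM Mg"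

definition graded_submodule where
  "graded_submodule scM M YM Mg W \<longleftrightarrow>
     submodule scM M YM W \<and> W \<subseteq> module.span scM (\<Union>n. W \<inter> Mg n)"

definition irred_admissible_tw_module where
  "irred_admissible_tw_module sc Y vac Ve Vo Vw g scM M YM Mg \<longleftrightarrow>
     admissible_tw_module sc Y vac Ve Vo Vw g scM M YM Mg \<and> M \<noteq> {0}
   \<and> (\<forall>W. graded_submodule scM M YM Mg W \<longrightarrow> W = {0} \<or> W = M)"

definition ordinary_tw_module where
  "ordinary_tw_module sc Y vac om Ve Vo g scM M YM \<longleftrightarrow>
     weak_tw_module sc Y vac Ve Vo g scM M YM
   \<and> (let E = (\<lambda>lam::complex. {w\<in>M. YM om 1 w = scM lam w}) in
        M \<subseteq> module.span scM (\<Union>(range E))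
      \<and> (\<forall>lam. fin_dim scM (E lam))
      \<and> (\<forall>lam. \<exists>N::int. \<forall>n\<le>N.
            E (lam + of_rat (of_int n / of_nat (aut_order (g \<circ> par_aut Ve Vo)))) = {0}))"

definition irred_module where
  "irred_module scM M YM \<longleftrightarrow> M \<noteq> {0} \<and> (\<forall>W. submodule scM M YM W \<longrightarrow> W = {0} \<or> W = M)"

definition g_rational :: "'m::ab_group_add itself \<Rightarrow> (complex \<Rightarrow> 'v::ab_group_add \<Rightarrow> 'v) \<Rightarrow> ('v \<Rightarrow> int \<Rightarrow> 'v \<Rightarrow> 'v)
   \<Rightarrow> 'v \<Rightarrow> 'v set \<Rightarrow> 'v set \<Rightarrow> (rat \<Rightarrow> 'v set) \<Rightarrow> ('v \<Rightarrow> 'v) \<Rightarrow> bool" where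
  "g_rational (t::'m itself) sc Y vac Ve Vo Vw g \<longleftrightarrow>
     (\<forall>(scM::complex \<Rightarrow> 'm \<Rightarrow> 'm) M YM Mg.
        admissible_tw_module sc Y vac Ve Vo Vw g scM M YM Mg \<longrightarrow>
        (\<exists>S. is_dsum scM M S \<and>
             (\<forall>W\<in>S. graded_submodule scM M YM Mg W \<and>
                     irred_admissible_tw_module sc Y vac Ve Vo Vw g scM W YM (\<lambda>n. W \<inter> Mg n))))"

definition g_regular :: "'m::ab_group_add itself \<Rightarrow> (complex \<Rightarrow> 'v::ab_group_add \<Rightarrow> 'v) \<Rightarrow> ('v \<Rightarrow> int \<Rightarrow> 'v \<Rightarrow> 'v)
   \<Rightarrow> 'v \<Rightarrow> 'v \<Rightarrow> 'v set \<Rightarrow> 'v set \<Rightarrow> ('v \<Rightarrow> 'v) \<Rightarrow> bool" where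
  "g_regular (t::'m itself) sc Y vac om Ve Vo g \<longleftrightarrow>
     (\<forall>(scM::complex \<Rightarrow> 'm \<Rightarrow> 'm) M YM.
        weak_tw_module sc Y vac Ve Vo g scM M YM \<longrightarrow>
        (\<exists>S. is_dsum scM M S \<and>
             (\<forall>W\<in>S. submodule scM M YM W \<and> ordinary_tw_module sc Y vac om Ve Vo g scM W YM
                    \<and> irred_module scM W YM)))"

end

theory Submission
  imports Defs "HOL-Computational_Algebra.Fundamental_Theorem_Algebra"
begin

text \<open>
  Suppose \<open>V\<close> is \<open>g\<close>-rational and let \<open>w\<close> be a vector of a weak module. Cofiniteness passes from \<open>C\<^sub>2\<close> to every
  \<open>C\<^sub>n\<close>, and reducing words in modes modulo \<open>C\<^sub>n\<close> for large \<open>n\<close> shows that the words of a given degree, applied to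
  \<open>w\<close>, span a finite-dimensional space, which vanishes for very negative degrees. In particular \<open>w\<close> lies
  in a finite-dimensional \<open>L(0)\<close>-stable space, so it is a sum of generalized eigenvectors. A generalized eigenvector
  generates a module graded by degree, hence admissible; by rationality it is a sum of irreducible graded modules. Each of
  these contains a true eigenvector of \<open>L(0)\<close>, which generates it; thus it is ordinary, and its \<open>L(0)\<close>-eigenspaces
  refine the grading, so that it is irreducible even as an ungraded module.

  Conversely, if an admissible module is a sum of irreducible ordinary modules, then \<open>L(0)\<close> is semisimple and the
  submodules on which \<open>L(0)\<close> minus the degree is a constant \<open>t\<close> decompose it. The projections of the irreducible
  summands to these submodules are irreducible or zero, and graded because there the degree is read off from \<open>L(0)\<close>.
  In both directions Zorn's lemma turns a sum of irreducibles into a direct sum.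
\<close>

section \<open>Generalized eigenspaces and sums of simple subspaces\<close>

text \<open>Total weight cannot drive the reduction of words: weights may be negative, and the mode
  of \<open>f(-1) f\<close> that appears when a repeated letter is spread has the same weight as the
  pair. The level \<open>lev\<close> is therefore twice the weight plus a constant
  \<open>shift\<close> charged per letter. Merging two letters saves one \<open>shift\<close>.
  Splitting a mode of \<open>a(-n) b\<close> into modes of \<open>a\<close> and \<open>b\<close>
  loses \<open>n - 1\<close> in weight but pays one more \<open>shift\<close>, so it lowers the
  level only if \<open>n > shift + 1\<close>; hence the passage from \<open>C 2\<close> to
  \<open>C (shift + 2)\<close>. The degree is kept by every rule. In the converse, the summands
  given by regularity need not be graded: in the sum of an irreducible module and a copy of it with
  degrees moved by 1, the diagonal is a submodule but not a graded one. Hence the detour through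
  projections. Rationality and regularity both speak about subspaces of one type \<open>'m\<close>,
  so only submodules are formed, never quotients or external sums.\<close>

lemma (in vector_space) span_UN_subspaces:
  assumes "a \<in> span (\<Union>i\<in>I. A i)" "\<And>i. i \<in> I \<Longrightarrow> subspace (A i)"
  obtains J x where "finite J" "J \<subseteq> I" "\<And>i. i \<in> J \<Longrightarrow> x i \<in> A i" "a = sum x J"
proof -
  have "\<exists>J x. finite J \<and> J \<subseteq> I \<and> (\<forall>i\<in>J. x i \<in> A i) \<and> a = sum x J"
    using assms(1)
  proof (induction rule: span_induct_alt)
    case base
    show ?case by (rule exI[of _ "{}"]) auto
  next
    case (step c b y)
    then obtain i J x where i: "i \<in> I" "b \<in> A i" and J: "finite J" "J \<subseteq> I" "\<forall>i\<in>J. x i \<in> A i" "y = sum x J"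
      by auto
    define x' where "x' = (\<lambda>j. (if j = i then c *s b else 0) + (if j \<in> J then x j else 0))"
    have "sum x' (insert i J) = c *s b + y"
      unfolding x'_def using J by (simp add: sum.distrib sum.If_cases Int_absorb1 subset_insertI insert_absorb)
    moreover have "\<forall>j\<in>insert i J. x' j \<in> A j"
      unfolding x'_def using J i assms(2) by (auto intro!: subspace_add subspace_scale subspace_0)
    ultimately show ?case
      using J i by (intro exI[of _ "insert i J"] exI[of _ x']) auto
  qed
  then show ?thesis using that by blast
qed

locale complex_vector_space = vector_space scale
  for scale :: "complex \<Rightarrow> 'b::ab_group_add \<Rightarrow> 'b" (infixr "*s" 75)

text \<open>A mode of a module is linear only on the carrier \<open>M\<close>, so
  \<open>\<phi>\<close> is not assumed linear on the whole type and membership in \<open>M\<close>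
  is carried along everywhere.\<close>

locale endo_on = complex_vector_space scale
  for scale :: "complex \<Rightarrow> 'b::ab_group_add \<Rightarrow> 'b" (infixr "*s" 75) +
  fixes M :: "'b set" and \<phi> :: "'b \<Rightarrow> 'b"
  assumes sub_M: "subspace M"
    and phi_M: "x \<in> M \<Longrightarrow> \<phi> x \<in> M"
    and phi_lin: "x \<in> M \<Longrightarrow> y \<in> M \<Longrightarrow> \<phi> (a *s x + y) = a *s \<phi> x + \<phi> y"
begin

lemma phi_add: "x \<in> M \<Longrightarrow> y \<in> M \<Longrightarrow> \<phi> (x + y) = \<phi> x + \<phi> y"
  using phi_lin[of x y 1] by simp

lemma phi_0: "\<phi> 0 = 0"
  using phi_add[of 0 0] subspace_0[OF sub_M] by simp

lemma phi_scale: "x \<in> M \<Longrightarrow> \<phi> (a *s x) = a *s \<phi> x"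
  using phi_lin[of x 0 a] subspace_0[OF sub_M] phi_0 by simp

lemma phi_diff: "x \<in> M \<Longrightarrow> y \<in> M \<Longrightarrow> \<phi> (x - y) = \<phi> x - \<phi> y"
  using phi_add[of "x - y" y] subspace_diff[OF sub_M, of x y] by simp

lemma phi_sum: "(\<And>i. i \<in> J \<Longrightarrow> x i \<in> M) \<Longrightarrow> \<phi> (sum x J) = (\<Sum>i\<in>J. \<phi> (x i))"
  by (induction J rule: infinite_finite_induct)
     (auto simp: phi_0 phi_add subspace_sum[OF sub_M])

definition sh :: "complex \<Rightarrow> 'b \<Rightarrow> 'b" where "sh \<nu> x = \<phi> x - \<nu> *s x"

lemma sh_M: "x \<in> M \<Longrightarrow> sh \<nu> x \<in> M"
  unfolding sh_def by (intro subspace_diff[OF sub_M] subspace_scale[OF sub_M] phi_M)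

lemma sh_lin: "x \<in> M \<Longrightarrow> y \<in> M \<Longrightarrow> sh \<nu> (a *s x + y) = a *s sh \<nu> x + sh \<nu> y"
  unfolding sh_def phi_lin by (simp add: algebra_simps)

lemma sh_endo: "endo_on scale M (sh \<nu>)"
  by unfold_locales (auto simp: sh_M sh_lin sub_M)

lemma sh_pow_M: "x \<in> M \<Longrightarrow> (sh \<nu> ^^ n) x \<in> M"
  by (induction n) (auto simp: sh_M)

lemma sh_pow_lin: "x \<in> M \<Longrightarrow> y \<in> M \<Longrightarrow> (sh \<nu> ^^ n) (a *s x + y) = a *s (sh \<nu> ^^ n) x + (sh \<nu> ^^ n) y"
  by (induction n) (auto simp: sh_lin sh_pow_M)

lemma sh_pow_endo: "endo_on scale M (sh \<nu> ^^ n)"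
  by unfold_locales (auto simp: sh_pow_M sh_pow_lin sub_M)

lemma sh_commute: "x \<in> M \<Longrightarrow> sh \<nu> (sh \<mu> x) = sh \<mu> (sh \<nu> x)"
  unfolding sh_def using phi_M by (simp add: phi_diff phi_scale subspace_scale[OF sub_M] algebra_simps)

lemma sh_pow_commute: "x \<in> M \<Longrightarrow> (sh \<nu> ^^ n) (sh \<mu> x) = sh \<mu> ((sh \<nu> ^^ n) x)"
  by (induction n) (auto simp: sh_commute sh_pow_M)

definition gen :: "complex \<Rightarrow> 'b set" where
  "gen \<nu> = {x \<in> M. \<exists>n. (sh \<nu> ^^ n) x = 0}"

lemma sh_pow_0: "(sh \<nu> ^^ n) 0 = 0"
  by (rule endo_on.phi_0[OF sh_pow_endo])

lemma sh_pow_mono: "(sh \<nu> ^^ n) x = 0 \<Longrightarrow> n \<le> m \<Longrightarrow> (sh \<nu> ^^ m) x = 0"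
  by (metis funpow_add comp_apply le_add_diff_inverse2 sh_pow_0)

lemma gen_subspace: "subspace (gen \<nu>)"
proof (rule subspaceI)
  show "0 \<in> gen \<nu>" unfolding gen_def using subspace_0[OF sub_M] by (auto intro: exI[of _ 0])
next
  fix x y assume "x \<in> gen \<nu>" "y \<in> gen \<nu>"
  then obtain n m where "(sh \<nu> ^^ n) x = 0" "(sh \<nu> ^^ m) y = 0" and M: "x \<in> M" "y \<in> M"
    unfolding gen_def by auto
  then have "(sh \<nu> ^^ (n + m)) x = 0" "(sh \<nu> ^^ (n + m)) y = 0"
    by (auto intro: sh_pow_mono)
  then have "(sh \<nu> ^^ (n + m)) (x + y) = 0"
    using endo_on.phi_add[OF sh_pow_endo] M by simp
  then show "x + y \<in> gen \<nu>"
    unfolding gen_def using M subspace_add[OF sub_M] by auto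
next
  fix c x assume "x \<in> gen \<nu>"
  then obtain n where "(sh \<nu> ^^ n) x = 0" and M: "x \<in> M"
    unfolding gen_def by auto
  then have "(sh \<nu> ^^ n) (c *s x) = 0"
    using endo_on.phi_scale[OF sh_pow_endo] M by simp
  then show "c *s x \<in> gen \<nu>"
    unfolding gen_def using M subspace_scale[OF sub_M] by auto
qed

lemma eigen_gen: "x \<in> M \<Longrightarrow> \<phi> x = \<nu> *s x \<Longrightarrow> x \<in> gen \<nu>"
  unfolding gen_def by (auto intro!: exI[of _ 1] simp: sh_def)

lemma gen_sh: "x \<in> gen \<nu> \<Longrightarrow> sh \<mu> x \<in> gen \<nu>"
  unfolding gen_def by (auto simp: sh_M sh_pow_commute) (metis endo_on.phi_0 sh_endo)

lemma gen_sh_pow: "x \<in> gen \<nu> \<Longrightarrow> (sh \<mu> ^^ n) x \<in> gen \<nu>"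
  by (induction n) (auto simp: gen_sh)

definition stable :: "'b set \<Rightarrow> bool" where
  "stable U \<longleftrightarrow> subspace U \<and> (\<forall>x\<in>U. \<phi> x \<in> U)"

lemma stable_sh: "stable U \<Longrightarrow> x \<in> U \<Longrightarrow> sh \<mu> x \<in> U"
  unfolding stable_def sh_def by (auto intro: subspace_diff subspace_scale)

lemma stable_sh_pow: "stable U \<Longrightarrow> x \<in> U \<Longrightarrow> (sh \<mu> ^^ n) x \<in> U"
  by (induction n) (auto simp: stable_sh)

lemma stable_zero: "stable {0}"
  unfolding stable_def by (simp add: phi_0)

text \<open>On \<open>gen \<nu>\<close> the map \<open>\<phi> - \<mu>\<close> is a nonzero scalar
  plus a locally nilpotent map, hence injective modulo every stable \<open>U\<close>. The induction
  on the nilpotency order uses that \<open>sh \<mu> y - sh \<nu> y\<close> is a nonzero multiple of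
  \<open>y\<close>.\<close>

lemma sh_in_stable:
  assumes "stable U" "\<nu> \<noteq> \<mu>" "y \<in> gen \<nu>" "sh \<mu> y \<in> U"
  shows "y \<in> U"
proof -
  from assms(3) obtain n where "(sh \<nu> ^^ n) y = 0" "y \<in> M" unfolding gen_def by auto
  then show ?thesis using assms(4)
  proof (induction n arbitrary: y)
    case 0
    then show ?case using assms(1) by (simp add: stable_def subspace_0)
  next
    case (Suc n)
    have "(sh \<nu> ^^ n) (sh \<nu> y) = 0"
      using Suc.prems by (simp add: funpow_swap1)
    moreover have "sh \<mu> (sh \<nu> y) \<in> U"
      using Suc.prems assms(1) sh_commute[of y \<mu> \<nu>] by (simp add: stable_sh)
    ultimately have *: "sh \<nu> y \<in> U"
      using Suc.IH[of "sh \<nu> y"] Suc.prems(2) sh_M by blast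
    have "sh \<mu> y - sh \<nu> y = (\<nu> - \<mu>) *s y"
      unfolding sh_def by (simp add: algebra_simps)
    then have "(\<nu> - \<mu>) *s y \<in> U"
      using * Suc.prems(3) assms(1) unfolding stable_def by (metis subspace_diff)
    then have "inverse (\<nu> - \<mu>) *s ((\<nu> - \<mu>) *s y) \<in> U"
      using assms(1) unfolding stable_def by (meson subspace_scale)
    then show ?case using assms(2) by simp
  qed
qed

lemma sh_pow_in_stable:
  assumes "stable U" "\<nu> \<noteq> \<mu>" "y \<in> gen \<nu>" "(sh \<mu> ^^ n) y \<in> U"
  shows "y \<in> U"
  using assms(4)
proof (induction n)
  case (Suc n)
  then show ?case
    using sh_in_stable[OF assms(1,2) gen_sh_pow[OF assms(3)]] by simp
qed simp

text \<open>A power of \<open>sh (ev k)\<close> kills the summand \<open>x k\<close>, and by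
  \<open>sh_pow_in_stable\<close> membership of the other summands in \<open>U\<close> can still be
  recovered afterwards. For \<open>U = {0}\<close> this gives independence of generalized
  eigenspaces; for a submodule \<open>U\<close> it gives gradedness.\<close>

lemma gen_sum_stable:
  assumes "stable U" "finite J" "inj_on ev J" "\<And>j. j \<in> J \<Longrightarrow> x j \<in> gen (ev j)" "sum x J \<in> U"
  shows "\<forall>j\<in>J. x j \<in> U"
  using assms(2-)
proof (induction J arbitrary: x rule: finite_induct)
  case (insert k J)
  from insert.prems(2) obtain n where n: "(sh (ev k) ^^ n) (x k) = 0" unfolding gen_def by auto
  let ?s = "sh (ev k) ^^ n"
  have M: "\<And>j. j \<in> insert k J \<Longrightarrow> x j \<in> M" using insert.prems(2) unfolding gen_def by auto
  have "?s (sum x (insert k J)) = (\<Sum>j\<in>J. ?s (x j))"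
    using endo_on.phi_sum[OF sh_pow_endo, of "insert k J" x] M n insert.hyps by simp
  then have "(\<Sum>j\<in>J. ?s (x j)) \<in> U"
    using stable_sh_pow[OF assms(1) insert.prems(3)] by metis
  then have "\<forall>j\<in>J. ?s (x j) \<in> U"
    using insert.IH[of "\<lambda>j. ?s (x j)"] insert.prems gen_sh_pow by auto
  then have *: "\<forall>j\<in>J. x j \<in> U"
    using sh_pow_in_stable[OF assms(1)] insert.prems insert.hyps by (metis inj_onD insertI1 insertI2)
  then have "sum x J \<in> U" using assms(1) unfolding stable_def by (meson subspace_sum)
  then have "x k \<in> U" using insert.prems(3) insert.hyps assms(1) unfolding stable_def
    by (metis add_diff_cancel_right' sum.insert subspace_diff)
  with * show ?case by auto
qed simp

lemma stable_decomp:
  assumes "stable U" "inj_on ev I" "\<And>i. i \<in> I \<Longrightarrow> subspace (A i)" "\<And>i. i \<in> I \<Longrightarrow> A i \<subseteq> gen (ev i)"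
    and "a \<in> U" "a \<in> span (\<Union>i\<in>I. A i)"
  shows "a \<in> span (\<Union>i\<in>I. U \<inter> A i)"
proof -
  obtain J x where J: "finite J" "J \<subseteq> I" "\<And>i. i \<in> J \<Longrightarrow> x i \<in> A i" "a = sum x J"
    using span_UN_subspaces[OF assms(6,3)] by blast
  have "\<forall>j\<in>J. x j \<in> U"
    using J assms(4,5) inj_on_subset[OF assms(2) J(2)]
    by (intro gen_sum_stable[OF assms(1), where ev = ev]) blast+
  then show ?thesis
    unfolding J(4) using J(2,3) by (intro span_sum span_base) blast
qed

lemma eigen_component:
  assumes "inj_on ev I" "\<And>i. i \<in> I \<Longrightarrow> subspace (A i)" "\<And>i. i \<in> I \<Longrightarrow> A i \<subseteq> gen (ev i)"
    and "a \<in> gen \<mu>" "a \<in> span (\<Union>i\<in>I. A i)"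
  shows "a \<in> span (\<Union>i\<in>{i\<in>I. ev i = \<mu>}. A i)"
proof -
  obtain J x where J: "finite J" "J \<subseteq> I" "\<And>i. i \<in> J \<Longrightarrow> x i \<in> A i" "a = sum x J"
    using span_UN_subspaces[OF assms(5,2)] by blast
  obtain n where n: "(sh \<mu> ^^ n) a = 0" using assms(4) unfolding gen_def by auto
  have g: "\<And>j. j \<in> J \<Longrightarrow> x j \<in> gen (ev j)" using J assms by blast
  have "(\<Sum>j\<in>J. (sh \<mu> ^^ n) (x j)) = 0"
    using endo_on.phi_sum[OF sh_pow_endo, of J x n \<mu>] g n J by (auto simp: gen_def)
  then have "\<forall>j\<in>J. (sh \<mu> ^^ n) (x j) \<in> {0}"
    using J assms(1) g by (intro gen_sum_stable[OF stable_zero]) (auto intro: inj_on_subset gen_sh_pow)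
  then have "\<And>j. j \<in> J \<Longrightarrow> ev j \<noteq> \<mu> \<Longrightarrow> x j = 0"
    using sh_pow_in_stable[OF stable_zero] g by blast
  then have "a = sum x {j\<in>J. ev j = \<mu>}"
    unfolding J(4) by (intro sum.mono_neutral_right) (use J in auto)
  moreover have "sum x {j\<in>J. ev j = \<mu>} \<in> span (\<Union>i\<in>{i\<in>I. ev i = \<mu>}. A i)"
    using J by (intro span_sum span_base) auto
  ultimately show ?thesis by simp
qed

lemma gen_indep:
  assumes "inj_on ev I" "\<And>i. i \<in> I \<Longrightarrow> subspace (A i)" "\<And>i. i \<in> I \<Longrightarrow> A i \<subseteq> gen (ev i)" "i \<in> I"
  shows "A i \<inter> span (\<Union>k\<in>I - {i}. A k) = {0}"
proof -
  have "a = 0" if a: "a \<in> A i" "a \<in> span (\<Union>k\<in>I - {i}. A k)" for a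
  proof -
    have "{k \<in> I - {i}. ev k = ev i} = {}" using assms(1,4) by (auto dest: inj_onD)
    moreover have "a \<in> span (\<Union>k\<in>{k \<in> I - {i}. ev k = ev i}. A k)"
      using assms a by (intro eigen_component[where \<mu> = "ev i"]) (auto intro: inj_on_subset)
    ultimately show ?thesis by (metis (no_types, lifting) Union_empty image_empty singletonD span_empty)
  qed
  then show ?thesis using assms(2,4) subspace_0 span_zero by blast
qed

text \<open>Serves to select homogeneous generators: cofiniteness yields a spanning set of
  eigenvectors, but only those sharing the eigenvalue of a given vector may enter its reduction.
  Grouping \<open>H\<close> by eigenvalue makes the eigenvalue map injective, as
  \<open>eigen_component\<close> requires.\<close>

lemma eigen_span:
  assumes "H \<subseteq> M" "\<And>h. h \<in> H \<Longrightarrow> \<phi> h = c h *s h" "a \<in> span H" "\<phi> a = \<mu> *s a"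
  shows "a \<in> span {h\<in>H. c h = \<mu>}"
proof -
  define A where "A = (\<lambda>\<nu>. span {h\<in>H. c h = \<nu>})"
  have sub: "A \<nu> \<subseteq> gen \<nu>" for \<nu>
    unfolding A_def using assms(1,2) by (intro span_minimal gen_subspace) (auto intro: eigen_gen)
  have "a \<in> M" using assms(1,3) span_minimal[OF _ sub_M] by blast
  have "span H \<subseteq> span (\<Union>\<nu>\<in>UNIV. A \<nu>)"
    unfolding A_def by (intro span_mono) (auto intro: span_base)
  then have "a \<in> span (\<Union>\<nu>\<in>UNIV. A \<nu>)" using assms(3) by blast
  then have "a \<in> span (\<Union>i\<in>{i\<in>UNIV. id i = \<mu>}. A i)"
    using sub eigen_gen[OF \<open>a \<in> M\<close> assms(4)] by (intro eigen_component) (simp_all add: A_def subspace_span)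
  also have "{i\<in>UNIV. id i = \<mu>} = {\<mu>}" by auto
  finally show ?thesis by (simp add: A_def span_span)
qed

section \<open>Polynomials in the endomorphism and the primary decomposition\<close>

definition pact :: "complex poly \<Rightarrow> 'b \<Rightarrow> 'b" where
  "pact p w = fold_coeffs (\<lambda>a acc. a *s w + \<phi> acc) p 0"

lemma pact_0 [simp]: "pact 0 w = 0"
  by (simp add: pact_def)

lemma pact_pCons: "pact (pCons a p) w = a *s w + \<phi> (pact p w)"
  by (cases "p = 0 \<and> a = 0") (auto simp: pact_def fold_coeffs_pCons_eq phi_0 fold_coeffs_def cCons_def)

lemma pact_stable: "stable U \<Longrightarrow> w \<in> U \<Longrightarrow> pact p w \<in> U"
  by (induction p) (auto simp: pact_pCons stable_def subspace_0 intro!: subspace_add subspace_scale)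

lemma stable_M: "stable M"
  by (simp add: stable_def sub_M phi_M)

lemma pact_M: "w \<in> M \<Longrightarrow> pact p w \<in> M"
  using pact_stable[OF stable_M] .

lemma pact_add: "w \<in> M \<Longrightarrow> pact (p + q) w = pact p w + pact q w"
  by (induction p q rule: poly_induct2) (auto simp: pact_pCons phi_add pact_M scale_left_distrib)

lemma pact_smult: "w \<in> M \<Longrightarrow> pact (smult c p) w = c *s pact p w"
  by (induction p) (auto simp: pact_pCons phi_scale pact_M scale_right_distrib)

lemma pact_phi: "w \<in> M \<Longrightarrow> pact p (\<phi> w) = \<phi> (pact p w)"
  by (induction p) (auto simp: pact_pCons phi_lin pact_M phi_M phi_0)

lemma pact_lin: "w \<in> M \<Longrightarrow> v \<in> M \<Longrightarrow> pact p (c *s w + v) = c *s pact p w + pact p v"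
proof (induction p)
  case (pCons a p)
  then show ?case
    using phi_lin[of "pact p w" "pact p v" c] by (simp add: pact_pCons pact_M algebra_simps)
qed simp

lemma pact_linear_factor:
  assumes "w \<in> M"
  shows "pact ([:- \<nu>, 1:] * p) w = pact p (sh \<nu> w)"
proof -
  have "[:- \<nu>, 1:] * p = smult (- \<nu>) p + pCons 0 p" by simp
  then have "pact ([:- \<nu>, 1:] * p) w = (- \<nu>) *s pact p w + \<phi> (pact p w)"
    using assms by (simp only: pact_add pact_smult pact_pCons) simp
  also have "\<dots> = pact p ((- \<nu>) *s w + \<phi> w)"
    using pact_lin[OF assms phi_M[OF assms]] pact_phi[OF assms] by metis
  finally show ?thesis by (simp add: sh_def)
qed

text \<open>A nonzero scalar plus a locally nilpotent map is onto; the Neumann series of its inverse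
  is unrolled as an induction on the nilpotency order, which stays inside \<open>U\<close>.\<close>

lemma sh_surj_gen:
  assumes "stable U" "U \<subseteq> M" "\<nu> \<noteq> \<mu>" "y \<in> U \<inter> gen \<mu>"
  shows "\<exists>z \<in> U \<inter> gen \<mu>. sh \<nu> z = y"
proof -
  from assms(4) obtain n where "(sh \<mu> ^^ n) y = 0" "y \<in> U" "y \<in> M" unfolding gen_def by auto
  then show ?thesis
  proof (induction n arbitrary: y)
    case 0
    then show ?case
      using endo_on.phi_0[OF sh_endo] subspace_0[OF gen_subspace] by (intro bexI[of _ 0]) auto
  next
    case (Suc n)
    have "(sh \<mu> ^^ n) (sh \<mu> y) = 0"
      using Suc.prems by (simp add: funpow_swap1)
    then obtain z where z: "z \<in> U \<inter> gen \<mu>" "sh \<nu> z = sh \<mu> y"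
      using Suc.IH[of "sh \<mu> y"] Suc.prems sh_M stable_sh[OF assms(1)] by blast
    define z' where "z' = inverse (\<mu> - \<nu>) *s (y - z)"
    have y: "y \<in> gen \<mu>" using Suc.prems(1,3) unfolding gen_def by blast
    have sU: "subspace U" using assms(1) stable_def by simp
    have mem: "z' \<in> U \<inter> gen \<mu>"
      unfolding z'_def using z y Suc.prems sU gen_subspace
      by (auto intro!: subspace_scale subspace_diff)
    have zM: "z \<in> M" using z assms(2) by auto
    have "sh \<nu> (y - z) = (\<mu> - \<nu>) *s y"
      unfolding endo_on.phi_diff[OF sh_endo Suc.prems(3) zM] z(2) by (simp add: sh_def algebra_simps)
    then have "sh \<nu> z' = y"
      unfolding z'_def using endo_on.phi_scale[OF sh_endo subspace_diff[OF sub_M Suc.prems(3) zM]] assms(3)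
      by simp
    with mem show ?case by blast
  qed
qed

lemma killed_by_poly_decomp:
  assumes "stable U" "U \<subseteq> M" "w \<in> U" "p \<noteq> 0" "pact p w = 0"
  shows "w \<in> span (\<Union>\<nu>. U \<inter> gen \<nu>)"
  using assms(3-)
proof (induction "degree p" arbitrary: p w rule: less_induct)
  case less
  have sU: "subspace U" using assms(1) stable_def by simp
  show ?case
  proof (cases "degree p = 0")
    case True
    then obtain c where "p = [:c:]" by (metis degree_eq_zeroE)
    then have "w = 0" using less.prems by (simp add: pact_pCons phi_0)
    then show ?thesis by (simp add: span_zero)
  next
    case False
    then obtain \<nu> where "poly p \<nu> = 0"
      using fundamental_theorem_of_algebra[of p] constant_degree[of p] by auto
    then obtain q where q: "p = [:- \<nu>, 1:] * q"
      using poly_eq_0_iff_dvd[of p \<nu>] by (auto elim: dvdE)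
    with less.prems have "q \<noteq> 0" by auto
    moreover have "degree q < degree p"
      unfolding q using \<open>q \<noteq> 0\<close> by (subst degree_mult_eq) auto
    moreover have "pact q (sh \<nu> w) = 0"
      using less.prems assms(2) unfolding q by (subst pact_linear_factor[symmetric]) auto
    ultimately have "sh \<nu> w \<in> span (\<Union>\<mu>\<in>UNIV. U \<inter> gen \<mu>)"
      using less.hyps less.prems stable_sh[OF assms(1)] by simp
    moreover have "\<And>\<mu>. subspace (U \<inter> gen \<mu>)" by (intro subspace_inter sU gen_subspace)
    ultimately obtain J x where J: "finite J" "\<And>i. i \<in> J \<Longrightarrow> x i \<in> U \<inter> gen i" "sh \<nu> w = sum x J"
      using span_UN_subspaces[where A = "\<lambda>\<mu>. U \<inter> gen \<mu>" and I = UNIV] by metis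
    have "\<exists>z. z \<in> U \<inter> gen i \<and> sh \<nu> z = x i" if "i \<in> J - {\<nu>}" for i
    proof -
      have "\<nu> \<noteq> i" "x i \<in> U \<inter> gen i" using that J(2) by auto
      from sh_surj_gen[OF assms(1,2) this] show ?thesis by blast
    qed
    then have "\<forall>i\<in>J - {\<nu>}. \<exists>z. z \<in> U \<inter> gen i \<and> sh \<nu> z = x i" by blast
    from bchoice[OF this] obtain z where z: "\<forall>i\<in>J - {\<nu>}. z i \<in> U \<inter> gen i \<and> sh \<nu> (z i) = x i"
      by blast
    \<comment> \<open>Only in the component of \<open>\<nu>\<close> may \<open>sh \<nu>\<close> fail
      to be onto. Subtracting preimages of all other components leaves a remainder that
      \<open>sh \<nu>\<close> maps into \<open>gen \<nu>\<close>, so the remainder lies in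
      \<open>gen \<nu>\<close> itself.\<close>
    define t where "t = w - sum z (J - {\<nu>})"
    have zU: "sum z (J - {\<nu>}) \<in> U" using z by (intro subspace_sum sU) auto
    have tU: "t \<in> U" unfolding t_def using zU less.prems by (intro subspace_diff sU) auto
    have "sh \<nu> t = sh \<nu> w - (\<Sum>i\<in>J - {\<nu>}. sh \<nu> (z i))"
    proof -
      have zM: "\<And>i. i \<in> J - {\<nu>} \<Longrightarrow> z i \<in> M" "w \<in> M" "sum z (J - {\<nu>}) \<in> M"
        using z assms(2) zU less.prems(1) by auto
      show ?thesis
        unfolding t_def endo_on.phi_diff[OF sh_endo zM(2,3)] by (subst endo_on.phi_sum[OF sh_endo zM(1)]) auto
    qed
    also have "\<dots> = sum x J - sum x (J - {\<nu>})" using z J by simp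
    finally have "sh \<nu> t = (if \<nu> \<in> J then x \<nu> else 0)"
      using J by (simp add: sum_diff1)
    then have "sh \<nu> t \<in> gen \<nu>" using J subspace_0[OF gen_subspace] by auto
    then obtain n where "(sh \<nu> ^^ n) (sh \<nu> t) = 0" unfolding gen_def by auto
    then have "(sh \<nu> ^^ Suc n) t = 0" by (simp add: funpow_swap1)
    then have "t \<in> U \<inter> gen \<nu>" unfolding gen_def using tU assms(2) by blast
    then have "t \<in> span (\<Union>\<nu>. U \<inter> gen \<nu>)" by (intro span_base) auto
    moreover have "sum z (J - {\<nu>}) \<in> span (\<Union>\<nu>. U \<inter> gen \<nu>)"
      using z by (intro span_sum span_base) auto
    ultimately show ?thesis
      unfolding t_def using span_add by fastforce
  qed
qed

lemma orbit_span_pact: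
  assumes "w \<in> M" "x \<in> span {(\<phi> ^^ i) w | i. i < n}"
  shows "\<exists>q. (\<forall>i\<ge>n. coeff q i = 0) \<and> x = pact q w"
proof -
  have pw: "(\<phi> ^^ i) w = pact (monom 1 i) w" for i
    by (induction i) (auto simp: monom_0 monom_Suc pact_pCons phi_0)
  show ?thesis using assms(2)
  proof (induction rule: span_induct_alt)
    case base
    show ?case by (rule exI[of _ 0]) auto
  next
    case (step c b y)
    then obtain i q where "i < n" "b = pact (monom 1 i) w" "\<forall>i\<ge>n. coeff q i = 0" "y = pact q w"
      using pw by blast
    then show ?case
      using assms(1) by (intro exI[of _ "smult c (monom 1 i) + q"]) (auto simp: pact_add pact_smult)
  qed
qed

lemma fin_dim_gen_decomp:
  assumes "stable U" "U \<subseteq> M" "fin_dim scale U" "w \<in> U"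
  shows "w \<in> span (\<Union>\<nu>. U \<inter> gen \<nu>)"
proof -
  obtain B where B: "finite B" "U \<subseteq> span B" using assms(3) unfolding fin_dim_def by auto
  have orb: "(\<phi> ^^ i) w \<in> U" for i
    using assms(1,4) by (induction i) (auto simp: stable_def)
  define Q where "Q = (\<lambda>n. {(\<phi> ^^ i) w | i. i < n})"
  \<comment> \<open>Otherwise \<open>card B + 1\<close> independent iterates would lie in
    \<open>span B\<close>. A dependent iterate yields a monic polynomial that kills
    \<open>w\<close>.\<close>
  have "\<exists>n. (\<phi> ^^ n) w \<in> span (Q n)"
  proof (rule ccontr)
    assume contr: "\<not> ?thesis"
    have Q: "independent (Q n) \<and> card (Q n) = n \<and> finite (Q n)" for n
    proof (induction n)
      case 0
      show ?case by (simp add: Q_def independent_empty)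
    next
      case (Suc n)
      have "Q (Suc n) = insert ((\<phi> ^^ n) w) (Q n)"
        by (auto simp: Q_def less_Suc_eq)
      moreover have n: "(\<phi> ^^ n) w \<notin> span (Q n)" using contr by blast
      then have "(\<phi> ^^ n) w \<notin> Q n" using span_base by blast
      ultimately show ?case using Suc n by (simp add: independent_insert)
    qed
    have "Q (card B + 1) \<subseteq> span B" using orb B(2) unfolding Q_def by blast
    then have "card (Q (card B + 1)) \<le> card B"
      using independent_span_bound[OF B(1)] Q by blast
    then show False using Q by simp
  qed
  then obtain n where n: "(\<phi> ^^ n) w \<in> span {(\<phi> ^^ i) w | i. i < n}"
    unfolding Q_def by (elim exE)
  from orbit_span_pact[OF _ n] obtain q where q: "\<forall>i\<ge>n. coeff q i = 0" "(\<phi> ^^ n) w = pact q w"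
    using assms(2,4) by blast
  have pw: "(\<phi> ^^ i) w = pact (monom 1 i) w" for i
    by (induction i) (auto simp: monom_0 monom_Suc pact_pCons phi_0)
  have wM: "w \<in> M" using assms by auto
  have "pact (monom 1 n + smult (-1) q) w = 0"
    using q pw[of n] wM by (simp add: pact_add pact_smult del: smult_minus_left)
  moreover have "coeff (monom 1 n + smult (-1) q) n = 1" using q by simp
  then have "monom 1 n + smult (-1) q \<noteq> 0" by (metis coeff_0 zero_neq_one)
  ultimately show ?thesis using killed_by_poly_decomp[OF assms(1,2,4)] by blast
qed

lemma eigenvector_exists:
  assumes "stable U" "U \<subseteq> M" "fin_dim scale U" "U \<noteq> {0}"
  obtains y \<nu> where "y \<in> U" "y \<noteq> 0" "\<phi> y = \<nu> *s y"
proof -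
  have "0 \<in> U" using assms(1) by (simp add: stable_def subspace_0)
  then obtain w where w: "w \<in> U" "w \<noteq> 0" using assms(4) by auto
  have "\<exists>\<nu>. \<exists>y\<in>U \<inter> gen \<nu>. y \<noteq> 0"
  proof (rule ccontr)
    assume "\<not> ?thesis"
    then have "(\<Union>\<nu>. U \<inter> gen \<nu>) \<subseteq> {0}" by auto
    then have "span (\<Union>\<nu>. U \<inter> gen \<nu>) \<subseteq> {0}" by (metis span_minimal subspace_single_0)
    then show False using fin_dim_gen_decomp[OF assms(1-3) w(1)] w(2) by auto
  qed
  then obtain \<nu> y n where y: "y \<in> U" "y \<noteq> 0" "(sh \<nu> ^^ n) y = 0" unfolding gen_def by auto
  define k where "k = (LEAST n. (sh \<nu> ^^ n) y = 0)"
  have k: "(sh \<nu> ^^ k) y = 0" unfolding k_def using y(3) by (rule LeastI)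
  then obtain j where j: "k = Suc j" using y(2) by (cases k) auto
  have "(sh \<nu> ^^ j) y \<noteq> 0" using not_less_Least[of j "\<lambda>n. (sh \<nu> ^^ n) y = 0"] j k_def by auto
  moreover have "\<phi> ((sh \<nu> ^^ j) y) = \<nu> *s (sh \<nu> ^^ j) y" using k j by (simp add: sh_def)
  ultimately show ?thesis using that stable_sh_pow[OF assms(1) y(1)] by blast
qed

end

section \<open>Zorn's lemma for sums of simple subspaces\<close>

lemma (in vector_space) span_chain_Union:
  assumes "subset.chain A C" "C \<noteq> {}" "x \<in> span (\<Union>(\<Union>C - {W}))"
  shows "\<exists>S\<in>C. x \<in> span (\<Union>(S - {W}))"
  using assms(3)
proof (induction rule: span_induct_alt)
  case base
  then show ?case using assms(2) span_zero by blast
next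
  case (step c b y)
  then obtain S T W' where S: "S \<in> C" "y \<in> span (\<Union>(S - {W}))" and T: "T \<in> C" "W' \<in> T" "W' \<noteq> W" "b \<in> W'"
    by auto
  have "S \<subseteq> T \<or> T \<subseteq> S" using assms(1) S T unfolding subset.chain_def by auto
  then obtain R where R: "R \<in> C" "S \<subseteq> R" "T \<subseteq> R" using S T by auto
  have "y \<in> span (\<Union>(R - {W}))" using S(2) R(2) span_mono[of "\<Union>(S - {W})" "\<Union>(R - {W})"] by blast
  moreover have "b \<in> span (\<Union>(R - {W}))" using T R(3) by (intro span_base) auto
  ultimately show ?case using R(1) by (auto intro!: bexI[of _ R] span_add span_scale)
qed

text \<open>The dichotomy \<open>simple\<close> is all that semisimplicity requires: a member not
  contained in the span of a maximal independent family meets that span trivially and could be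
  added. It speaks of spans of subfamilies because these are again submodules, to which
  irreducibility applies.\<close>

lemma (in complex_vector_space) sum_of_simples_is_dsum:
  assumes sub: "\<And>W. W \<in> Irr \<Longrightarrow> subspace W \<and> W \<subseteq> M"
    and cover: "M \<subseteq> span (\<Union>Irr)"
    and simple: "\<And>W S. W \<in> Irr \<Longrightarrow> S \<subseteq> Irr \<Longrightarrow>
      W \<inter> span (\<Union>S) = {0} \<or> W \<subseteq> span (\<Union>S)"
  shows "\<exists>S\<subseteq>Irr. is_dsum scale M S"
proof -
  define A where "A = {S. S \<subseteq> Irr \<and> indep_family scale S}"
  have "{} \<in> A" by (simp add: A_def indep_family_def)
  have "\<Union>C \<in> A" if C: "C \<noteq> {}" "subset.chain A C" for C
  proof -
    have CA: "C \<subseteq> A" using C(2) by (simp add: subset.chain_def)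
    have "x = 0" if W: "W \<in> \<Union>C" "x \<in> W" "x \<in> span (\<Union>(\<Union>C - {W}))" for W x
    proof -
      obtain S where S: "S \<in> C" "x \<in> span (\<Union>(S - {W}))"
        using span_chain_Union[OF C(2,1) W(3)] by blast
      obtain T where T: "T \<in> C" "W \<in> T" using W by auto
      have "S \<subseteq> T \<or> T \<subseteq> S" using C(2) S T unfolding subset.chain_def by auto
      then obtain R where R: "R \<in> C" "S \<subseteq> R" "W \<in> R" using S T by auto
      have "x \<in> span (\<Union>(R - {W}))" using S(2) R(2) span_mono[of "\<Union>(S - {W})" "\<Union>(R - {W})"] by blast
      moreover have "indep_family scale R" using R CA by (auto simp: A_def)
      ultimately show ?thesis using R(3) W(2) unfolding indep_family_def by blast
    qed
    moreover have "0 \<in> W" if "W \<in> \<Union>C" for W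
      using that CA sub subspace_0 unfolding A_def by blast
    ultimately have "W \<inter> span (\<Union>(\<Union>C - {W})) = {0}" if "W \<in> \<Union>C" for W
      using that span_zero[of "\<Union>(\<Union>C - {W})"] by auto
    then have "indep_family scale (\<Union>C)"
      unfolding indep_family_def by blast
    then show ?thesis using CA by (auto simp: A_def)
  qed
  then obtain S where S: "S \<in> A" "\<And>X. X \<in> A \<Longrightarrow> S \<subseteq> X \<Longrightarrow> X = S"
    using subset_Zorn_nonempty[of A] \<open>{} \<in> A\<close> by blast
  have SI: "S \<subseteq> Irr" and ind: "indep_family scale S" using S(1) by (auto simp: A_def)
  have "W \<subseteq> span (\<Union>S)" if W: "W \<in> Irr" for W
  proof (rule ccontr)
    assume no: "\<not> ?thesis"
    then have W0: "W \<inter> span (\<Union>S) = {0}" using simple[OF W SI] by auto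
    have "W \<notin> S" using no span_base by blast
    have W'0: "W' \<inter> span (\<Union>(insert W S - {W'})) = {0}" if "W' \<in> insert W S" for W'
    proof (cases "W' = W")
      case True
      then show ?thesis using W0 \<open>W \<notin> S\<close> by simp
    next
      case False
      then have W': "W' \<in> S" using that by auto
      have "x = 0" if x: "x \<in> W'" "x \<in> span (\<Union>(insert W S - {W'}))" for x
      proof -
        have "\<Union>(insert W S - {W'}) = W \<union> \<Union>(S - {W'})" using False by auto
        then obtain y z where yz: "x = y + z" "y \<in> span W" "z \<in> span (\<Union>(S - {W'}))"
          using x(2) by (auto simp: span_Un)
        have "span W = W" using sub[OF W] span_eq_iff by blast
        have "z \<in> span (\<Union>S)" using yz(3) span_mono[of "\<Union>(S - {W'})" "\<Union>S"] by blast
        moreover have "x \<in> span (\<Union>S)" using x(1) W' by (intro span_base) auto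
        ultimately have "x - z \<in> span (\<Union>S)" by (intro span_diff)
        then have "y \<in> W \<inter> span (\<Union>S)" using yz \<open>span W = W\<close> by auto
        then have "x = z" using W0 yz by auto
        then show ?thesis using ind W' x(1) yz(3) unfolding indep_family_def by blast
      qed
      moreover have "0 \<in> W'" using W' SI sub subspace_0 by blast
      ultimately show ?thesis using span_zero by blast
    qed
    have "insert W S \<in> A"
      unfolding A_def using SI W W'0 by (auto simp: indep_family_def)
    then show False using S(2)[of "insert W S"] \<open>W \<notin> S\<close> by auto
  qed
  then have "\<Union>Irr \<subseteq> span (\<Union>S)" by auto
  then have "M \<subseteq> span (\<Union>S)" using cover span_minimal[OF _ subspace_span] by blast
  moreover have "\<forall>W\<in>S. subspace W \<and> W \<subseteq> M" using SI sub by blast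
  ultimately have "is_dsum scale M S" using ind by (simp add: is_dsum_def)
  then show ?thesis using SI by blast
qed

section \<open>Words in modes\<close>

text \<open>
  Words in modes \<open>a \<in> L\<close> act on \<open>M\<close>. Modulo words of lower level, letters commute up to a scalar,
  every letter is a combination of the letters \<open>fl f j\<close> with \<open>f\<close> in a finite set, and a repeated letter can be
  traded for pairs of letters with indices further apart. Since letters of negative index kill \<open>w\<close>,
  repeated spreading terminates and only words without repetition remain.
\<close>

locale word_system = complex_vector_space scale
  for scale :: "complex \<Rightarrow> 'b::ab_group_add \<Rightarrow> 'b" (infixr "*s" 75) +
  fixes M :: "'b set" and L :: "'l set" and opr :: "'l \<Rightarrow> 'b \<Rightarrow> 'b"
    and lev :: "'l \<Rightarrow> nat" and deg :: "'l \<Rightarrow> rat"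
    and F :: "'f set" and fl :: "'f \<Rightarrow> int \<Rightarrow> 'l" and e :: "'f \<Rightarrow> rat" and w :: 'b
  assumes sub_M: "subspace M" and w_M: "w \<in> M"
    and opr_M: "a \<in> L \<Longrightarrow> x \<in> M \<Longrightarrow> opr a x \<in> M"
    and opr_lin: "a \<in> L \<Longrightarrow> x \<in> M \<Longrightarrow> y \<in> M \<Longrightarrow> opr a (c *s x + y) = c *s opr a x + opr a y"
    and fin_F: "finite F"
    and fl_L: "f \<in> F \<Longrightarrow> fl f j \<in> L"
    and deg_fl: "f \<in> F \<Longrightarrow> deg (fl f j) = e f + of_int j"
    and lev_fl: "f \<in> F \<Longrightarrow> lev (fl f j) = lev (fl f 0)"
    and kill: "f \<in> F \<Longrightarrow> j < 0 \<Longrightarrow> opr (fl f j) w = 0"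
    and swap: "a \<in> L \<Longrightarrow> b \<in> L \<Longrightarrow> x \<in> M \<Longrightarrow>
      opr a (opr b x) \<in> span ((\<lambda>t. foldr opr t x) `
        ({[b, a]} \<union> {t. set t \<subseteq> L \<and> sum_list (map lev t) < lev a + lev b
                          \<and> sum_list (map deg t) = deg a + deg b}))"
    and reduce: "a \<in> L \<Longrightarrow> x \<in> M \<Longrightarrow>
      opr a x \<in> span ((\<lambda>t. foldr opr t x) `
        ({[fl f j] | f j. f \<in> F \<and> lev (fl f j) = lev a \<and> deg (fl f j) = deg a}
         \<union> {t. set t \<subseteq> L \<and> sum_list (map lev t) < lev a \<and> sum_list (map deg t) = deg a}))"
    and spread: "f \<in> F \<Longrightarrow> x \<in> M \<Longrightarrow>
      opr (fl f j) (opr (fl f j) x) \<in> span ((\<lambda>t. foldr opr t x) `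
        ({[fl f (j + i), fl f (j - i)] | i. i \<noteq> 0}
         \<union> {t. set t \<subseteq> L \<and> sum_list (map lev t) < 2 * lev (fl f j)
               \<and> sum_list (map deg t) = 2 * deg (fl f j)}))"
begin

abbreviation "wd \<equiv> foldr opr"

definition levw :: "'l list \<Rightarrow> nat" where "levw t = sum_list (map lev t)"
definition degw :: "'l list \<Rightarrow> rat" where "degw t = sum_list (map deg t)"

lemma levw_simps [simp]: "levw [] = 0" "levw (a # t) = lev a + levw t" "levw (s @ t) = levw s + levw t"
  by (auto simp: levw_def)

lemma degw_simps [simp]: "degw [] = 0" "degw (a # t) = deg a + degw t" "degw (s @ t) = degw s + degw t"
  by (auto simp: degw_def)

definition low :: "nat \<Rightarrow> rat \<Rightarrow> 'l list set" where
  "low l d = {t. set t \<subseteq> L \<and> levw t < l \<and> degw t = d}"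

lemma wd_M: "set t \<subseteq> L \<Longrightarrow> x \<in> M \<Longrightarrow> wd t x \<in> M"
  by (induction t) (auto simp: opr_M)

lemma wd_lin: "set t \<subseteq> L \<Longrightarrow> x \<in> M \<Longrightarrow> y \<in> M \<Longrightarrow> wd t (c *s x + y) = c *s wd t x + wd t y"
  by (induction t) (auto simp: opr_lin wd_M)

lemma wd_0: "set t \<subseteq> L \<Longrightarrow> wd t 0 = 0"
  using wd_lin[of t w w "-1"] w_M by simp

lemma wd_span:
  assumes "set t \<subseteq> L" "A \<subseteq> M" "y \<in> span A"
  shows "wd t y \<in> span (wd t ` A)"
proof -
  have "y \<in> M \<and> wd t y \<in> span (wd t ` A)"
    using assms(3)
  proof (induction rule: span_induct_alt)
    case base
    show ?case using wd_0[OF assms(1)] subspace_0[OF sub_M] by (simp add: span_zero)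
  next
    case (step c x y)
    have M: "x \<in> M" "y \<in> M" using step assms(2) by auto
    have "wd t x \<in> span (wd t ` A)" using step(1) by (intro span_base) blast
    then show ?case
      unfolding wd_lin[OF assms(1) M] using step(2) M sub_M
      by (auto intro!: span_add span_scale subspace_add subspace_scale)
  qed
  then show ?thesis ..
qed

text \<open>Rewriting inside a word: a rule for \<open>t\<close> holds at every vector of
  \<open>M\<close>, in particular at \<open>wd s w\<close>, and linearity of \<open>wd p\<close>
  carries the resulting combination outward.\<close>

lemma wd_context:
  assumes "set p \<subseteq> L" "set s \<subseteq> L" "subspace G"
    and "\<And>x. x \<in> M \<Longrightarrow> wd t x \<in> span ((\<lambda>r. wd r x) ` R)"
    and "\<And>r. r \<in> R \<Longrightarrow> set r \<subseteq> L \<and> wd (p @ r @ s) w \<in> G"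
  shows "wd (p @ t @ s) w \<in> G"
proof -
  have sM: "wd s w \<in> M" using wd_M assms(2) w_M by blast
  have "(\<lambda>r. wd r (wd s w)) ` R \<subseteq> M" using assms(5) sM wd_M by blast
  then have "wd p (wd t (wd s w)) \<in> span (wd p ` (\<lambda>r. wd r (wd s w)) ` R)"
    using assms(4)[OF sM] by (rule wd_span[OF assms(1)])
  also have "\<dots> \<subseteq> G" using assms(3,5) by (intro span_minimal) auto
  finally show ?thesis by simp
qed

definition fw :: "('f \<times> int) list \<Rightarrow> 'l list" where
  "fw ps = map (\<lambda>(f, j). fl f j) ps"

lemma fw_simps [simp]: "fw [] = []" "fw ((f, j) # ps) = fl f j # fw ps" "fw (ps @ qs) = fw ps @ fw qs"
  by (auto simp: fw_def)

lemma fw_L: "fst ` set ps \<subseteq> F \<Longrightarrow> set (fw ps) \<subseteq> L"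
  using fl_L by (auto simp: fw_def)

text \<open>No order of the letters is imposed. This enlarges a set that remains finite, and swaps
  are then needed only to bring two equal letters together or to move a letter to the right
  end.\<close>

definition nor :: "rat \<Rightarrow> ('f \<times> int) list set" where
  "nor d = {ps. distinct ps \<and> set ps \<subseteq> F \<times> {0..} \<and> degw (fw ps) = d}"

definition N :: "rat \<Rightarrow> 'b set" where "N d = span ((\<lambda>ps. wd (fw ps) w) ` nor d)"

lemma N_subspace: "subspace (N d)"
  by (simp add: N_def subspace_span)

lemma sum_list_square_le:
  fixes js :: "int list"
  assumes "\<forall>j\<in>set js. j \<ge> 0"
  shows "0 \<le> sum_list js \<and> sum_list (map (\<lambda>j. j\<^sup>2) js) \<le> (sum_list js)\<^sup>2"
  using assms
proof (induction js)
  case (Cons j js)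
  then show ?case
    using mult_nonneg_nonneg[of j "sum_list js"] by (auto simp: power2_sum intro: add_increasing2)
qed simp

text \<open>The assumption is the induction hypothesis on the level: words of level below
  \<open>l\<close> are already reduced, so inside this context every rule may be used modulo such
  words.\<close>

context
  fixes l :: nat and d :: rat
  assumes low_N: "\<And>t. t \<in> low l d \<Longrightarrow> wd t w \<in> N d"
begin

lemma swap_N:
  assumes "set p \<subseteq> L" "set s \<subseteq> L" "a \<in> L" "b \<in> L" "levw (p @ [a, b] @ s) = l" "degw (p @ [a, b] @ s) = d"
    and "wd (p @ [b, a] @ s) w \<in> N d"
  shows "wd (p @ [a, b] @ s) w \<in> N d"
proof (rule wd_context[OF assms(1,2) N_subspace])
  show "wd [a, b] x \<in> span ((\<lambda>r. wd r x) ` ({[b, a]} \<union> low (lev a + lev b) (deg a + deg b)))" if "x \<in> M" for x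
    using swap[OF assms(3,4) that] by (simp add: low_def levw_def degw_def)
  fix r assume "r \<in> {[b, a]} \<union> low (lev a + lev b) (deg a + deg b)"
  then show "set r \<subseteq> L \<and> wd (p @ r @ s) w \<in> N d"
  proof
    assume "r \<in> low (lev a + lev b) (deg a + deg b)"
    then have "set r \<subseteq> L" "p @ r @ s \<in> low l d"
      using assms(1,2,5,6) by (auto simp: low_def)
    then show ?thesis using low_N by blast
  qed (use assms in auto)
qed

lemma move_N:
  assumes "set p \<subseteq> L" "set s \<subseteq> L" "a \<in> L" "set t \<subseteq> L"
    and "levw (p @ [a] @ s @ t) = l" "degw (p @ [a] @ s @ t) = d"
    and "wd (p @ s @ [a] @ t) w \<in> N d"
  shows "wd (p @ [a] @ s @ t) w \<in> N d"
  using assms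
proof (induction s arbitrary: p)
  case (Cons b s)
  have "wd ((p @ [b]) @ [a] @ s @ t) w \<in> N d"
    using Cons.prems by (intro Cons.IH) auto
  then show ?case
    using swap_N[of p "s @ t" a b] Cons.prems by auto
qed simp

text \<open>A letter of negative index kills \<open>w\<close>, so moving it to the right end leaves
  only words of lower level.\<close>

lemma negative_N:
  assumes "fst ` set ps \<subseteq> F" "(f, j) \<in> set ps" "j < 0" "levw (fw ps) = l" "degw (fw ps) = d"
  shows "wd (fw ps) w \<in> N d"
proof -
  obtain p s where ps: "ps = p @ (f, j) # s" using assms(2) by (auto simp: in_set_conv_decomp)
  have "f \<in> F" using assms(1,2) by force
  have L: "set (fw p) \<subseteq> L" "set (fw s) \<subseteq> L" "fl f j \<in> L"
    using assms(1) unfolding ps by (auto intro!: fl_L fw_L)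
  have "wd (fw p @ fw s @ [fl f j] @ []) w = 0"
    using wd_0 L kill[OF \<open>f \<in> F\<close> assms(3)] by simp
  then have "wd (fw p @ [fl f j] @ fw s @ []) w \<in> N d"
    using assms L by (intro move_N) (auto simp: ps N_def span_zero)
  then show ?thesis by (simp add: ps)
qed

text \<open>Spreading a repeated letter keeps the sum of the indices and increases the sum of their
  squares. As long as all indices are nonnegative, the latter is bounded by the square of the
  former; as soon as an index is negative, \<open>negative_N\<close> ends the process.\<close>

lemma fletters_N:
  assumes "fst ` set ps \<subseteq> F" "levw (fw ps) = l" "degw (fw ps) = d"
  shows "wd (fw ps) w \<in> N d"
  using assms
\<comment> \<open>The summand 1 makes the measure positive on words with nonnegative indices, so it
  drops strictly even if spreading makes the difference negative and \<open>nat\<close> truncates it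
  to 0.\<close>
proof (induction "nat ((sum_list (map snd ps))\<^sup>2 - sum_list (map (\<lambda>j. j\<^sup>2) (map snd ps)) + 1)"
       arbitrary: ps rule: less_induct)
  case less
  consider f j where "(f, j) \<in> set ps" "j < 0" | "distinct ps" "\<forall>(f, j) \<in> set ps. j \<ge> 0"
    | "\<not> distinct ps" "\<forall>(f, j) \<in> set ps. j \<ge> 0"
    by force
  then show ?case
  proof cases
    case 1
    then show ?thesis using negative_N less.prems by blast
  next
    case 2
    then have "ps \<in> nor d" using less.prems unfolding nor_def by force
    then show ?thesis unfolding N_def by (intro span_base) blast
  next
    case 3
    then obtain p s t f j where ps: "ps = p @ [(f, j)] @ s @ [(f, j)] @ t"
      by (metis not_distinct_decomp surj_pair)
    have F: "f \<in> F" and L: "set (fw p) \<subseteq> L" "set (fw s) \<subseteq> L" "set (fw t) \<subseteq> L" "fl f j \<in> L"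
      using less.prems(1) unfolding ps by (auto intro!: fl_L fw_L)
    have "0 \<le> (sum_list (map snd ps))\<^sup>2 - sum_list (map (\<lambda>j. j\<^sup>2) (map snd ps))"
      using sum_list_square_le[of "map snd ps"] 3(2) by fastforce
    have L': "set (fw p @ fw s) \<subseteq> L" using L by simp
    have "wd ((fw p @ fw s) @ [fl f j, fl f j] @ fw t) w \<in> N d"
    proof (rule wd_context[OF L' L(3) N_subspace])
      show "wd [fl f j, fl f j] x \<in> span ((\<lambda>r. wd r x) `
          ({[fl f (j + i), fl f (j - i)] | i. i \<noteq> 0} \<union> low (2 * lev (fl f j)) (2 * deg (fl f j))))"
        if "x \<in> M" for x
        using spread[OF F that] by (simp add: low_def levw_def degw_def)
      fix r assume "r \<in> {[fl f (j + i), fl f (j - i)] | i. i \<noteq> 0} \<union> low (2 * lev (fl f j)) (2 * deg (fl f j))"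
      then show "set r \<subseteq> L \<and> wd ((fw p @ fw s) @ r @ fw t) w \<in> N d"
      proof
        assume "r \<in> low (2 * lev (fl f j)) (2 * deg (fl f j))"
        then have "set r \<subseteq> L" "(fw p @ fw s) @ r @ fw t \<in> low l d"
          using L less.prems(2,3) unfolding ps by (auto simp: low_def)
        then show ?thesis using low_N by blast
      next
        assume "r \<in> {[fl f (j + i), fl f (j - i)] | i. i \<noteq> 0}"
        then obtain i where i: "r = [fl f (j + i), fl f (j - i)]" "i \<noteq> 0" by blast
        define qs where "qs = p @ s @ [(f, j + i), (f, j - i)] @ t"
        have eq: "fw qs = (fw p @ fw s) @ r @ fw t" by (simp add: qs_def i)
        have J: "sum_list (map snd qs) = sum_list (map snd ps)" by (simp add: qs_def ps)
        have "sum_list (map (\<lambda>j. j\<^sup>2) (map snd qs)) = sum_list (map (\<lambda>j. j\<^sup>2) (map snd ps)) + 2 * i\<^sup>2"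
          by (simp add: qs_def ps power2_eq_square algebra_simps)
        then have "sum_list (map (\<lambda>j. j\<^sup>2) (map snd ps)) < sum_list (map (\<lambda>j. j\<^sup>2) (map snd qs))"
          using i(2) by simp
        then have "wd (fw qs) w \<in> N d"
        proof (intro less.hyps)
          have "lev (fl f (j + i)) = lev (fl f j)" "lev (fl f (j - i)) = lev (fl f j)"
            using lev_fl[OF F] by metis+
          then show "levw (fw qs) = l" "degw (fw qs) = d" "fst ` set qs \<subseteq> F"
            using less.prems F by (auto simp: qs_def ps deg_fl)
        qed (use \<open>0 \<le> (sum_list (map snd ps))\<^sup>2 - _\<close> in \<open>simp del: map_map add: J\<close>)
        then show ?thesis using fl_L[OF F] by (simp add: eq i)
      qed
    qed
    then have "wd (fw p @ [fl f j] @ fw s @ ([fl f j] @ fw t)) w \<in> N d"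
      using L less.prems(2,3) by (intro move_N) (auto simp: ps)
    then show ?thesis by (simp add: ps)
  qed
qed

text \<open>Letters are replaced from left to right, and \<open>ps\<close> collects the finished
  prefix. A replacement \<open>fl f j\<close> keeps level and degree; all other words of the rule
  \<open>reduce\<close> are of lower level.\<close>

lemma level_step_N:
  assumes "fst ` set ps \<subseteq> F" "set s \<subseteq> L" "levw (fw ps @ s) = l" "degw (fw ps @ s) = d"
  shows "wd (fw ps @ s) w \<in> N d"
  using assms
proof (induction s arbitrary: ps)
  case Nil
  then show ?case using fletters_N by simp
next
  case (Cons a s)
  have L: "set (fw ps) \<subseteq> L" "set s \<subseteq> L" "a \<in> L" using Cons.prems fw_L by auto
  have "wd (fw ps @ [a] @ s) w \<in> N d"
  proof (rule wd_context[OF L(1,2) N_subspace])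
    show "wd [a] x \<in> span ((\<lambda>r. wd r x) ` ({[fl f j] | f j. f \<in> F \<and> lev (fl f j) = lev a \<and> deg (fl f j) = deg a}
        \<union> low (lev a) (deg a)))" if "x \<in> M" for x
      using reduce[OF L(3) that] by (simp add: low_def levw_def degw_def)
    fix r assume "r \<in> {[fl f j] | f j. f \<in> F \<and> lev (fl f j) = lev a \<and> deg (fl f j) = deg a} \<union> low (lev a) (deg a)"
    then show "set r \<subseteq> L \<and> wd (fw ps @ r @ s) w \<in> N d"
    proof
      assume "r \<in> low (lev a) (deg a)"
      then have "set r \<subseteq> L" "fw ps @ r @ s \<in> low l d"
        using L Cons.prems by (auto simp: low_def)
      then show ?thesis using low_N by blast
    next
      assume "r \<in> {[fl f j] | f j. f \<in> F \<and> lev (fl f j) = lev a \<and> deg (fl f j) = deg a}"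
      then obtain f j where r: "r = [fl f j]" "f \<in> F" "lev (fl f j) = lev a" "deg (fl f j) = deg a" by blast
      have "wd (fw (ps @ [(f, j)]) @ s) w \<in> N d"
        using Cons.prems r by (intro Cons.IH) auto
      then show ?thesis using r fl_L by simp
    qed
  qed
  then show ?case by simp
qed

end

lemma word_in_N:
  assumes "set t \<subseteq> L"
  shows "wd t w \<in> N (degw t)"
  using assms
proof (induction "levw t" arbitrary: t rule: less_induct)
  case less
  have "wd (fw [] @ t) w \<in> N (degw t)"
  proof (rule level_step_N[where l = "levw t"])
    show "wd s w \<in> N (degw t)" if "s \<in> low (levw t) (degw t)" for s
      using that less.hyps[of s] unfolding low_def by force
  qed (use less.prems in auto)
  then show ?case by simp
qed

section \<open>Finitely many normal words in each degree\<close>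

definition en :: "'f \<times> int \<Rightarrow> rat" where "en = (\<lambda>(f, j). e f + of_int j)"

lemma finite_en_le: "finite {p \<in> F \<times> {0..}. en p \<le> c}"
proof (rule finite_subset)
  show "{p \<in> F \<times> {0..}. en p \<le> c} \<subseteq> (SIGMA f:F. {0..\<lfloor>c - e f\<rfloor>})"
    by (auto simp: en_def le_floor_iff algebra_simps)
qed (use fin_F in auto)

lemma degw_nor: "ps \<in> nor d \<Longrightarrow> sum en (set ps) = d"
proof -
  assume ps: "ps \<in> nor d"
  have "degw (fw qs) = sum_list (map en qs)" if "fst ` set qs \<subseteq> F" for qs
    using that by (induction qs) (auto simp: en_def deg_fl)
  moreover have "fst ` set ps \<subseteq> F" using ps by (auto simp: nor_def)
  ultimately show ?thesis using ps by (auto simp: nor_def sum_list_distinct_conv_sum_set)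
qed

text \<open>Since \<open>F\<close> is finite, only finitely many letters of nonnegative index have
  negative energy, and in a set each counts once. Their total is the bound.\<close>

lemma sum_en_lower_bound:
  obtains b where "\<And>S. finite S \<Longrightarrow> S \<subseteq> F \<times> {0..} \<Longrightarrow> b \<le> sum en S"
proof
  define Neg where "Neg = {p \<in> F \<times> {0..}. en p < 0}"
  have fin: "finite Neg" by (rule finite_subset[OF _ finite_en_le[of 0]]) (auto simp: Neg_def)
  show "sum en Neg \<le> sum en S" if S: "finite S" "S \<subseteq> F \<times> {0..}" for S
  proof -
    have "sum en Neg = sum en (Neg \<inter> S) + sum en (Neg - S)"
      by (metis fin sum.Int_Diff)
    also have "sum en (Neg - S) \<le> 0" by (rule sum_nonpos) (auto simp: Neg_def)
    also have "sum en (Neg \<inter> S) + 0 \<le> sum en S"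
      using S by (simp, intro sum_mono2) (auto simp: Neg_def)
    finally show ?thesis by simp
  qed
qed

text \<open>The other letters of a word of degree \<open>d\<close> contribute at least
  \<open>b\<close>, so each letter has energy at most \<open>d - b\<close>. This leaves finitely
  many letters, hence finitely many lists without repetition.\<close>

lemma finite_nor: "finite (nor d)"
proof -
  obtain b where b: "\<And>S. finite S \<Longrightarrow> S \<subseteq> F \<times> {0..} \<Longrightarrow> b \<le> sum en S"
    using sum_en_lower_bound by blast
  have "set ps \<subseteq> {p \<in> F \<times> {0..}. en p \<le> d - b}" if ps: "ps \<in> nor d" for ps
  proof
    fix p assume p: "p \<in> set ps"
    have F: "set ps \<subseteq> F \<times> {0..}" using ps by (auto simp: nor_def)
    have "sum en (set ps) = en p + sum en (set ps - {p})" using p by (simp add: sum.remove)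
    moreover have "b \<le> sum en (set ps - {p})" using F by (intro b) auto
    ultimately show "p \<in> {p \<in> F \<times> {0..}. en p \<le> d - b}" using degw_nor[OF ps] F p by auto
  qed
  moreover have "distinct ps" if "ps \<in> nor d" for ps using that by (simp add: nor_def)
  ultimately have "nor d \<subseteq> {ps. set ps \<subseteq> {p \<in> F \<times> {0..}. en p \<le> d - b} \<and> distinct ps}" by blast
  then show ?thesis using finite_subset_distinct[OF finite_en_le] finite_subset by blast
qed

definition X :: "rat \<Rightarrow> 'b set" where
  "X d = span {wd t w | t. set t \<subseteq> L \<and> degw t = d}"

lemma X_sub_N: "X d \<subseteq> N d"
  unfolding X_def using word_in_N by (intro span_minimal N_subspace) blast

lemma fin_dim_X: "fin_dim scale (X d)"
  unfolding fin_dim_def using X_sub_N[of d] finite_nor[of d] unfolding N_def by blast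

lemma X_bounded_below: "\<exists>b. \<forall>d<b. X d = {0}"
proof -
  obtain b where b: "\<And>S. finite S \<Longrightarrow> S \<subseteq> F \<times> {0..} \<Longrightarrow> b \<le> sum en S"
    using sum_en_lower_bound by blast
  have "X d = {0}" if "d < b" for d
  proof -
    have "nor d = {}"
    proof (rule ccontr)
      assume "nor d \<noteq> {}"
      then obtain ps where ps: "ps \<in> nor d" by auto
      have "b \<le> sum en (set ps)" using ps by (intro b) (auto simp: nor_def)
      then show False using degw_nor[OF ps] that by simp
    qed
    then have "X d \<subseteq> {0}" using X_sub_N[of d] by (simp add: N_def span_empty)
    then show ?thesis unfolding X_def using span_zero by blast
  qed
  then show ?thesis by blast
qed

end

section \<open>Vertex operator superalgebras\<close>

lemma fsum_eq_sum: "finite A \<Longrightarrow> (\<And>i. i \<notin> A \<Longrightarrow> f i = 0) \<Longrightarrow> fsum f = sum f A"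
  unfolding fsum_def by (intro sum.mono_neutral_left) auto

lemma fsum_single: "(\<And>i. i \<noteq> 0 \<Longrightarrow> f i = 0) \<Longrightarrow> fsum f = f 0"
  by (subst fsum_eq_sum[of "{0}"]) auto

context complex_vector_space
begin

lemma fsum_in_subspace: "subspace U \<Longrightarrow> (\<And>i. f i \<in> U) \<Longrightarrow> fsum f \<in> U"
  unfolding fsum_def by (intro subspace_sum) auto

text \<open>This is how the Jacobi identity serves as a rewriting rule: it is solved for one term
  modulo a subspace containing all the others. Eventual vanishing is required because a sum over an
  infinite support is 0 by convention.\<close>

lemma fsum_term_in_subspace:
  assumes "subspace U" "\<And>i. i \<ge> N \<Longrightarrow> f i = 0" "fsum f \<in> U" "\<And>i. i \<noteq> k \<Longrightarrow> f i \<in> U"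
  shows "f k \<in> U"
proof -
  have "fsum f = sum f (insert k {..<N})" using assms(2) by (intro fsum_eq_sum) auto
  also have "\<dots> = f k + sum f ({..<N} - {k})"
    by (simp add: sum.insert_remove)
  finally have "f k = fsum f - sum f ({..<N} - {k})" by simp
  moreover have "sum f ({..<N} - {k}) \<in> U" using assms(1,4) by (intro subspace_sum) auto
  ultimately show ?thesis using assms(1,3) by (metis subspace_diff)
qed

lemma span_finite_subset:
  assumes "a \<in> span A" obtains S where "finite S" "S \<subseteq> A" "a \<in> span S"
proof -
  have "\<exists>S. finite S \<and> S \<subseteq> A \<and> a \<in> span S" using assms
  proof (induction rule: span_induct_alt)
    case base
    show ?case using span_zero by blast
  next
    case (step c x y)
    then obtain S where S: "finite S" "S \<subseteq> A" "y \<in> span S" by blast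
    have "c *s x + y \<in> span (insert x S)"
      using S(3) span_mono[of S "insert x S"] by (intro span_add span_scale) (auto intro: span_base)
    then show ?case using S step(1) by (intro exI[of _ "insert x S"]) auto
  qed
  then show ?thesis using that by blast
qed

end

lemma (in endo_on) eigen_span':
  assumes "H \<subseteq> M" "\<And>h. h \<in> H \<Longrightarrow> \<exists>c. \<phi> h = c *s h" "a \<in> span H" "\<phi> a = \<mu> *s a"
  shows "a \<in> span {h\<in>H. \<phi> h = \<mu> *s h}"
proof -
  obtain c where c: "\<And>h. h \<in> H \<Longrightarrow> \<phi> h = c h *s h" using assms(2) by metis
  have "a \<in> span {h\<in>H. c h = \<mu>}" by (rule eigen_span[OF assms(1) c assms(3,4)])
  also have "\<dots> \<subseteq> span {h\<in>H. \<phi> h = \<mu> *s h}" using c by (intro span_mono) auto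
  finally show ?thesis .
qed

section \<open>A character of the rationals modulo the integers\<close>

definition chi :: "rat \<Rightarrow> complex" where
  "chi m = exp (- (2 * of_real pi * \<i> * of_rat m))"

lemma chi_add: "chi (a + b) = chi a * chi b"
  by (simp add: chi_def of_rat_add exp_add[symmetric] algebra_simps)

lemma chi_nz [simp]: "chi a \<noteq> 0" by (simp add: chi_def)

lemma chi_0 [simp]: "chi 0 = 1" by (simp add: chi_def)

lemma chi_minus: "chi (- a) = inverse (chi a)"
  using chi_add[of a "-a"] by (simp add: field_simps)

lemma chi_diff: "chi (a - b) = chi a / chi b"
  using chi_add[of a "-b"] by (simp add: chi_minus divide_inverse)

lemma chi_power: "chi a ^ n = chi (of_nat n * a)"
  by (induction n) (auto simp: chi_add[symmetric] algebra_simps)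

lemma chi_eq_1_iff: "chi a = 1 \<longleftrightarrow> a \<in> \<int>"
proof
  assume "chi a = 1"
  moreover have "(of_rat a :: complex) = of_real (of_rat a)"
    by (cases a) (simp add: of_rat_rat)
  then have "chi a = cis (- (2 * pi * of_rat a))"
    by (simp add: chi_def cis_conv_exp mult_ac)
  ultimately have "cos (2 * pi * of_rat a) = 1"
    by (metis cis.sel(1) cos_minus one_complex.sel(1))
  then obtain n :: int where "2 * pi * of_rat a = of_int n * 2 * pi"
    using cos_one_2pi_int by blast
  then have "(of_rat a :: real) = of_int n" by simp
  then have "a = of_int n" by (metis of_rat_eq_iff of_rat_of_int_eq)
  then show "a \<in> \<int>" by simp
next
  assume "a \<in> \<int>"
  then obtain n where "a = of_int n" by (auto elim: Ints_cases)
  then have "chi a = cis (2 * pi * of_int (- n))"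
    by (simp add: chi_def cis_conv_exp mult_ac)
  then show "chi a = 1" by (simp only: cis_multiple_2pi Ints_of_int)
qed

lemma chi_add_int [simp]: "chi (a + of_int n) = chi a" "chi (a - of_int n) = chi a"
  using chi_eq_1_iff[of "of_int n"] by (auto simp: chi_add chi_diff)

locale vosa = complex_vector_space sc
  for sc :: "complex \<Rightarrow> 'v::ab_group_add \<Rightarrow> 'v" (infixr "*s" 75) +
  fixes Y :: "'v \<Rightarrow> int \<Rightarrow> 'v \<Rightarrow> 'v" and vac om :: 'v and Ve Vo :: "'v set"
    and Vw :: "rat \<Rightarrow> 'v set" and g :: "'v \<Rightarrow> 'v"
  assumes VOSA: "is_VOSA sc Y vac om Ve Vo Vw"
    and aut: "is_aut sc Y vac om g"
    and fin_order: "\<exists>T>0. g ^^ T = id"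
begin

lemmas VOSA_conjuncts = VOSA[unfolded is_VOSA_def]

lemma Y_lin1: "Y (a *s u + u') n w = a *s Y u n w + Y u' n w"
  using VOSA_conjuncts[THEN conjunct2, THEN conjunct1] by blast

lemma Y_lin2: "Y u n (a *s w + w') = a *s Y u n w + Y u n w'"
  using VOSA_conjuncts[THEN conjunct2, THEN conjunct2, THEN conjunct1] by blast

lemma trunc: "\<exists>N. \<forall>n\<ge>N. Y u n w = 0"
  using VOSA_conjuncts[THEN conjunct2, THEN conjunct2, THEN conjunct2, THEN conjunct1] by blast

lemma Y_creation0: "n \<ge> 0 \<Longrightarrow> Y u n vac = 0"
  using VOSA_conjuncts[THEN conjunct2, THEN conjunct2, THEN conjunct2, THEN conjunct2, THEN conjunct2, THEN conjunct1] by blast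

lemma Y_creation: "Y u (-1) vac = u"
  using VOSA_conjuncts[THEN conjunct2, THEN conjunct2, THEN conjunct2, THEN conjunct2, THEN conjunct2, THEN conjunct2, THEN conjunct1] by blast

lemma Vw_sub: "subspace (Vw k)"
  using VOSA_conjuncts[THEN conjunct2, THEN conjunct2, THEN conjunct2, THEN conjunct2, THEN conjunct2, THEN conjunct2, THEN conjunct2, THEN conjunct1] by blast

lemma Vw_half: "Vw k \<noteq> {0} \<Longrightarrow> 2 * k \<in> \<int>"
  using VOSA_conjuncts[THEN conjunct2, THEN conjunct2, THEN conjunct2, THEN conjunct2, THEN conjunct2, THEN conjunct2, THEN conjunct2, THEN conjunct2, THEN conjunct1] by blast

lemma Vw_span: "UNIV \<subseteq> span (\<Union>(range Vw))"
  using VOSA_conjuncts[THEN conjunct2, THEN conjunct2, THEN conjunct2, THEN conjunct2, THEN conjunct2, THEN conjunct2, THEN conjunct2, THEN conjunct2, THEN conjunct2, THEN conjunct1] by blast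

lemma L0_Vw: "v \<in> Vw k \<Longrightarrow> Y om 1 v = of_rat k *s v"
  using VOSA_conjuncts[THEN conjunct2, THEN conjunct2, THEN conjunct2, THEN conjunct2, THEN conjunct2, THEN conjunct2, THEN conjunct2, THEN conjunct2, THEN conjunct2, THEN conjunct2, THEN conjunct2, THEN conjunct1] by blast

lemma Vw_bdd: "\<exists>N. \<forall>k<N. Vw k = {0}"
  using VOSA_conjuncts[THEN conjunct2, THEN conjunct2, THEN conjunct2, THEN conjunct2, THEN conjunct2, THEN conjunct2, THEN conjunct2, THEN conjunct2, THEN conjunct2, THEN conjunct2, THEN conjunct2, THEN conjunct2, THEN conjunct2, THEN conjunct1] by blast

lemma vac_Vw: "vac \<in> Vw 0"
  using VOSA_conjuncts[THEN conjunct2, THEN conjunct2, THEN conjunct2, THEN conjunct2, THEN conjunct2, THEN conjunct2, THEN conjunct2, THEN conjunct2, THEN conjunct2, THEN conjunct2, THEN conjunct2, THEN conjunct2, THEN conjunct2, THEN conjunct2, THEN conjunct1] by blast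

lemma om_Vw: "om \<in> Vw 2"
  using VOSA_conjuncts[THEN conjunct2, THEN conjunct2, THEN conjunct2, THEN conjunct2, THEN conjunct2, THEN conjunct2, THEN conjunct2, THEN conjunct2, THEN conjunct2, THEN conjunct2, THEN conjunct2, THEN conjunct2, THEN conjunct2, THEN conjunct2, THEN conjunct2, THEN conjunct1] by blast

lemma Ve_def: "Ve = span (\<Union>n\<in>{n. n \<in> \<int>}. Vw n)"
  using VOSA_conjuncts[THEN conjunct2, THEN conjunct2, THEN conjunct2, THEN conjunct2, THEN conjunct2, THEN conjunct2, THEN conjunct2, THEN conjunct2, THEN conjunct2, THEN conjunct2, THEN conjunct2, THEN conjunct2, THEN conjunct2, THEN conjunct2, THEN conjunct2, THEN conjunct2, THEN conjunct1] by blast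

lemma Vo_def: "Vo = span (\<Union>n\<in>{n. n - 1/2 \<in> \<int>}. Vw n)"
  using VOSA_conjuncts[THEN conjunct2, THEN conjunct2, THEN conjunct2, THEN conjunct2, THEN conjunct2, THEN conjunct2, THEN conjunct2, THEN conjunct2, THEN conjunct2, THEN conjunct2, THEN conjunct2, THEN conjunct2, THEN conjunct2, THEN conjunct2, THEN conjunct2, THEN conjunct2, THEN conjunct2, THEN conjunct1] by blast

lemma Y_deriv: "Y (Y om 0 u) n w = (- of_int n) *s Y u (n - 1) w"
  using VOSA_conjuncts[THEN conjunct2, THEN conjunct2, THEN conjunct2, THEN conjunct2, THEN conjunct2, THEN conjunct2, THEN conjunct2, THEN conjunct2, THEN conjunct2, THEN conjunct2, THEN conjunct2, THEN conjunct2, THEN conjunct2, THEN conjunct2, THEN conjunct2, THEN conjunct2, THEN conjunct2, THEN conjunct2, THEN conjunct2, THEN conjunct2, THEN conjunct1] by blast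

lemma jac: "u \<in> Ve \<union> Vo \<Longrightarrow> v \<in> Ve \<union> Vo \<Longrightarrow>
    fsum (\<lambda>i. ((-1) ^ i * ((of_int l :: complex) gchoose i)) *s
                  (Y u (l + m - int i) (Y v (n + int i) w)
                   - (ssign Vo u v * isign l) *s (Y v (l + n - int i) (Y u (m + int i) w))))
      = fsum (\<lambda>i. ((of_int m :: complex) gchoose i) *s (Y (Y u (l + int i) v) (m + n - int i) w))"
  using VOSA_conjuncts[THEN conjunct2, THEN conjunct2, THEN conjunct2, THEN conjunct2, THEN conjunct2, THEN conjunct2, THEN conjunct2, THEN conjunct2, THEN conjunct2, THEN conjunct2, THEN conjunct2, THEN conjunct2, THEN conjunct2, THEN conjunct2, THEN conjunct2, THEN conjunct2, THEN conjunct2, THEN conjunct2, THEN conjunct2, THEN conjunct2, THEN conjunct2] by blast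

lemma g_lin: "g (a *s u + v) = a *s g u + g v"
  using aut unfolding is_aut_def by blast

lemma g_om: "g om = om"
  using aut unfolding is_aut_def by blast

lemma g_Y: "g (Y u n v) = Y (g u) n (g v)"
  using aut unfolding is_aut_def by blast

lemma endo_Y: "endo_on sc UNIV (Y u n)"
  by unfold_locales (auto simp: Y_lin2 subspace_UNIV)

lemma endo_Y1: "endo_on sc UNIV (\<lambda>u. Y u n w)"
  by unfold_locales (auto simp: Y_lin1 subspace_UNIV)

lemma endo_g: "endo_on sc UNIV g"
  by unfold_locales (auto simp: g_lin subspace_UNIV)

lemmas Y_zero [simp] = endo_on.phi_0[OF endo_Y] endo_on.phi_0[OF endo_Y1]

lemma Y_span2: "v \<in> span A \<Longrightarrow> subspace U \<Longrightarrow> (\<And>a. a \<in> A \<Longrightarrow> Y u n a \<in> U) \<Longrightarrow> Y u n v \<in> U"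
  by (induction rule: span_induct_alt) (auto simp: Y_lin2 subspace_0 intro!: subspace_add subspace_scale)

lemma Y_span1: "u \<in> span A \<Longrightarrow> subspace U \<Longrightarrow> (\<And>a. a \<in> A \<Longrightarrow> Y a n v \<in> U) \<Longrightarrow> Y u n v \<in> U"
  by (induction rule: span_induct_alt) (auto simp: Y_lin1 subspace_0 intro!: subspace_add subspace_scale)

lemma Vw_gen: "Vw k \<subseteq> endo_on.gen sc UNIV (Y om 1) (of_rat k)"
  using endo_on.eigen_gen[OF endo_Y] L0_Vw by auto

lemma inj_of_rat: "inj_on (of_rat :: rat \<Rightarrow> complex) I"
  by (auto intro: inj_onI)

text \<open>The weight spaces span \<open>V\<close> and sit in eigenspaces for distinct eigenvalues,
  so each of them is a full eigenspace of \<open>L(0)\<close>.\<close>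

lemma Vw_iff: "v \<in> Vw k \<longleftrightarrow> Y om 1 v = of_rat k *s v"
proof
  assume v: "Y om 1 v = of_rat k *s v"
  have "v \<in> span (\<Union>i\<in>{i\<in>UNIV. of_rat i = (of_rat k :: complex)}. Vw i)"
    using endo_on.eigen_component[OF endo_Y inj_of_rat Vw_sub Vw_gen endo_on.eigen_gen[OF endo_Y UNIV_I v]]
      Vw_span by blast
  also have "(\<Union>i\<in>{i\<in>UNIV. of_rat i = (of_rat k :: complex)}. Vw i) = Vw k" by auto
  finally show "v \<in> Vw k" using span_eq_iff Vw_sub by blast
qed (rule L0_Vw)

lemma span_Vw_disjoint:
  assumes "I \<inter> J = {}" "v \<in> span (\<Union>k\<in>I. Vw k)" "v \<in> span (\<Union>k\<in>J. Vw k)"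
  shows "v = 0"
proof -
  interpret L0: endo_on sc UNIV "Y om 1" by (rule endo_Y)
  define U where "U = span (\<Union>k\<in>J. Vw k)"
  have "Y om 1 x \<in> U" if "x \<in> U" for x
    using that unfolding U_def
    by (rule Y_span2[OF _ subspace_span]) (auto simp: L0_Vw intro!: span_scale intro: span_base[OF UN_I])
  then have "L0.stable U" by (auto simp: L0.stable_def U_def subspace_span)
  then have "v \<in> span (\<Union>i\<in>I. U \<inter> Vw i)"
    using L0.stable_decomp[OF _ inj_of_rat Vw_sub Vw_gen] assms(2,3) unfolding U_def by blast
  moreover have "U \<inter> Vw i \<subseteq> {0}" if "i \<in> I" for i
  proof -
    have "U \<subseteq> span (\<Union>k\<in>UNIV - {i}. Vw k)"
      unfolding U_def using assms(1) that by (intro span_mono) blast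
    moreover have "Vw i \<inter> span (\<Union>k\<in>UNIV - {i}. Vw k) = {0}"
      using L0.gen_indep[OF inj_of_rat Vw_sub Vw_gen UNIV_I] .
    ultimately show ?thesis by blast
  qed
  ultimately have "v \<in> span {0}" using span_mono[of "\<Union>i\<in>I. U \<inter> Vw i" "{0}"] by blast
  then show ?thesis by simp
qed

lemma Ve_Vo_disjoint: "v \<in> Ve \<Longrightarrow> v \<in> Vo \<Longrightarrow> v = 0"
  unfolding Ve_def Vo_def
proof (rule span_Vw_disjoint)
  have False if "n \<in> \<int>" "n - 1/2 \<in> \<int>" for n :: rat
  proof -
    have "n - (n - 1/2) \<in> \<int>" using that by (rule Ints_diff)
    then obtain z :: int where "(1/2 :: rat) = of_int z" by (auto elim: Ints_cases)
    then have "of_int (2 * z) = (of_int 1 :: rat)" by simp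
    then have "2 * z = 1" by (simp only: of_int_eq_iff)
    then show False by presburger
  qed
  then show "{n::rat. n \<in> \<int>} \<inter> {n. n - 1/2 \<in> \<int>} = {}" by auto
qed

lemma half_int_cases: "2 * (k::rat) \<in> \<int> \<Longrightarrow> k \<in> \<int> \<or> k - 1/2 \<in> \<int>"
proof -
  assume "2 * k \<in> \<int>"
  then obtain z :: int where z: "2 * k = of_int z" by (auto elim: Ints_cases)
  show ?thesis
  proof (cases "even z")
    case True
    then obtain y where "z = 2 * y" by auto
    then have "k = of_int y" using z by simp
    then show ?thesis by simp
  next
    case False
    then obtain y where "z = 2 * y + 1" by (auto elim: oddE)
    then have "k - 1/2 = of_int y" using z by simp
    then have "k - 1/2 \<in> \<int>" by (metis Ints_of_int)
    then show ?thesis by simp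
  qed
qed

lemma Vw_Ve: "k \<in> \<int> \<Longrightarrow> Vw k \<subseteq> Ve"
  and Vw_Vo: "k - 1/2 \<in> \<int> \<Longrightarrow> Vw k \<subseteq> Vo"
  unfolding Ve_def Vo_def by (auto intro: span_base)

lemma Vw_cases: "v \<in> Vw k \<Longrightarrow> v \<in> Ve \<and> k \<in> \<int> \<or> v \<in> Vo \<and> k - 1/2 \<in> \<int> \<or> v = 0"
  using half_int_cases[of k] Vw_half[of k] Vw_Ve[of k] Vw_Vo[of k] by blast

lemma zero_Ve: "0 \<in> Ve" by (simp add: Ve_def span_zero)

lemma Vw_parity: "v \<in> Vw k \<Longrightarrow> v \<in> Ve \<union> Vo"
  using Vw_cases[of v k] zero_Ve by auto

lemma om_parity: "om \<in> Ve \<union> Vo"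
  using Vw_parity om_Vw by blast

lemma ssign_om: "om \<noteq> 0 \<Longrightarrow> ssign Vo om v = 1"
proof -
  have "om \<in> Ve" using Vw_Ve[of 2] om_Vw by auto
  then show "om \<noteq> 0 \<Longrightarrow> ssign Vo om v = 1" using Ve_Vo_disjoint by (auto simp: ssign_def)
qed

text \<open>The case \<open>l = 0\<close> of the Jacobi identity; \<open>iterate\<close> is the case
  \<open>m = 0\<close>. In each, the binomial coefficients of 0 leave a single term on one
  side.\<close>

lemma commutator:
  assumes "u \<in> Ve \<union> Vo" "v \<in> Ve \<union> Vo"
  shows "Y u m (Y v n w) - ssign Vo u v *s Y v n (Y u m w)
    = fsum (\<lambda>i. ((of_int m :: complex) gchoose i) *s Y (Y u (int i) v) (m + n - int i) w)"
  using jac[OF assms, of 0 m n w]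
  by (subst (asm) fsum_single) (auto simp: isign_def gbinomial_0_left)

lemma iterate:
  assumes "u \<in> Ve \<union> Vo" "v \<in> Ve \<union> Vo"
  shows "fsum (\<lambda>i. ((-1) ^ i * ((of_int l :: complex) gchoose i)) *s
                  (Y u (l - int i) (Y v (n + int i) w)
                   - (ssign Vo u v * isign l) *s (Y v (l + n - int i) (Y u (int i) w))))
      = Y (Y u l v) n w"
  using jac[OF assms, of l 0 n w]
  by (subst (asm) (2) fsum_single) (auto simp: gbinomial_0_left)

lemma om0: "Y om 0 u = Y u (-2) vac"
  using Y_deriv[of u "-1" vac] Y_creation[of "Y om 0 u"] by simp

lemma L0_Y:
  assumes "u \<in> Vw k" "v \<in> Vw k'"
  shows "Y u n v \<in> Vw (k + k' - of_int n - 1)"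
\<comment> \<open>The vector 0 is odd as well as even, so \<open>ssign_om\<close> speaks only of
  \<open>om \<noteq> 0\<close>. If \<open>om = 0\<close>, then \<open>L(0)\<close> and
  \<open>L(-1)\<close> vanish: nonzero homogeneous vectors have weight 0 and only the modes with
  \<open>n = -1\<close> survive.\<close>
proof (cases "om = 0")
  case True
  then have "of_rat k *s u = 0" "of_rat k' *s v = 0" using assms L0_Vw by (metis Y_zero(2))+
  then have 1: "k = 0 \<or> u = 0" "k' = 0 \<or> v = 0" by auto
  have "Y om 0 u = 0" using True by simp
  then have "(- of_int (n + 1)) *s Y u n v = 0" using Y_deriv[of u "n + 1" v] by (simp del: of_int_add)
  then have "n = -1 \<or> Y u n v = 0"
    unfolding scale_eq_0_iff neg_equal_0_iff_equal of_int_eq_0_iff by auto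
  moreover have "0 \<in> Vw j" for j using Vw_sub subspace_0 by blast
  moreover have "x \<in> Vw 0" for x using Vw_iff[of x 0] True by simp
  ultimately show ?thesis using 1 by auto
next
  case False
  have "Y om 1 (Y u n v) - Y u n (Y om 1 v) =
    fsum (\<lambda>i. ((of_int 1 :: complex) gchoose i) *s Y (Y om (int i) u) (1 + n - int i) v)"
    using commutator[OF om_parity Vw_parity[OF assms(1)], of 1 n v] ssign_om[OF False] by simp
  also have "\<dots> = (\<Sum>i\<in>{0,1}. ((of_int 1 :: complex) gchoose i) *s Y (Y om (int i) u) (1 + n - int i) v)"
  proof (rule fsum_eq_sum)
    fix i :: nat assume "i \<notin> {0, 1}"
    then have "of_nat 1 gchoose i = (0 :: complex)"
      unfolding binomial_gbinomial[symmetric] by (simp add: binomial_eq_0)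
    then show "((of_int 1 :: complex) gchoose i) *s Y (Y om (int i) u) (1 + n - int i) v = 0" by simp
  qed simp
  also have "\<dots> = (of_rat k - of_int n - 1) *s Y u n v"
    using endo_on.phi_scale[OF endo_Y1] by (simp add: Y_deriv L0_Vw[OF assms(1)] algebra_simps)
  finally have "Y om 1 (Y u n v) = (of_rat k - of_int n - 1) *s Y u n v + Y u n (Y om 1 v)"
    by (simp add: algebra_simps)
  also have "\<dots> = of_rat (k + k' - of_int n - 1) *s Y u n v"
    using endo_on.phi_scale[OF endo_Y] L0_Vw[OF assms(2)]
    by (simp add: of_rat_add of_rat_diff algebra_simps)
  finally show ?thesis by (simp add: Vw_iff)
qed

abbreviation "T \<equiv> aut_order g"

lemma T_pos: "T > 0" and g_T: "g ^^ T = id"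
proof -
  have "T > 0 \<and> g ^^ T = id"
    unfolding aut_order_def using fin_order by (rule LeastI_ex)
  then show "T > 0" "g ^^ T = id" by auto
qed

text \<open>Indexing eigenspaces by rational numbers lets the eigenvalue of a vector and its modes
  share one index: an eigenvector \<open>v\<close> can have a nonzero mode \<open>v(m)\<close> on a
  twisted module only if it lies in \<open>E m\<close>.\<close>

definition E :: "rat \<Rightarrow> 'v set" where "E m = {v. g v = chi m *s v}"

lemma twsp_E: "twsp sc g r = E (of_int r / of_nat T)"
  by (simp add: twsp_def E_def chi_def of_rat_divide)

lemma E_Y: "u \<in> E m \<Longrightarrow> v \<in> E n \<Longrightarrow> Y u l v \<in> E (m + n)"
  using endo_on.phi_scale[OF endo_Y] endo_on.phi_scale[OF endo_Y1]
  by (simp add: E_def g_Y chi_add)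

lemma E_chi_eq: "chi m = chi n \<Longrightarrow> E m = E n"
  by (simp add: E_def)

lemma E_unique: "v \<in> E m \<Longrightarrow> v \<in> E n \<Longrightarrow> v \<noteq> 0 \<Longrightarrow> chi m = chi n"
  by (auto simp: E_def)

lemma om_E: "om \<in> E 0"
  by (simp add: E_def g_om)

lemma g_Vw: "v \<in> Vw k \<Longrightarrow> g v \<in> Vw k"
  using g_Y[of om 1 v] by (simp add: Vw_iff g_om endo_on.phi_scale[OF endo_g])

lemma g_pow_Vw: "v \<in> Vw k \<Longrightarrow> (g ^^ n) v \<in> Vw k"
  by (induction n) (auto simp: g_Vw)

lemma chi_T: "of_nat T * m \<in> \<int> \<Longrightarrow> chi m ^ T = 1"
  by (simp add: chi_power chi_eq_1_iff)

definition HV :: "'v set" where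
  "HV = {v. \<exists>k m. v \<in> Vw k \<and> v \<in> E m \<and> of_nat T * m \<in> \<int>}"

text \<open>The projections onto the eigenspaces of \<open>g\<close> are discrete Fourier transforms along its powers.\<close>

lemma Vw_sub_span_HV: "Vw k \<subseteq> span HV"
proof
  fix v assume v: "v \<in> Vw k"
  define P where "P = (\<lambda>r::nat. \<Sum>s<T. chi (- of_nat (r * s) / of_nat T) *s (g ^^ s) v)"
  have "P r \<in> HV" for r
  proof -
    define z where "z = chi (- of_nat r / of_nat T)"
    have Pz: "P r = (\<Sum>s<T. z ^ s *s (g ^^ s) v)"
      unfolding P_def z_def by (intro sum.cong refl) (simp add: chi_power mult_ac)
    have zT: "z ^ T = 1"
      unfolding z_def using T_pos by (intro chi_T) simp
    define f where "f = (\<lambda>s. z ^ s *s (g ^^ s) v)"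
    have "z *s g (P r) = (\<Sum>s<T. f (Suc s))"
      unfolding Pz f_def
      by (subst endo_on.phi_sum[OF endo_g]) (auto simp: endo_on.phi_scale[OF endo_g] scale_sum_right)
    also have "\<dots> = (\<Sum>s<T. f s)"
      using sum.lessThan_Suc_shift[of f T] sum.lessThan_Suc[of f T] zT g_T by (simp add: f_def)
    finally have "z *s g (P r) = P r" by (simp add: Pz f_def)
    then have "chi (of_nat r / of_nat T) *s (z *s g (P r)) = chi (of_nat r / of_nat T) *s P r" by simp
    moreover have "chi (of_nat r / of_nat T) * z = 1"
      unfolding z_def by (simp add: chi_add[symmetric])
    ultimately have "P r \<in> E (of_nat r / of_nat T)" by (simp add: E_def)
    moreover have "P r \<in> Vw k"
      unfolding P_def using v by (intro subspace_sum Vw_sub subspace_scale g_pow_Vw)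
    moreover have "of_nat T * (of_nat r / of_nat T :: rat) \<in> \<int>" using T_pos by simp
    ultimately show ?thesis unfolding HV_def by blast
  qed
  then have "(\<Sum>r<T. P r) \<in> span HV" by (intro span_sum span_base)
  moreover have "(\<Sum>r<T. P r) = of_nat T *s v"
  proof -
    have geo: "(\<Sum>r<T. chi (- of_nat (r * s) / of_nat T)) = (if s = 0 then of_nat T else 0)" if "s < T" for s
    proof (cases "s = 0")
      case False
      define y where "y = chi (- of_nat s / of_nat T)"
      have "y \<noteq> 1"
      proof
        assume "y = 1"
        then have "- of_nat s / of_nat T \<in> (\<int> :: rat set)" by (simp add: y_def chi_eq_1_iff)
        then obtain j :: int where "- of_nat s / of_nat T = (of_int j :: rat)" by (rule Ints_cases)
        then have "- of_nat s = (of_int j * of_nat T :: rat)" using T_pos by (simp add: field_simps)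
        then have "of_int (- int s) = (of_int (j * int T) :: rat)" by simp
        then have "- int s = j * int T" by (simp only: of_int_eq_iff)
        then have "int T dvd int s" by (metis dvd_triv_right dvd_minus_iff)
        then show False using that False by (simp add: nat_dvd_not_less)
      qed
      have "(\<Sum>r<T. chi (- of_nat (r * s) / of_nat T)) = (\<Sum>r<T. y ^ r)"
        unfolding y_def by (intro sum.cong refl) (simp add: chi_power mult_ac)
      also have "\<dots> = (y ^ T - 1) / (y - 1)" using \<open>y \<noteq> 1\<close> by (rule geometric_sum)
      also have "y ^ T = 1" unfolding y_def using T_pos by (intro chi_T) simp
      finally show ?thesis using False by simp
    qed simp
    have "(\<Sum>r<T. P r) = (\<Sum>s<T. (\<Sum>r<T. chi (- of_nat (r * s) / of_nat T)) *s (g ^^ s) v)"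
      unfolding P_def by (subst sum.swap) (simp add: scale_sum_left)
    also have "\<dots> = (\<Sum>s<T. if s = 0 then of_nat T *s v else 0)"
      using geo by (intro sum.cong refl) auto
    also have "\<dots> = of_nat T *s v" using T_pos by simp
    finally show ?thesis .
  qed
  ultimately have "inverse (of_nat T) *s (of_nat T *s v) \<in> span HV" by (metis span_scale)
  then show "v \<in> span HV" using T_pos by simp
qed

lemma span_HV: "span HV = UNIV"
proof -
  have "span (\<Union>(range Vw)) \<subseteq> span HV"
    using Vw_sub_span_HV by (intro span_minimal subspace_span) blast
  then show ?thesis using Vw_span by blast
qed

lemma HV_parity: "v \<in> HV \<Longrightarrow> v \<in> Ve \<union> Vo"
  using Vw_parity by (auto simp: HV_def)

section \<open>Cofiniteness of \<open>C\<^sub>n\<close>\<close>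

definition C :: "nat \<Rightarrow> 'v set" where "C n = span {Y a (- int n) b | a b. True}"

lemma C_sub: "subspace (C n)" by (simp add: C_def subspace_span)

lemma C_base: "Y a (- int n) b \<in> C n" unfolding C_def by (intro span_base) blast

lemma C_HV: "C n = span {Y a (- int n) b | a b. a \<in> HV \<and> b \<in> HV}"
proof
  have "Y a (- int n) b \<in> span {Y a (- int n) b | a b. a \<in> HV \<and> b \<in> HV}" for a b
  proof (rule Y_span1[OF _ subspace_span])
    show "a \<in> span HV" by (simp add: span_HV)
    fix a assume "a \<in> HV"
    then show "Y a (- int n) b \<in> span {Y a (- int n) b | a b. a \<in> HV \<and> b \<in> HV}"
      by (intro Y_span2[of b HV] subspace_span) (auto simp: span_HV intro!: span_base)
  qed
  then show "C n \<subseteq> span {Y a (- int n) b | a b. a \<in> HV \<and> b \<in> HV}"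
    unfolding C_def by (intro span_minimal subspace_span) blast
qed (auto simp: C_def intro!: span_mono)

text \<open>By the derivative property, \<open>a(-m-1)\<close> is \<open>1/m\<close> times the mode
  \<open>-m\<close> of \<open>L(-1) a\<close>, so deeper modes are modes \<open>-n\<close> of other
  vectors.\<close>

lemma Y_in_C: "int n \<le> m \<Longrightarrow> n \<ge> 1 \<Longrightarrow> Y a (- m) b \<in> C n"
proof (induction m arbitrary: a rule: int_ge_induct)
  case base
  then show ?case using C_base by simp
next
  case (step m)
  have "of_int m *s Y a (- m - 1) b = Y (Y om 0 a) (- m) b"
    using Y_deriv[of a "- m" b] by simp
  moreover have "- (m + 1) = - m - 1" by simp
  ultimately have "of_int m *s Y a (- (m + 1)) b \<in> C n" using step by (simp only:)
  then have "inverse (of_int m) *s (of_int m *s Y a (- (m + 1)) b) \<in> C n"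
    using C_sub subspace_scale by blast
  then show ?case using step by simp
qed

lemma Y_in_C': "k \<le> - int n \<Longrightarrow> n \<ge> 1 \<Longrightarrow> Y a k b \<in> C n"
  using Y_in_C[of n "- k" a b] by simp

text \<open>The product \<open>b(-n) c(-n)\<close> is the only term of the iterate formula for \<open>(b(-1)c)(1-2n)\<close>
  whose membership in \<open>C\<^sub>n\<^sub>+\<^sub>1\<close> is not clear.\<close>

lemma Y_Y_in_C:
  assumes "n \<ge> 2" "b \<in> Ve \<union> Vo" "c \<in> Ve \<union> Vo"
  shows "Y b (- int n) (Y c (- int n) v) \<in> C (Suc n)"
proof -
  define f where "f = (\<lambda>i. ((-1) ^ i * ((of_int (-1) :: complex) gchoose i)) *s
                  (Y b (- 1 - int i) (Y c (1 - 2 * int n + int i) v)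
                   - (ssign Vo b c * isign (- 1)) *s (Y c (- 1 + (1 - 2 * int n) - int i) (Y b (int i) v))))"
  have coef: "(-1) ^ i * ((of_int (-1) :: complex) gchoose i) = 1" for i
    using gbinomial_minus[of "1::complex" i] by (simp add: gbinomial_of_nat_symmetric flip: power_mult_distrib)
  have second: "Y c (- 1 + (1 - 2 * int n) - int i) x \<in> C (Suc n)" for i x
    using assms(1) by (intro Y_in_C') auto
  have "f (n - 1) \<in> C (Suc n)"
  proof -
    obtain N1 where N1: "\<forall>m\<ge>N1. Y c m v = 0" using trunc by blast
    obtain N2 where N2: "\<forall>m\<ge>N2. Y b m v = 0" using trunc by blast
    show ?thesis
    proof (rule fsum_term_in_subspace[OF C_sub])
      show "f i = 0" if "nat (max (N1 + 2 * int n) N2) \<le> i" for i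
      proof -
        have "Y c (1 - 2 * int n + int i) v = 0" "Y b (int i) v = 0" using that N1 N2 by auto
        then show ?thesis by (simp add: f_def)
      qed
      have "fsum f = Y (Y b (-1) c) (1 - 2 * int n) v"
        unfolding f_def by (rule iterate[OF assms(2,3)])
      \<comment> \<open>Here \<open>n \<ge> 2\<close> is essential: it gives
        \<open>1 - 2 * n \<le> - (n + 1)\<close>.\<close>
      then show "fsum f \<in> C (Suc n)" using Y_in_C'[of "1 - 2 * int n" "Suc n"] assms(1) by simp
      fix i assume i: "i \<noteq> n - 1"
      have "Y b (- 1 - int i) (Y c (1 - 2 * int n + int i) v) \<in> C (Suc n)"
      proof (cases "i \<ge> n")
        case True
        then show ?thesis by (intro Y_in_C') auto
      next
        case False
        \<comment> \<open>The commutator brings \<open>c\<close> to the left, where its index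
          \<open>1 - 2 * n + i\<close> is at most \<open>- (n + 1)\<close>; the commutator terms
          themselves have index at most \<open>- 2 * n\<close>.\<close>
        then have i2: "i + 2 \<le> n" using i by linarith
        have "Y b (- 1 - int i) (Y c (1 - 2 * int n + int i) v)
          - ssign Vo b c *s Y c (1 - 2 * int n + int i) (Y b (- 1 - int i) v) \<in> C (Suc n)"
          unfolding commutator[OF assms(2,3)] using assms(1)
          by (intro fsum_in_subspace C_sub subspace_scale Y_in_C') auto
        moreover have "ssign Vo b c *s Y c (1 - 2 * int n + int i) (Y b (- 1 - int i) v) \<in> C (Suc n)"
          using i2 by (intro subspace_scale C_sub Y_in_C') auto
        ultimately show ?thesis using subspace_add[OF C_sub] by fastforce
      qed
      then show "f i \<in> C (Suc n)"
        unfolding f_def by (intro subspace_scale subspace_diff C_sub second)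
    qed
  qed
  moreover have "f (n - 1) = Y b (- int n) (Y c (- int n) v)
      - (ssign Vo b c * isign (- 1)) *s (Y c (- 1 + (1 - 2 * int n) - int (n - 1)) (Y b (int (n - 1)) v))"
    unfolding f_def coef using assms(1) by (simp add: of_nat_diff)
  ultimately have "Y b (- int n) (Y c (- int n) v)
      - (ssign Vo b c * isign (- 1)) *s (Y c (- 1 + (1 - 2 * int n) - int (n - 1)) (Y b (int (n - 1)) v)) \<in> C (Suc n)"
    by simp
  from subspace_add[OF C_sub this subspace_scale[OF C_sub second]] show ?thesis
    by (metis diff_add_cancel)
qed

text \<open>In the iterate formula at \<open>l = -n\<close> every left factor has index at most
  \<open>- (n + 1)\<close>, except in the leading product \<open>b(-n) c(-n)\<close>, which
  \<open>Y_Y_in_C\<close> covers.\<close>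

lemma Y_of_Y_in_C:
  assumes "n \<ge> 2" "b \<in> Ve \<union> Vo" "c \<in> Ve \<union> Vo"
  shows "Y (Y b (- int n) c) (- int n) v \<in> C (Suc n)"
proof -
  have "Y b (- int n - int i) (Y c (- int n + int i) v) \<in> C (Suc n)" for i
  proof (cases "i = 0")
    case True
    then show ?thesis using Y_Y_in_C[OF assms] by simp
  qed (auto intro!: Y_in_C')
  then show ?thesis
    unfolding iterate[OF assms(2,3), symmetric] using assms(1)
    by (intro fsum_in_subspace C_sub subspace_scale subspace_diff) (auto intro!: Y_in_C')
qed

lemma C_left: "n \<ge> 2 \<Longrightarrow> a \<in> C n \<Longrightarrow> Y a (- int n) v \<in> C (Suc n)"
  unfolding C_HV[of n] by (rule Y_span1[OF _ C_sub]) (use Y_of_Y_in_C HV_parity in blast)+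

lemma C_right:
  assumes "n \<ge> 2" "v \<in> C n"
  shows "Y a (- int n) v \<in> C (Suc n)"
proof (rule Y_span1[OF _ C_sub])
  show "a \<in> span HV" by (simp add: span_HV)
  fix a assume a: "a \<in> HV"
  show "Y a (- int n) v \<in> C (Suc n)"
    using assms(2) unfolding C_HV[of n]
    by (rule Y_span2[OF _ C_sub]) (use Y_Y_in_C[OF assms(1)] a HV_parity in blast)
qed

text \<open>By \<open>C_left\<close> and \<open>C_right\<close>, the product \<open>a(-n) b\<close>
  modulo \<open>C (Suc n)\<close> depends only on the classes of \<open>a\<close> and
  \<open>b\<close> modulo \<open>C n\<close>. Products of pairs of representatives therefore span
  \<open>C n\<close> modulo \<open>C (Suc n)\<close>.\<close>

lemma C_cofinite_step:
  assumes "n \<ge> 2" "finite F" "span (F \<union> C n) = UNIV"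
  shows "\<exists>F'. finite F' \<and> span (F' \<union> C (Suc n)) = UNIV"
proof -
  define F' where "F' = F \<union> (\<lambda>(a, b). Y a (- int n) b) ` (F \<times> F)"
  define U where "U = span (F' \<union> C (Suc n))"
  have U: "subspace U" "F' \<subseteq> U" "C (Suc n) \<subseteq> U"
    by (auto simp: U_def subspace_span intro!: span_base)
  have "Y a (- int n) b \<in> U" for a b
  proof (rule Y_span1[of a "F \<union> C n", OF _ U(1)])
    fix x assume x: "x \<in> F \<union> C n"
    show "Y x (- int n) b \<in> U"
    proof (rule Y_span2[of b "F \<union> C n", OF _ U(1)])
      fix y assume y: "y \<in> F \<union> C n"
      show "Y x (- int n) y \<in> U"
      proof (cases "x \<in> C n \<or> y \<in> C n")
        case True
        then show ?thesis using C_left[OF assms(1)] C_right[OF assms(1)] U(3) by blast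
      next
        case False
        then have "Y x (- int n) y \<in> F'" using x y by (force simp: F'_def)
        then show ?thesis using U(2) by blast
      qed
    qed (simp add: assms(3))
  qed (simp add: assms(3))
  then have "C n \<subseteq> U" unfolding C_def by (intro span_minimal U(1)) blast
  moreover have "F \<subseteq> U" using U(2) by (auto simp: F'_def)
  ultimately have "span (F \<union> C n) \<subseteq> U" by (intro span_minimal U(1)) blast
  then show ?thesis using assms(2,3) by (intro exI[of _ F']) (auto simp: F'_def U_def)
qed

lemma C_cofinite:
  assumes "C2_cofinite sc Y" "n \<ge> 2"
  obtains F where "finite F" "F \<subseteq> HV" "span (F \<union> {Y a (- int n) b | a b. a \<in> HV \<and> b \<in> HV}) = UNIV"
proof -
  have "\<exists>F. finite F \<and> span (F \<union> C n) = UNIV"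
    using assms(2)
  proof (induction n rule: dec_induct)
    case base
    have "C 2 = span {Y u (-2) v | u v. True}" by (simp add: C_def)
    then show ?case using assms(1) unfolding C2_cofinite_def by (metis Un_commute)
  next
    case (step n)
    then show ?case using C_cofinite_step by blast
  qed
  then obtain F where F: "finite F" "span (F \<union> C n) = UNIV" by blast
  \<comment> \<open>Each representative is replaced by finitely many simultaneous eigenvectors whose
    span contains it, so that a vector can later be reduced within its own weight and
    eigenvalue.\<close>
  have "\<exists>S. finite S \<and> S \<subseteq> HV \<and> f \<in> span S" for f
  proof -
    have "f \<in> span HV" by (simp add: span_HV)
    then show ?thesis by (rule span_finite_subset) blast
  qed
  then obtain S where S: "\<And>f. finite (S f) \<and> S f \<subseteq> HV \<and> f \<in> span (S f)" by metis
  define F' where "F' = \<Union>(S ` F)"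
  define U where "U = span (F' \<union> {Y a (- int n) b | a b. a \<in> HV \<and> b \<in> HV})"
  have "C n \<subseteq> U" unfolding C_HV U_def by (intro span_mono) blast
  moreover have "f \<in> U" if "f \<in> F" for f
    using S[of f] span_mono[of "S f" "F' \<union> {Y a (- int n) b | a b. a \<in> HV \<and> b \<in> HV}"] that
    by (auto simp: F'_def U_def)
  ultimately have "span (F \<union> C n) \<subseteq> U" unfolding U_def by (intro span_minimal subspace_span) blast
  then have "U = UNIV" using F(2) by blast
  then show ?thesis using that[of F'] F(1) S by (auto simp: F'_def U_def)
qed

section \<open>The parity automorphism and the order of \<open>g \<circ> par\<close>\<close>

lemma Ve_sub: "subspace Ve" and Vo_sub: "subspace Vo"
  by (simp_all add: Ve_def Vo_def subspace_span)

lemma Ve_Vo_decomp: obtains a b where "a \<in> Ve" "b \<in> Vo" "v = a + b"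
proof -
  have "\<Union>(range Vw) \<subseteq> Ve \<union> Vo"
    using Vw_parity by blast
  then have "v \<in> span (Ve \<union> Vo)" using Vw_span span_mono by blast
  moreover have "span Ve = Ve" "span Vo = Vo" using Ve_sub Vo_sub span_eq_iff by auto
  ultimately show ?thesis using that by (auto simp: span_Un)
qed

abbreviation "par \<equiv> par_aut Ve Vo"

lemma par_add:
  assumes "a \<in> Ve" "b \<in> Vo"
  shows "par (a + b) = a - b"
  unfolding par_aut_def
proof (rule the_equality)
  show "\<exists>a' b'. a' \<in> Ve \<and> b' \<in> Vo \<and> a + b = a' + b' \<and> a - b = a' - b'" using assms by blast
  fix x assume "\<exists>a' b'. a' \<in> Ve \<and> b' \<in> Vo \<and> a + b = a' + b' \<and> x = a' - b'"
  then obtain a' b' where x: "a' \<in> Ve" "b' \<in> Vo" "a + b = a' + b'" "x = a' - b'" by blast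
  then have "a - a' = b' - b" by (simp add: algebra_simps)
  moreover have "a - a' \<in> Ve" "b' - b \<in> Vo"
    using x assms Ve_sub Vo_sub by (auto intro: subspace_diff)
  ultimately have "a - a' = 0" using Ve_Vo_disjoint by metis
  then show "x = a - b" using x by simp
qed

lemma par_lin: "par (c *s x + y) = c *s par x + par y"
proof -
  obtain a b where x: "a \<in> Ve" "b \<in> Vo" "x = a + b" by (rule Ve_Vo_decomp)
  obtain a' b' where y: "a' \<in> Ve" "b' \<in> Vo" "y = a' + b'" by (rule Ve_Vo_decomp)
  have "c *s a + a' \<in> Ve" "c *s b + b' \<in> Vo"
    using x y Ve_sub Vo_sub by (auto intro!: subspace_add subspace_scale)
  then have "par ((c *s a + a') + (c *s b + b')) = (c *s a + a') - (c *s b + b')" by (rule par_add)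
  moreover have "(c *s a + a') + (c *s b + b') = c *s x + y" by (simp add: x y algebra_simps)
  moreover have "(c *s a + a') - (c *s b + b') = c *s (a - b) + (a' - b')" by (simp add: algebra_simps)
  ultimately show ?thesis using par_add x y by metis
qed

lemma chi_half: "chi (1/2) = -1"
proof -
  have "(chi (1/2))\<^sup>2 = chi 1" by (simp add: chi_power)
  also have "chi 1 = 1" by (simp add: chi_eq_1_iff)
  finally have "(chi (1/2))\<^sup>2 = 1" .
  moreover have "chi (1/2) \<noteq> 1"
  proof
    assume "chi (1/2) = 1"
    then have "(1/2 :: rat) \<in> \<int>" by (simp add: chi_eq_1_iff)
    then obtain z :: int where "(1/2 :: rat) = of_int z" by (rule Ints_cases)
    then have "of_int (2 * z) = (of_int 1 :: rat)" by simp
    then have "2 * z = 1" by (simp only: of_int_eq_iff)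
    then show False by presburger
  qed
  ultimately show ?thesis by (simp add: power2_eq_1_iff)
qed

text \<open>Parity is read off from the weight, and \<open>chi (1/2) = -1\<close>. Thus parity and
  twist are described by the same character, and \<open>g \<circ> par\<close> acts on a vector of
  \<open>Vw k\<close> and \<open>E m\<close> by \<open>chi (k + m)\<close>.\<close>

lemma par_Vw:
  assumes "v \<in> Vw k"
  shows "par v = chi k *s v"
proof -
  consider "v \<in> Ve" "k \<in> \<int>" | "v \<in> Vo" "k - 1/2 \<in> \<int>" | "v = 0" using Vw_cases[OF assms] by auto
  then show ?thesis
  proof cases
    case 1
    then have "par v = v" using par_add[of v 0] Vo_sub subspace_0 by fastforce
    moreover have "chi k = 1" using 1 by (simp add: chi_eq_1_iff)
    ultimately show ?thesis by simp
  next
    case 2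
    then have "par v = - v" using par_add[of 0 v] zero_Ve by simp
    moreover have "chi (k - 1/2) = 1" using 2 by (simp add: chi_eq_1_iff)
    then have "- chi k = 1" by (simp add: chi_diff chi_half)
    then have "chi k = -1" by (metis minus_equation_iff)
    ultimately show ?thesis by simp
  next
    case 3
    then show ?thesis using par_add[of 0 0] zero_Ve Vo_sub subspace_0 by fastforce
  qed
qed

abbreviation "T' \<equiv> aut_order (g \<circ> par)"

lemma gpar_pow: "v \<in> Vw k \<Longrightarrow> v \<in> E m \<Longrightarrow> ((g \<circ> par) ^^ n) v = chi (of_nat n * (k + m)) *s v"
proof (induction n)
  case (Suc n)
  then have "((g \<circ> par) ^^ n) v = chi (of_nat n * (k + m)) *s v" by blast
  then have "((g \<circ> par) ^^ Suc n) v = g (par (chi (of_nat n * (k + m)) *s v))"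
    by (simp only: funpow.simps(2) comp_apply)
  also have "\<dots> = g (chi k *s (chi (of_nat n * (k + m)) *s v))"
    using par_Vw[OF subspace_scale[OF Vw_sub Suc.prems(1)]] by simp
  also have "\<dots> = (chi k * chi (of_nat n * (k + m)) * chi m) *s v"
    using Suc.prems(2) by (simp add: endo_on.phi_scale[OF endo_g] E_def)
  also have "chi k * chi (of_nat n * (k + m)) * chi m = chi (of_nat (Suc n) * (k + m))"
    by (simp add: chi_add[symmetric] algebra_simps)
  finally show ?case .
qed simp

lemma gpar_pow_lin: "((g \<circ> par) ^^ n) (c *s u + v) = c *s ((g \<circ> par) ^^ n) u + ((g \<circ> par) ^^ n) v"
  by (induction n) (auto simp: par_lin g_lin)

text \<open>The power \<open>2 * T\<close> of \<open>g \<circ> par\<close> fixes every simultaneous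
  eigenvector, because \<open>2 * k\<close> and \<open>T * m\<close> are integers; so the
  \<open>LEAST\<close> in \<open>aut_order\<close> is attained.\<close>

lemma T'_pos: "T' > 0" and gpar_T': "(g \<circ> par) ^^ T' = id"
proof -
  have "((g \<circ> par) ^^ (2 * T)) v = v" for v
  proof -
    interpret P: endo_on sc UNIV "(g \<circ> par) ^^ (2 * T)"
      by unfold_locales (simp_all add: gpar_pow_lin subspace_UNIV)
    have "v \<in> span HV" by (simp add: span_HV)
    then show ?thesis
    proof (induction rule: span_induct_alt)
      case base
      show ?case by (rule P.phi_0)
    next
      case (step c x y)
      obtain k m where x: "x \<in> Vw k" "x \<in> E m" "of_nat T * m \<in> \<int>" using step(1) by (auto simp: HV_def)
      have "((g \<circ> par) ^^ (2 * T)) x = x"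
      proof (cases "x = 0")
        case False
        then have "2 * k \<in> \<int>" using x(1) Vw_half by blast
        then have "of_nat T * (2 * k) \<in> \<int>" by (rule Ints_mult[OF Ints_of_nat])
        moreover have "2 * (of_nat T * m) \<in> \<int>" using x(3) by (rule Ints_mult[OF Ints_numeral])
        ultimately have "of_nat T * (2 * k) + 2 * (of_nat T * m) \<in> \<int>" by (rule Ints_add)
        then have "chi (of_nat (2 * T) * (k + m)) = 1" by (simp add: chi_eq_1_iff algebra_simps)
        then show ?thesis unfolding gpar_pow[OF x(1,2)] by simp
      qed (simp add: P.phi_0)
      then show ?case using step P.phi_lin[OF UNIV_I UNIV_I, of c x y] by (simp only:)
    qed
  qed
  then have "(g \<circ> par) ^^ (2 * T) = id" by auto
  then have "\<exists>n>0. (g \<circ> par) ^^ n = id" using T_pos by (intro exI[of _ "2 * T"]) auto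
  then have "T' > 0 \<and> (g \<circ> par) ^^ T' = id"
    unfolding aut_order_def by (rule LeastI_ex)
  then show "T' > 0" "(g \<circ> par) ^^ T' = id" by auto
qed

text \<open>The eigenvalue \<open>chi (k + m)\<close> of \<open>g \<circ> par\<close> makes
  \<open>T' * (k + m)\<close> an integer. Subtracting it from the integer
  \<open>T' * (2 * k)\<close> turns \<open>k + m\<close> into \<open>k - m\<close>.\<close>

lemma degree_T'_int:
  assumes "v \<in> Vw k" "v \<in> E m" "v \<noteq> 0"
  shows "(k - m - 1) * of_nat T' \<in> \<int>"
proof -
  have "chi (of_nat T' * (k + m)) *s v = v" using gpar_pow[OF assms(1,2), of T'] gpar_T' by simp
  then have "chi (of_nat T' * (k + m)) = 1" using assms(3) by (metis scale_cancel_right scale_one)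
  then have "of_nat T' * (k + m) \<in> \<int>" by (simp add: chi_eq_1_iff)
  moreover have "2 * k \<in> \<int>" using assms(1,3) Vw_half by blast
  then have "of_nat T' * (2 * k) \<in> \<int>" by (rule Ints_mult[OF Ints_of_nat])
  ultimately have "of_nat T' * (2 * k) - of_nat T' * (k + m) - of_nat T' \<in> \<int>"
    by (intro Ints_diff Ints_of_nat)
  moreover have "of_nat T' * (2 * k) - of_nat T' * (k + m) - of_nat T' = (k - m - 1) * of_nat T'"
    by (simp add: algebra_simps)
  ultimately show ?thesis by metis
qed

text \<open>Weights may be negative; adding \<open>shift\<close> makes every letter of nonnegative level.\<close>

definition shift :: nat where
  "shift = (SOME c. c \<ge> 1 \<and> (\<forall>k. Vw k \<noteq> {0} \<longrightarrow> k + of_nat c \<ge> 0))"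

lemma shift: "shift \<ge> 1" "v \<in> Vw k \<Longrightarrow> v \<noteq> 0 \<Longrightarrow> k + of_nat shift \<ge> 0"
proof -
  obtain N where N: "\<forall>k<N. Vw k = {0}" using Vw_bdd by blast
  obtain n :: nat where n: "- N < of_nat n" using reals_Archimedean2 by blast
  have "k + of_nat (Suc n) \<ge> 0" if "Vw k \<noteq> {0}" for k
  proof -
    have "N \<le> k" using N that by (meson not_le)
    then have "0 \<le> k + of_nat n" using n by linarith
    then show ?thesis by simp
  qed
  then have "\<exists>c. c \<ge> 1 \<and> (\<forall>k. Vw k \<noteq> {0} \<longrightarrow> k + of_nat c \<ge> 0)" by (intro exI[of _ "Suc n"]) auto
  then have "shift \<ge> 1 \<and> (\<forall>k. Vw k \<noteq> {0} \<longrightarrow> k + of_nat shift \<ge> 0)"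
    unfolding shift_def by (rule someI_ex)
  then show "shift \<ge> 1" "v \<in> Vw k \<Longrightarrow> v \<noteq> 0 \<Longrightarrow> k + of_nat shift \<ge> 0" by auto
qed

text \<open>A letter \<open>(v, k, m)\<close> stands for the mode \<open>v(m)\<close> of a homogeneous \<open>v\<close> of weight \<open>k\<close>.\<close>

definition L :: "('v \<times> rat \<times> rat) set" where
  "L = {(v, k, m). v \<in> Vw k \<and> v \<in> E m \<and> of_nat T * m \<in> \<int> \<and> v \<noteq> 0}"

text \<open>Weights may be half-integral; doubling makes the level a natural number, fit for
  induction.\<close>

definition lev :: "'v \<times> rat \<times> rat \<Rightarrow> nat" where
  "lev = (\<lambda>(v, k, m). nat \<lfloor>2 * (k + of_nat shift)\<rfloor>)"

definition deg :: "'v \<times> rat \<times> rat \<Rightarrow> rat" where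
  "deg = (\<lambda>(v, k, m). k - m - 1)"

lemma of_nat_lev:
  assumes "(v, k, m) \<in> L"
  shows "of_nat (lev (v, k, m)) = 2 * (k + of_nat shift)"
proof -
  have v: "v \<in> Vw k" "v \<noteq> 0" using assms by (auto simp: L_def)
  then have "2 * k \<in> \<int>" using Vw_half by blast
  then have "2 * k + of_nat (2 * shift) \<in> \<int>" by (intro Ints_add) auto
  then have "2 * (k + of_nat shift) \<in> \<int>" by (simp add: algebra_simps)
  then obtain z where z: "2 * (k + of_nat shift) = of_int z" by (rule Ints_cases)
  moreover have "0 \<le> (of_int z :: rat)" using shift(2)[OF v] z by simp
  ultimately show ?thesis by (simp add: lev_def del: distrib_left_numeral)
qed

lemma deg_T'_int: "a \<in> L \<Longrightarrow> deg a * of_nat T' \<in> \<int>"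
  using degree_T'_int by (auto simp: L_def deg_def)

lemma T_int_add: "of_nat T * m \<in> \<int> \<Longrightarrow> of_nat T * n \<in> \<int> \<Longrightarrow> of_nat T * (m + n) \<in> \<int>"
  and T_int_diff: "of_nat T * m \<in> \<int> \<Longrightarrow> of_nat T * n \<in> \<int> \<Longrightarrow> of_nat T * (m - n) \<in> \<int>"
  for m n :: rat
  by (simp_all add: distrib_left right_diff_distrib)

lemma T_int_int [simp]: "of_nat T * (of_int n :: rat) \<in> \<int>" "of_nat T * (of_nat i :: rat) \<in> \<int>"
  by (simp_all add: Ints_mult)

end

section \<open>Twisted modules\<close>

locale tw_module = vosa sc Y vac om Ve Vo Vw g + mv: complex_vector_space scM
  for sc :: "complex \<Rightarrow> 'v::ab_group_add \<Rightarrow> 'v" (infixr "*s" 75)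
    and Y vac om Ve Vo Vw g
    and scM :: "complex \<Rightarrow> 'm::ab_group_add \<Rightarrow> 'm" (infixr "*m" 75) +
  fixes M :: "'m set" and YM :: "'v \<Rightarrow> rat \<Rightarrow> 'm \<Rightarrow> 'm"
  assumes weak: "weak_tw_module sc Y vac Ve Vo g scM M YM"
begin

lemmas weak_conjuncts = weak[unfolded weak_tw_module_def]

lemma M_sub: "mv.subspace M"
  using weak_conjuncts[THEN conjunct2, THEN conjunct1] by blast

lemma YM_M: "x \<in> M \<Longrightarrow> YM v m x \<in> M"
  using weak_conjuncts[THEN conjunct2, THEN conjunct2, THEN conjunct1] by blast

lemma YM_lin1: "x \<in> M \<Longrightarrow> YM (a *s u + u') m x = a *m YM u m x + YM u' m x"
  using weak_conjuncts[THEN conjunct2, THEN conjunct2, THEN conjunct2, THEN conjunct1] by blast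

lemma YM_lin2: "x \<in> M \<Longrightarrow> y \<in> M \<Longrightarrow> YM v m (a *m x + y) = a *m YM v m x + YM v m y"
  using weak_conjuncts[THEN conjunct2, THEN conjunct2, THEN conjunct2, THEN conjunct2, THEN conjunct1] by blast

lemma YM_trunc: "x \<in> M \<Longrightarrow> \<exists>N. \<forall>m\<ge>N. YM v m x = 0"
  using weak_conjuncts[THEN conjunct2, THEN conjunct2, THEN conjunct2, THEN conjunct2, THEN conjunct2, THEN conjunct2, THEN conjunct1] by blast

lemma YM_vac: "x \<in> M \<Longrightarrow> YM vac m x = (if m = -1 then x else 0)"
  using weak_conjuncts[THEN conjunct2, THEN conjunct2, THEN conjunct2, THEN conjunct2, THEN conjunct2, THEN conjunct2, THEN conjunct2, THEN conjunct1] by blast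

lemma YM_coset:
  assumes "v \<in> E n" "of_nat T * n \<in> \<int>" "m - n \<notin> \<int>" "x \<in> M"
  shows "YM v m x = 0"
proof -
  obtain r where r: "of_nat T * n = of_int r" using assms(2) by (rule Ints_cases)
  then have n: "n = of_int r / of_nat T" using T_pos by (simp add: field_simps)
  then have "v \<in> twsp sc g r" using assms(1) by (simp add: twsp_E)
  then show ?thesis
    using weak_conjuncts[THEN conjunct2, THEN conjunct2, THEN conjunct2, THEN conjunct2, THEN conjunct2, THEN conjunct1]
      assms(3,4) n by blast
qed

lemma mjac:
  assumes "u \<in> E m" "of_nat T * m \<in> \<int>" "u \<in> Ve \<union> Vo" "v \<in> Ve \<union> Vo" "x \<in> M"
  shows "fsum (\<lambda>i. ((-1) ^ i * ((of_int l :: complex) gchoose i)) *m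
                  (YM u (of_int l + m - of_nat i) (YM v (n + of_nat i) x)
                   - (ssign Vo u v * isign l) *m (YM v (of_int l + n - of_nat i) (YM u (m + of_nat i) x))))
      = fsum (\<lambda>i. ((of_rat m :: complex) gchoose i) *m (YM (Y u (l + int i) v) (m + n - of_nat i) x))"
proof -
  obtain r where r: "of_nat T * m = of_int r" using assms(2) by (rule Ints_cases)
  then have m: "m = of_int r / of_nat T" using T_pos by (simp add: field_simps)
  then have u: "u \<in> twsp sc g r" using assms(1) by (simp add: twsp_E)
  have int: "m - of_int r / of_nat T \<in> \<int>" by (simp add: m[symmetric])
  have J: "\<forall>r u v l m n. \<forall>w\<in>M. u \<in> twsp sc g r \<longrightarrow> u \<in> Ve \<union> Vo \<longrightarrow> v \<in> Ve \<union> Vo \<longrightarrow>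
        m - of_int r / of_nat (aut_order g) \<in> \<int> \<longrightarrow>
        fsum (\<lambda>i. ((-1) ^ i * ((of_int l :: complex) gchoose i)) *m
                  (YM u (of_int l + m - of_nat i) (YM v (n + of_nat i) w)
                   - (ssign Vo u v * isign l) *m (YM v (of_int l + n - of_nat i) (YM u (m + of_nat i) w))))
      = fsum (\<lambda>i. ((of_rat m :: complex) gchoose i) *m (YM (Y u (l + int i) v) (m + n - of_nat i) w))"
    by (intro weak_conjuncts[THEN conjunct2, THEN conjunct2, THEN conjunct2, THEN conjunct2, THEN conjunct2,
          THEN conjunct2, THEN conjunct2, THEN conjunct2])
  show ?thesis using J assms(3-5) u int by blast
qed

lemma endo_YM: "endo_on scM M (YM v m)"
  by unfold_locales (auto simp: M_sub YM_M YM_lin2)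

lemma YM_zero2 [simp]: "YM v m 0 = 0"
  by (rule endo_on.phi_0[OF endo_YM])

lemma YM_zero1 [simp]: "x \<in> M \<Longrightarrow> YM 0 m x = 0"
  using YM_lin1[of x "-1" 0 0 m] by simp

lemma YM_scale1: "x \<in> M \<Longrightarrow> YM (a *s u) m x = a *m YM u m x"
  using YM_lin1[of x a u 0 m] by simp

lemma YM_span1:
  assumes "v \<in> span A" "x \<in> M" "mv.subspace U" "\<And>a. a \<in> A \<Longrightarrow> YM a m x \<in> U"
  shows "YM v m x \<in> U"
  using assms(1)
  by (induction rule: span_induct_alt)
     (use assms in \<open>auto simp: YM_lin1 mv.subspace_0 intro!: mv.subspace_add mv.subspace_scale\<close>)

lemma mcommutator:
  assumes "u \<in> E m" "of_nat T * m \<in> \<int>" "u \<in> Ve \<union> Vo" "v \<in> Ve \<union> Vo" "x \<in> M"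
  shows "YM u m (YM v n x) - ssign Vo u v *m YM v n (YM u m x)
    = fsum (\<lambda>i. ((of_rat m :: complex) gchoose i) *m YM (Y u (int i) v) (m + n - of_nat i) x)"
  using mjac[OF assms, of 0 n]
  by (subst (asm) fsum_single) (auto simp: isign_def gbinomial_0_left)

lemma YM_deriv:
  assumes "u \<in> E m" "of_nat T * m \<in> \<int>" "u \<in> Ve \<union> Vo" "x \<in> M"
  shows "YM (Y om 0 u) m x = (- of_rat m) *m YM u (m - 1) x"
proof -
  have vac: "vac \<in> Ve \<union> Vo" using vac_Vw Vw_parity by blast
  \<comment> \<open>The Jacobi identity for \<open>u\<close> and the vacuum at
    \<open>l = -2\<close>, with second mode 0. The mode -1 of the vacuum does not occur among the
    products, so the side with \<open>u(-2) vac = L(-1) u\<close> and \<open>u(-1) vac = u\<close>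
    vanishes.\<close>
  have "fsum (\<lambda>i. ((of_rat m :: complex) gchoose i) *m (YM (Y u (- 2 + int i) vac) (m + 0 - of_nat i) x))
    = fsum (\<lambda>i. ((-1) ^ i * ((of_int (- 2) :: complex) gchoose i)) *m
                  (YM u (of_int (- 2) + m - of_nat i) (YM vac (0 + of_nat i) x)
                   - (ssign Vo u vac * isign (- 2)) *m (YM vac (of_int (- 2) + 0 - of_nat i) (YM u (m + of_nat i) x))))"
    by (rule mjac[OF assms(1-3) vac assms(4), symmetric])
  also have "\<dots> = 0"
  proof -
    have "(of_nat i :: rat) \<noteq> -1" "- 2 - (of_nat i :: rat) \<noteq> -1" for i
      using of_nat_0_le_iff[of i, where 'a = rat] by linarith+
    then show ?thesis using YM_vac assms(4) YM_M by (simp add: fsum_def)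
  qed
  also have "fsum (\<lambda>i. ((of_rat m :: complex) gchoose i) *m (YM (Y u (- 2 + int i) vac) (m + 0 - of_nat i) x))
    = (\<Sum>i\<in>{0, 1}. ((of_rat m :: complex) gchoose i) *m (YM (Y u (- 2 + int i) vac) (m + 0 - of_nat i) x))"
    using Y_creation0[of "- 2 + int i" u for i] assms(4) by (intro fsum_eq_sum) auto
  also have "\<dots> = YM (Y om 0 u) m x + of_rat m *m YM u (m - 1) x"
    by (simp add: om0 Y_creation)
  finally show ?thesis by (simp add: eq_neg_iff_add_eq_0)
qed

abbreviation "L0 \<equiv> YM om 1"

lemma L0_YM:
  assumes "u \<in> Vw k" "u \<in> E m" "of_nat T * m \<in> \<int>" "x \<in> M"
  shows "L0 (YM u m x) = YM u m (L0 x) + of_rat (k - m - 1) *m YM u m x"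
proof -
  have E1: "om \<in> E 1" using om_E E_chi_eq[of 0 1] by (simp add: chi_eq_1_iff[of 1, THEN iffD2])
  have T1: "of_nat T * (1 :: rat) \<in> \<int>" by simp
  have p: "u \<in> Ve \<union> Vo" using Vw_parity assms(1) by blast
  have s: "ssign Vo om u *m YM u m (L0 x) = YM u m (L0 x)"
  proof (cases "om = 0")
    case False
    then show ?thesis using ssign_om by simp
  qed (use assms(4) in simp)
  have "L0 (YM u m x) - YM u m (L0 x)
    = fsum (\<lambda>i. ((of_rat 1 :: complex) gchoose i) *m YM (Y om (int i) u) (1 + m - of_nat i) x)"
    using mcommutator[OF E1 T1 om_parity p assms(4), of m] s by simp
  also have "\<dots> = (\<Sum>i\<in>{0,1}. ((of_rat 1 :: complex) gchoose i) *m YM (Y om (int i) u) (1 + m - of_nat i) x)"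
  proof (rule fsum_eq_sum)
    fix i :: nat assume "i \<notin> {0, 1}"
    then have "of_nat 1 gchoose i = (0 :: complex)"
      unfolding binomial_gbinomial[symmetric] by (simp add: binomial_eq_0)
    then show "((of_rat 1 :: complex) gchoose i) *m YM (Y om (int i) u) (1 + m - of_nat i) x = 0" by simp
  qed simp
  also have "\<dots> = YM (Y om 0 u) (1 + m) x + YM (Y om 1 u) m x" by simp
  also have "YM (Y om 0 u) (1 + m) x = (- of_rat (1 + m)) *m YM u m x"
  proof -
    have "chi (1 + m) = chi m" using chi_add_int(1)[of m 1] by (simp add: add.commute)
    then have "u \<in> E (1 + m)" using assms(2) E_chi_eq by metis
    moreover have "of_nat T * (1 + m) \<in> \<int>" using T_int_add[OF T1 assms(3)] .
    ultimately show ?thesis using YM_deriv[of u "1 + m" x] p assms(4) by simp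
  qed
  also have "YM (Y om 1 u) m x = of_rat k *m YM u m x"
    using L0_Vw[OF assms(1)] YM_scale1 assms(4) by simp
  finally show ?thesis
    by (simp add: of_rat_add of_rat_diff algebra_simps)
qed

section \<open>Reduction rules for words of modes\<close>

definition opr :: "'v \<times> rat \<times> rat \<Rightarrow> 'm \<Rightarrow> 'm" where "opr = (\<lambda>(v, k, m). YM v m)"

definition lowset :: "nat \<Rightarrow> rat \<Rightarrow> ('v \<times> rat \<times> rat) list set" where
  "lowset l d = {t. set t \<subseteq> L \<and> sum_list (map lev t) < l \<and> sum_list (map deg t) = d}"

definition Xw :: "'m \<Rightarrow> rat \<Rightarrow> 'm set" where
  "Xw w d = mv.span {foldr opr t w | t. set t \<subseteq> L \<and> sum_list (map deg t) = d}"

lemma single_low: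
  assumes "v \<in> Vw k" "v \<in> E m" "of_nat T * m \<in> \<int>" "x \<in> M"
    and "2 * (k + of_nat shift) < of_nat l" "k - m - 1 = d" "mv.subspace U"
    and "(\<lambda>t. foldr opr t x) ` lowset l d \<subseteq> U"
  shows "YM v m x \<in> U"
proof (cases "v = 0")
  case True
  then show ?thesis using assms(4,7) mv.subspace_0 by simp
next
  case False
  then have a: "(v, k, m) \<in> L" using assms by (simp add: L_def)
  then have "of_nat (lev (v, k, m)) < (of_nat l :: rat)" using of_nat_lev assms(5) by simp
  then have "[(v, k, m)] \<in> lowset l d" using a assms(6) by (simp add: lowset_def deg_def)
  then have "foldr opr [(v, k, m)] x \<in> U" using assms(8) by blast
  then show ?thesis by (simp add: opr_def)
qed

lemma pair_low:
  assumes "u \<in> Vw k" "u \<in> E m" "of_nat T * m \<in> \<int>" "v \<in> Vw k'" "v \<in> E n" "of_nat T * n \<in> \<int>" "x \<in> M"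
    and "2 * (k + of_nat shift) + 2 * (k' + of_nat shift) < of_nat l"
    and "k - m - 1 + (k' - n - 1) = d" "mv.subspace U"
    and "(\<lambda>t. foldr opr t x) ` lowset l d \<subseteq> U"
  shows "YM u m (YM v n x) \<in> U"
proof (cases "u = 0 \<or> v = 0")
  case True
  then show ?thesis using assms(7,10) mv.subspace_0 YM_M by auto
next
  case False
  then have a: "(u, k, m) \<in> L" "(v, k', n) \<in> L" using assms by (auto simp: L_def)
  then have "of_nat (lev (u, k, m) + lev (v, k', n)) < (of_nat l :: rat)" using of_nat_lev assms(8) by simp
  then have "lev (u, k, m) + lev (v, k', n) < l" by (simp only: of_nat_less_iff)
  then have "[(u, k, m), (v, k', n)] \<in> lowset l d" using a assms(9) by (simp add: lowset_def deg_def)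
  then have "foldr opr [(u, k, m), (v, k', n)] x \<in> U" using assms(11) by blast
  then show ?thesis by (simp add: opr_def)
qed

lemma chi_sub_nat: "chi (m - of_nat i) = chi m" "chi (m + of_nat i) = chi m"
  using chi_add_int[of m "int i"] by auto

text \<open>The commutator consists of single modes of \<open>u(i) v\<close>. Their weight is at
  most \<open>k + k' - 1\<close> and they pay \<open>shift\<close> once instead of twice, so they
  are of lower level.\<close>

lemma swap_letters:
  assumes "a \<in> L" "b \<in> L" "x \<in> M"
  shows "opr a (opr b x) \<in> mv.span ((\<lambda>t. foldr opr t x) ` ({[b, a]} \<union> lowset (lev a + lev b) (deg a + deg b)))"
    (is "_ \<in> ?U")
proof -
  obtain u k m v k' n where ab: "a = (u, k, m)" "b = (v, k', n)" by (metis surj_pair)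
  have u: "u \<in> Vw k" "u \<in> E m" "of_nat T * m \<in> \<int>" and v: "v \<in> Vw k'" "v \<in> E n" "of_nat T * n \<in> \<int>"
    using assms ab by (auto simp: L_def)
  have U: "mv.subspace ?U" by (rule mv.subspace_span)
  have low: "(\<lambda>t. foldr opr t x) ` lowset (lev a + lev b) (deg a + deg b) \<subseteq> ?U"
    by (auto intro: mv.span_base)
  have "YM (Y u (int i) v) (m + n - of_nat i) x \<in> ?U" for i
  proof (rule single_low[OF _ _ _ assms(3) _ _ U low])
    show "Y u (int i) v \<in> Vw (k + k' - of_int (int i) - 1)" by (rule L0_Y[OF u(1) v(1)])
    show "Y u (int i) v \<in> E (m + n - of_nat i)"
      using E_Y[OF u(2) v(2)] E_chi_eq[OF chi_sub_nat(1)] by blast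
    show "of_nat T * (m + n - of_nat i) \<in> \<int>" using u v by (intro T_int_diff T_int_add) auto
    have "(of_nat (lev a + lev b) :: rat) = 2 * (k + of_nat shift) + 2 * (k' + of_nat shift)"
      using of_nat_lev assms ab by simp
    moreover have "(1 :: rat) \<le> of_nat shift" using shift(1) by simp
    ultimately show "2 * (k + k' - of_int (int i) - 1 + of_nat shift) < of_nat (lev a + lev b)"
      using of_nat_0_le_iff[of i, where 'a = rat] by simp
  qed (simp add: ab deg_def)
  then have "YM u m (YM v n x) - ssign Vo u v *m YM v n (YM u m x) \<in> ?U"
    unfolding mcommutator[OF u(2,3) Vw_parity[OF u(1)] Vw_parity[OF v(1)] assms(3)]
    by (intro mv.fsum_in_subspace U mv.subspace_scale)
  moreover have "foldr opr [b, a] x \<in> ?U" by (intro mv.span_base) blast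
  then have "ssign Vo u v *m YM v n (YM u m x) \<in> ?U"
    using mv.subspace_scale[OF U] by (simp add: ab opr_def)
  ultimately have "YM u m (YM v n x) \<in> ?U" using mv.subspace_add[OF U] by fastforce
  then show ?thesis by (simp add: ab opr_def)
qed

lemma YM_trunc_nat: "x \<in> M \<Longrightarrow> \<exists>N. \<forall>i\<ge>N. YM v (m + of_nat i) x = 0"
proof -
  assume "x \<in> M"
  then obtain N where N: "\<forall>m\<ge>N. YM v m x = 0" using YM_trunc by blast
  obtain n :: nat where "N - m < of_nat n" using reals_Archimedean2 by blast
  then have "N \<le> m + of_nat i" if "i \<ge> n" for i
    using that of_nat_mono[of n i, where 'a = rat] by linarith
  then show ?thesis using N by blast
qed

text \<open>The Jacobi identity for \<open>f\<close> with itself at \<open>l = -1\<close> and modes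
  \<open>p + 1\<close> and \<open>p\<close> contains \<open>f(p) f(p)\<close> exactly once, whatever
  the parity; its other products have unequal modes with sum \<open>2 * p\<close>. The remaining
  side has modes of \<open>f(-1+i) f\<close> of weight at most \<open>2 * k\<close>, and their level
  is lower because \<open>shift \<ge> 1\<close>.\<close>

lemma spread_letters:
  assumes f: "f \<in> Vw k" "f \<in> E p" "of_nat T * p \<in> \<int>" "f \<noteq> 0" and x: "x \<in> M"
  shows "YM f p (YM f p x) \<in> mv.span ({YM f (p - of_int i) (YM f (p + of_int i) x) | i. i \<noteq> 0}
    \<union> (\<lambda>t. foldr opr t x) ` lowset (2 * lev (f, k, p)) (2 * deg (f, k, p)))"
    (is "_ \<in> ?U")
proof -
  define U where "U = ?U"
  have U: "mv.subspace U" unfolding U_def by (rule mv.subspace_span)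
  have low: "(\<lambda>t. foldr opr t x) ` lowset (2 * lev (f, k, p)) (2 * deg (f, k, p)) \<subseteq> U"
    unfolding U_def by (auto intro: mv.span_base)
  have far: "YM f (p - of_int i) (YM f (p + of_int i) x) \<in> U" if "i \<noteq> 0" for i
    using that unfolding U_def by (intro mv.span_base) blast
  have p1: "f \<in> E (p + 1)" "of_nat T * (p + 1) \<in> \<int>"
    using f(2) E_chi_eq[of "p + 1" p] chi_add_int(1)[of p 1] T_int_add[OF f(3), of 1] by auto
  note fp = Vw_parity[OF f(1)]
  define t where "t = (\<lambda>i. ((-1) ^ i * ((of_int (- 1) :: complex) gchoose i)) *m
                  (YM f (of_int (- 1) + (p + 1) - of_nat i) (YM f (p + of_nat i) x)
                   - (ssign Vo f f * isign (- 1)) *m (YM f (of_int (- 1) + p - of_nat i) (YM f (p + 1 + of_nat i) x))))"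
  have second: "YM f (of_int (- 1) + p - of_nat i) (YM f (p + 1 + of_nat i) x) \<in> U" for i
  proof -
    have "p - of_int (1 + int i) = of_int (- 1) + p - of_nat i" "p + of_int (1 + int i) = p + 1 + of_nat i"
      by simp_all
    moreover have "1 + int i \<noteq> 0" by simp
    ultimately show ?thesis using far[of "1 + int i"] by (simp only: not_False_eq_True)
  qed
  have "t 0 \<in> U"
  proof -
    obtain N1 where N1: "\<forall>i\<ge>N1. YM f (p + of_nat i) x = 0" using YM_trunc_nat[OF x] by blast
    obtain N2 where N2: "\<forall>i\<ge>N2. YM f (p + 1 + of_nat i) x = 0" using YM_trunc_nat[OF x] by blast
    show ?thesis
    proof (rule mv.fsum_term_in_subspace[OF U])
      show "t i = 0" if "max N1 N2 \<le> i" for i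
        using that N1 N2 by (simp add: t_def)
      have "fsum t = fsum (\<lambda>i. ((of_rat (p + 1) :: complex) gchoose i) *m
          (YM (Y f (- 1 + int i) f) (p + 1 + p - of_nat i) x))"
        unfolding t_def by (rule mjac[OF p1 fp fp x])
      also have "\<dots> \<in> U"
      proof (intro mv.fsum_in_subspace U mv.subspace_scale)
        fix i
        show "YM (Y f (- 1 + int i) f) (p + 1 + p - of_nat i) x \<in> U"
        proof (rule single_low[OF _ _ _ x _ _ U low])
          show "Y f (- 1 + int i) f \<in> Vw (k + k - of_int (- 1 + int i) - 1)" by (rule L0_Y[OF f(1) f(1)])
          show "Y f (- 1 + int i) f \<in> E (p + 1 + p - of_nat i)"
            using E_Y[OF p1(1) f(2)] E_chi_eq[OF chi_sub_nat(1)] by blast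
          show "of_nat T * (p + 1 + p - of_nat i) \<in> \<int>" using f p1 by (intro T_int_diff T_int_add[OF p1(2)]) auto
          have "(of_nat (2 * lev (f, k, p)) :: rat) = 4 * (k + of_nat shift)"
            using of_nat_lev[of f k p] f by (simp add: L_def)
          moreover have "(1 :: rat) \<le> of_nat shift" using shift(1) by simp
          ultimately show "2 * (k + k - of_int (- 1 + int i) - 1 + of_nat shift) < of_nat (2 * lev (f, k, p))"
            using of_nat_0_le_iff[of i, where 'a = rat] by simp
        qed (simp add: deg_def)
      qed
      finally show "fsum t \<in> U" .
      fix i :: nat assume "i \<noteq> 0"
      then have far_i: "YM f (p - of_int (int i)) (YM f (p + of_int (int i)) x) \<in> U" by (intro far) simp
      have "YM f (of_int (- 1) + (p + 1) - of_nat i) (YM f (p + of_nat i) x) \<in> U"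
        using far_i by simp
      from mv.subspace_diff[OF U this mv.subspace_scale[OF U second]] show "t i \<in> U"
        unfolding t_def by (rule mv.subspace_scale[OF U])
    qed
  qed
  then have "YM f p (YM f p x)
      - (ssign Vo f f * isign (- 1)) *m (YM f (of_int (- 1) + p - of_nat 0) (YM f (p + 1 + of_nat 0) x)) \<in> U"
    by (simp add: t_def)
  from mv.subspace_add[OF U this mv.subspace_scale[OF U second]] have "YM f p (YM f p x) \<in> U"
    by (metis diff_add_cancel)
  then show ?thesis by (simp only: U_def)
qed

lemma letter_shift:
  assumes "b \<in> E m" "of_nat T * m \<in> \<int>" "m' = m + of_int z"
  shows "b \<in> E m'" "of_nat T * m' \<in> \<int>"
  using assms T_int_add[OF assms(2) T_int_int(1), of z] by (simp_all add: E_def)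

text \<open>
  The mode of \<open>a(-n) b\<close> is the leading term on the right-hand side of the Jacobi identity. For \<open>n = shift + 2\<close>
  the weight of \<open>a(-n) b\<close> is so large that its modes have higher level than products of modes of \<open>a\<close> and \<open>b\<close>.
\<close>

lemma reduce_C_letter:
  assumes a: "a \<in> HV" and b: "b \<in> HV" and h: "Y a (- int (shift + 2)) b \<in> Vw k" "Y a (- int (shift + 2)) b \<in> E m"
    and m: "of_nat T * m \<in> \<int>" and nz: "Y a (- int (shift + 2)) b \<noteq> 0" and x: "x \<in> M"
    and l: "of_nat l = 2 * (k + of_nat shift)"
    and U: "mv.subspace U" and low: "(\<lambda>t. foldr opr t x) ` lowset l (k - m - 1) \<subseteq> U"
  shows "YM (Y a (- int (shift + 2)) b) m x \<in> U"
proof -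
  let ?n = "shift + 2"
  obtain ka ma where a': "a \<in> Vw ka" "a \<in> E ma" "of_nat T * ma \<in> \<int>" using a by (auto simp: HV_def)
  obtain kb mb where b': "b \<in> Vw kb" "b \<in> E mb" "of_nat T * mb \<in> \<int>" using b by (auto simp: HV_def)
  have ka: "k = ka + kb + of_nat ?n - 1"
  proof -
    have "Y a (- int ?n) b \<in> Vw (ka + kb - of_int (- int ?n) - 1)" by (rule L0_Y[OF a'(1) b'(1)])
    then have "of_rat k *s Y a (- int ?n) b = of_rat (ka + kb - of_int (- int ?n) - 1) *s Y a (- int ?n) b"
      using h(1) L0_Vw by metis
    then have "(of_rat k :: complex) = of_rat (ka + kb - of_int (- int ?n) - 1)"
      using nz by (simp only: scale_cancel_right) simp
    then have "k = ka + kb - of_int (- int ?n) - 1" by (simp only: of_rat_eq_iff)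
    then show ?thesis by simp
  qed
  \<comment> \<open>The eigenvalue of \<open>b\<close> is determined by those of \<open>a\<close>
    and of the product, so \<open>b\<close> admits the mode \<open>m - ma\<close>. With modes
    \<open>ma\<close> and \<open>m - ma\<close> the leading term of the Jacobi identity carries
    exactly the mode \<open>m\<close>.\<close>
  have "chi (ma + mb) = chi m" using E_unique[OF E_Y[OF a'(2) b'(2)] h(2) nz] .
  then have "chi mb = chi (m - ma)" by (simp add: chi_add chi_diff field_simps)
  then have bE: "b \<in> E (m - ma)" "of_nat T * (m - ma) \<in> \<int>"
    using b'(2) E_chi_eq[of mb "m - ma"] T_int_diff[OF m a'(3)] by auto
  define t where "t = (\<lambda>i. ((of_rat ma :: complex) gchoose i) *m
      (YM (Y a (- int ?n + int i) b) (ma + (m - ma) - of_nat i) x))"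
  have Jac: "fsum t = fsum (\<lambda>i. ((-1) ^ i * ((of_int (- int ?n) :: complex) gchoose i)) *m
                  (YM a (of_int (- int ?n) + ma - of_nat i) (YM b (m - ma + of_nat i) x)
                   - (ssign Vo a b * isign (- int ?n)) *m
                      (YM b (of_int (- int ?n) + (m - ma) - of_nat i) (YM a (ma + of_nat i) x))))"
    unfolding t_def by (rule mjac[OF a'(2,3) Vw_parity[OF a'(1)] Vw_parity[OF b'(1)] x, symmetric])
  have lev2: "2 * (ka + of_nat shift) + 2 * (kb + of_nat shift) < of_nat l"
    by (simp add: l ka)
  have "t 0 \<in> U"
  proof -
    obtain N where N: "\<forall>n\<ge>N. Y a n b = 0" using trunc by blast
    show ?thesis
    proof (rule mv.fsum_term_in_subspace[OF U])
      show "t i = 0" if "nat (N + int ?n) \<le> i" for i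
        using that N x by (simp add: t_def)
      show "fsum t \<in> U"
        unfolding Jac
      proof (intro mv.fsum_in_subspace U mv.subspace_scale mv.subspace_diff)
        fix i
        have E1: "a \<in> E (of_int (- int ?n) + ma - of_nat i)" "of_nat T * (of_int (- int ?n) + ma - of_nat i) \<in> \<int>"
          "a \<in> E (ma + of_nat i)" "of_nat T * (ma + of_nat i) \<in> \<int>"
          by (rule letter_shift(1)[OF a'(2,3), of _ "- int ?n - int i"], simp, rule letter_shift(2)[OF a'(2,3), of _ "- int ?n - int i"], simp,
              rule letter_shift(1)[OF a'(2,3), of _ "int i"], simp, rule letter_shift(2)[OF a'(2,3), of _ "int i"], simp)
        have E2: "b \<in> E (of_int (- int ?n) + (m - ma) - of_nat i)"
          "of_nat T * (of_int (- int ?n) + (m - ma) - of_nat i) \<in> \<int>"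
          "b \<in> E (m - ma + of_nat i)" "of_nat T * (m - ma + of_nat i) \<in> \<int>"
          by (rule letter_shift(1)[OF bE, of _ "- int ?n - int i"], simp, rule letter_shift(2)[OF bE, of _ "- int ?n - int i"], simp,
              rule letter_shift(1)[OF bE, of _ "int i"], simp, rule letter_shift(2)[OF bE, of _ "int i"], simp)
        show "YM a (of_int (- int ?n) + ma - of_nat i) (YM b (m - ma + of_nat i) x) \<in> U"
          by (rule pair_low[OF a'(1) E1(1,2) b'(1) E2(3,4) x lev2 _ U low]) (simp add: ka)
        show "YM b (of_int (- int ?n) + (m - ma) - of_nat i) (YM a (ma + of_nat i) x) \<in> U"
          using lev2 by (intro pair_low[OF b'(1) E2(1,2) a'(1) E1(3,4) x _ _ U low]) (simp_all add: ka)
      qed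
      fix i :: nat assume i: "i \<noteq> 0"
      have "YM (Y a (- int ?n + int i) b) (ma + (m - ma) - of_nat i) x \<in> U"
      proof (rule single_low[OF _ _ _ x _ _ U low])
        show "Y a (- int ?n + int i) b \<in> Vw (ka + kb - of_int (- int ?n + int i) - 1)"
          by (rule L0_Y[OF a'(1) b'(1)])
        show "Y a (- int ?n + int i) b \<in> E (ma + (m - ma) - of_nat i)"
          using E_Y[OF a'(2) bE(1)] E_chi_eq[OF chi_sub_nat(1)] by blast
        show "of_nat T * (ma + (m - ma) - of_nat i) \<in> \<int>" using m by (simp add: T_int_diff)
        show "2 * (ka + kb - of_int (- int ?n + int i) - 1 + of_nat shift) < of_nat l"
          using i by (simp add: l ka)
      qed (simp add: ka)
      then show "t i \<in> U" unfolding t_def by (intro mv.subspace_scale U)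
    qed
  qed
  then show ?thesis by (simp add: t_def)
qed

lemma word_spaces:
  assumes "C2_cofinite sc Y" "w \<in> M"
  shows "fin_dim scM (Xw w d)" "\<exists>b. \<forall>d<b. Xw w d = {0}"
proof -
  let ?Cg = "{Y a (- int (shift + 2)) b | a b. a \<in> HV \<and> b \<in> HV}"
  have "2 \<le> shift + 2" by simp
  with assms(1) obtain F0 where F0: "finite F0" "F0 \<subseteq> HV" "span (F0 \<union> ?Cg) = UNIV"
    by (rule C_cofinite)
  \<comment> \<open>Letters are nonzero vectors by definition of \<open>L\<close>; dropping 0 does
    not change the span.\<close>
  define F where "F = F0 - {0}"
  have spanF: "span (F \<union> ?Cg) = UNIV"
  proof -
    have "x \<in> span (F \<union> ?Cg)" if "x \<in> F0 \<union> ?Cg" for x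
    proof (cases "x = 0")
      case False
      then show ?thesis using that by (intro span_base) (auto simp: F_def)
    qed (simp add: span_zero)
    then have "F0 \<union> ?Cg \<subseteq> span (F \<union> ?Cg)" by blast
    then have "span (F0 \<union> ?Cg) \<subseteq> span (F \<union> ?Cg)" by (intro span_minimal subspace_span)
    then show ?thesis using F0(3) by blast
  qed
  have "\<exists>k \<mu>. f \<in> Vw k \<and> f \<in> E \<mu> \<and> of_nat T * \<mu> \<in> \<int> \<and> (\<forall>i::nat. YM f (\<mu> + of_nat i) w = 0)" if f: "f \<in> F" for f
  proof -
    obtain k \<mu> where k: "f \<in> Vw k" "f \<in> E \<mu>" "of_nat T * \<mu> \<in> \<int>" using f F0(2) by (auto simp: F_def HV_def)
    obtain N where N: "\<forall>i\<ge>N. YM f (\<mu> + of_nat i) w = 0" using YM_trunc_nat[OF assms(2)] by blast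
    have "YM f (\<mu> + of_nat N + of_nat i) w = 0" for i
      using N[rule_format, of "N + i"] by (simp add: add.assoc)
    moreover have "f \<in> E (\<mu> + of_nat N)" using k(2) E_chi_eq[OF chi_sub_nat(2)] by blast
    moreover have "of_nat T * (\<mu> + of_nat N) \<in> \<int>" using k(3) by (simp add: T_int_add)
    ultimately show ?thesis using k(1) by blast
  qed
  then obtain kf Nf where kN: "\<And>f. f \<in> F \<Longrightarrow> f \<in> Vw (kf f) \<and> f \<in> E (Nf f) \<and> of_nat T * Nf f \<in> \<int>
      \<and> (\<forall>i::nat. YM f (Nf f + of_nat i) w = 0)" by metis
  \<comment> \<open>The index \<open>j\<close> stands for the mode \<open>Nf f - 1 - j\<close>:
    negative \<open>j\<close> are exactly the modes from \<open>Nf f\<close> upward, which kill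
    \<open>w\<close>, and the degree grows with \<open>j\<close>. Only \<open>Nf\<close> depends on
    \<open>w\<close>, the set \<open>F\<close> does not.\<close>
  define fl where "fl = (\<lambda>f (j::int). (f, kf f, Nf f - 1 - of_int j))"
  have flL: "fl f j \<in> L" if "f \<in> F" for f j
  proof -
    have "f \<noteq> 0" using that by (simp add: F_def)
    moreover have "f \<in> E (Nf f - 1 - of_int j)"
    proof -
      have "chi (Nf f - 1 - of_int j) = chi (Nf f)" using chi_add_int(2)[of "Nf f" "1 + j"] by (simp add: algebra_simps)
      then show ?thesis using kN[OF that] E_chi_eq by metis
    qed
    moreover have "of_nat T * (Nf f - 1 - of_int j) \<in> \<int>"
      using kN[OF that] T_int_int(1)[of 1] by (intro T_int_diff) auto
    ultimately show ?thesis using kN[OF that] by (simp add: fl_def L_def)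
  qed
  interpret W: word_system scM M L opr lev deg F fl "\<lambda>f. kf f - Nf f" w
  proof (unfold_locales, goal_cases)
    case 1 show ?case by (rule M_sub)
  next
    case 2 show ?case by (rule assms(2))
  next
    case (3 a x) then show ?case by (auto simp: opr_def YM_M split: prod.splits)
  next
    case (4 a x y c) then show ?case by (auto simp: opr_def YM_lin2 split: prod.splits)
  next
    case 5 show ?case using F0(1) by (simp add: F_def)
  next
    case (6 f j) then show ?case by (rule flL)
  next
    case (7 f j) show ?case by (simp add: fl_def deg_def)
  next
    case (8 f j) show ?case by (simp add: fl_def lev_def)
  next
    case (9 f j)
    then have "Nf f - 1 - of_int j = Nf f + of_nat (nat (- 1 - j))" by simp
    then have "YM f (Nf f - 1 - of_int j) w = 0" using kN[OF 9(1)] by metis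
    then show ?case by (simp add: fl_def opr_def)
  next
    case (10 a b x) then show ?case using swap_letters[of a b x] unfolding lowset_def by blast
  next
    case (11 a x)
    obtain v k m where a: "a = (v, k, m)" by (metis surj_pair)
    have v: "v \<in> Vw k" "v \<in> E m" "of_nat T * m \<in> \<int>" "v \<noteq> 0" using 11(1) a by (auto simp: L_def)
    let ?U = "mv.span ((\<lambda>t. foldr opr t x) ` ({[fl f j] | f j. f \<in> F \<and> lev (fl f j) = lev a \<and> deg (fl f j) = deg a}
         \<union> lowset (lev a) (deg a)))"
    have U: "mv.subspace ?U" by (rule mv.subspace_span)
    have low: "(\<lambda>t. foldr opr t x) ` lowset (lev a) (k - m - 1) \<subseteq> ?U"
      by (auto simp: a deg_def intro: mv.span_base)
    interpret G: endo_on sc UNIV g by (rule endo_g)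
    interpret L0: endo_on sc UNIV "Y om 1" by (rule endo_Y)
    have ev: "(\<exists>c. Y om 1 h = c *s h) \<and> (\<exists>c. g h = c *s h)" if "h \<in> F \<union> ?Cg" for h
    proof -
      have "\<exists>k m. h \<in> Vw k \<and> h \<in> E m"
      proof (cases "h \<in> F")
        case True
        then show ?thesis using F0(2) by (auto simp: F_def HV_def)
      next
        case False
        then have "h \<in> ?Cg" using that by blast
        then obtain a b where "h = Y a (- int (shift + 2)) b" "a \<in> HV" "b \<in> HV" by blast
        then show ?thesis using L0_Y E_Y unfolding HV_def by blast
      qed
      then show ?thesis by (auto simp: E_def Vw_iff)
    qed
    \<comment> \<open>Selecting generators first by weight and then by eigenvalue of
      \<open>g\<close> leaves those whose mode \<open>m\<close> has the same level and degree as the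
      letter \<open>a\<close>.\<close>
    have "v \<in> span {h \<in> F \<union> ?Cg. Y om 1 h = of_rat k *s h}"
      using v spanF ev by (intro L0.eigen_span') (auto simp: Vw_iff)
    then have "v \<in> span {h' \<in> {h \<in> F \<union> ?Cg. Y om 1 h = of_rat k *s h}. g h' = chi m *s h'}"
      using v ev by (intro G.eigen_span') (auto simp: E_def)
    then have "YM v m x \<in> ?U"
    proof (rule YM_span1[OF _ 11(2) U])
      fix h assume "h \<in> {h' \<in> {h \<in> F \<union> ?Cg. Y om 1 h = of_rat k *s h}. g h' = chi m *s h'}"
      then have h: "h \<in> F \<or> h \<in> ?Cg" "h \<in> Vw k" "h \<in> E m" by (auto simp: E_def Vw_iff)
      show "YM h m x \<in> ?U"
      proof (cases "h = 0")
        case True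
        then show ?thesis using 11(2) mv.subspace_0[OF U] by simp
      next
        case False
        from h(1) show ?thesis
        proof
          assume hF: "h \<in> F"
          have "kf h = k"
          proof -
            have "of_rat (kf h) *s h = of_rat k *s h" using kN[OF hF] h(2) L0_Vw by metis
            then have "(of_rat (kf h) :: complex) = of_rat k" using False by (simp only: scale_cancel_right) simp
            then show ?thesis by (simp only: of_rat_eq_iff)
          qed
          moreover obtain j where "fl h j = (h, kf h, m)"
          proof -
            have "chi (Nf h) = chi m" using E_unique[OF _ h(3) False] kN[OF hF] by blast
            then have "chi (Nf h - m) = 1" by (simp add: chi_diff)
            then have "Nf h - m \<in> \<int>" by (simp add: chi_eq_1_iff)
            then obtain z where "Nf h - m = of_int z" by (rule Ints_cases)
            then have "Nf h - 1 - of_int (z - 1) = m" by (simp add: algebra_simps)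
            then have "fl h (z - 1) = (h, kf h, m)" by (simp add: fl_def)
            then show ?thesis using that by blast
          qed
          ultimately have "fl h j = (h, k, m)" by simp
          then have "lev (fl h j) = lev a" "deg (fl h j) = deg a" by (simp_all add: a lev_def deg_def)
          then have "[fl h j] \<in> {[fl f j] | f j. f \<in> F \<and> lev (fl f j) = lev a \<and> deg (fl f j) = deg a}"
            using hF by blast
          then have "foldr opr [fl h j] x \<in> ?U" by (intro mv.span_base) blast
          then show ?thesis by (simp add: opr_def \<open>fl h j = (h, k, m)\<close>)
        next
          assume "h \<in> ?Cg"
          then obtain c b where hc: "h = Y c (- int (shift + 2)) b" "c \<in> HV" "b \<in> HV" by blast
          have "of_nat (lev a) = 2 * (k + of_nat shift)" using of_nat_lev 11(1) a by simp
          then show ?thesis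
            using reduce_C_letter[OF hc(2,3) _ _ v(3) _ 11(2) _ U low] h False unfolding hc(1) by blast
        qed
      qed
    qed
    then show ?case by (simp add: a opr_def lowset_def)
  next
    case (12 f x j)
    have fL: "fl f j \<in> L" using flL[OF 12(1)] .
    define p where "p = Nf f - 1 - of_int j"
    have f: "f \<in> Vw (kf f)" "f \<in> E p" "of_nat T * p \<in> \<int>" "f \<noteq> 0"
      using fL by (auto simp: fl_def L_def p_def)
    have eq: "YM f (p - of_int i) (YM f (p + of_int i) x) = foldr opr [fl f (j + i), fl f (j - i)] x" for i
      by (simp add: fl_def opr_def p_def algebra_simps)
    have "opr (fl f j) (opr (fl f j) x) = YM f p (YM f p x)" by (simp add: fl_def opr_def p_def)
    also have "\<dots> \<in> mv.span ({YM f (p - of_int i) (YM f (p + of_int i) x) | i. i \<noteq> 0}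
      \<union> (\<lambda>t. foldr opr t x) ` lowset (2 * lev (f, kf f, p)) (2 * deg (f, kf f, p)))"
      by (rule spread_letters[OF f 12(2)])
    also have "\<dots> = mv.span ((\<lambda>t. foldr opr t x) ` ({[fl f (j + i), fl f (j - i)] | i. i \<noteq> 0}
         \<union> lowset (2 * lev (f, kf f, p)) (2 * deg (f, kf f, p))))"
      unfolding eq image_Un by (intro arg_cong[where f = mv.span] arg_cong2[where f = "(\<union>)"] refl) blast
    also have "(f, kf f, p) = fl f j" by (simp add: fl_def p_def)
    finally show ?case unfolding lowset_def .
  qed
  have "W.X d = Xw w d" for d by (simp add: W.X_def Xw_def W.degw_def)
  then show "fin_dim scM (Xw w d)" "\<exists>b. \<forall>d<b. Xw w d = {0}"
    using W.fin_dim_X W.X_bounded_below by auto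
qed

end

section \<open>Cyclic submodules\<close>

lemma (in complex_vector_space) indep_sum_zero:
  assumes "\<And>n. subspace (D n)" "\<And>n. D n \<inter> span (\<Union>k\<in>UNIV - {n}. D k) = {0}"
    and "finite J" "\<And>n. n \<in> J \<Longrightarrow> c n \<in> D n" "sum c J = 0" "n \<in> J"
  shows "c n = 0"
proof -
  have "c n + sum c (J - {n}) = 0" using assms(3,5,6) by (simp add: sum.remove)
  then have "c n = - sum c (J - {n})" by (simp add: eq_neg_iff_add_eq_0)
  moreover have "- sum c (J - {n}) \<in> span (\<Union>k\<in>UNIV - {n}. D k)"
    using assms(4) by (intro span_neg span_sum span_base) blast
  ultimately have "c n \<in> D n \<inter> span (\<Union>k\<in>UNIV - {n}. D k)" using assms(4)[OF assms(6)] by simp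
  then show ?thesis unfolding assms(2) by simp
qed

context tw_module
begin

lemma YM_span2:
  assumes "x \<in> mv.span A" "A \<subseteq> M" "mv.subspace U" "\<And>a. a \<in> A \<Longrightarrow> YM v m a \<in> U"
  shows "YM v m x \<in> U"
proof -
  have "x \<in> M \<and> YM v m x \<in> U"
    using assms(1)
  proof (induction rule: mv.span_induct_alt)
    case base
    show ?case using mv.subspace_0[OF M_sub] mv.subspace_0[OF assms(3)] by simp
  next
    case (step c a y)
    then have M: "a \<in> M" "y \<in> M" using assms(2) by auto
    then show ?case
      using step assms(3,4) M_sub by (auto simp: YM_lin2 intro!: mv.subspace_add mv.subspace_scale)
  qed
  then show ?thesis ..
qed

text \<open>Among the eigenvectors that compose \<open>v\<close>, only those with eigenvalue
  \<open>chi m\<close> have a mode \<open>m\<close>, by \<open>YM_coset\<close>. So closure under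
  all modes can be tested on letters.\<close>

lemma YM_homogeneous:
  assumes "v \<in> Vw k" "x \<in> M" "mv.subspace U" "\<And>h. (h, k, m) \<in> L \<Longrightarrow> YM h m x \<in> U"
  shows "YM v m x \<in> U"
proof -
  interpret L: endo_on sc UNIV "Y om 1" by (rule endo_Y)
  have "v \<in> span {h\<in>HV. Y om 1 h = of_rat k *s h}"
  proof (rule L.eigen_span')
    show "v \<in> span HV" by (simp add: span_HV)
    show "\<exists>c. Y om 1 h = c *s h" if "h \<in> HV" for h using that by (auto simp: HV_def Vw_iff)
  qed (use assms(1) Vw_iff in auto)
  then show ?thesis
  proof (rule YM_span1[OF _ assms(2,3)])
    fix h assume "h \<in> {h\<in>HV. Y om 1 h = of_rat k *s h}"
    then obtain n where h: "h \<in> Vw k" "h \<in> E n" "of_nat T * n \<in> \<int>" by (auto simp: HV_def Vw_iff)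
    show "YM h m x \<in> U"
    proof (cases "m - n \<in> \<int> \<and> h \<noteq> 0")
      case True
      then obtain z where "m - n = of_int z" by (auto elim: Ints_cases)
      then have "m = n + of_int z" by (simp add: algebra_simps)
      then have "(h, k, m) \<in> L" using letter_shift[OF h(2,3)] h(1) True by (simp add: L_def)
      then show ?thesis by (rule assms(4))
    next
      case False
      then have "YM h m x = 0" using YM_coset[OF h(2,3) _ assms(2)] assms(2) by auto
      then show ?thesis using mv.subspace_0[OF assms(3)] by simp
    qed
  qed
qed

lemma YM_by_letters:
  assumes "x \<in> M" "mv.subspace U" "\<And>a. a \<in> L \<Longrightarrow> opr a x \<in> U"
  shows "YM v m x \<in> U"
proof (rule YM_span1[OF _ assms(1,2)])
  show "v \<in> span (\<Union>(range Vw))" using Vw_span by blast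
  fix h assume "h \<in> \<Union>(range Vw)"
  then obtain k where "h \<in> Vw k" by blast
  then show "YM h m x \<in> U"
    using assms by (elim YM_homogeneous) (auto simp: opr_def split: prod.splits)
qed

lemma submodule_sub: "submodule scM M YM W \<Longrightarrow> mv.subspace W" "submodule scM M YM W \<Longrightarrow> W \<subseteq> M"
  "submodule scM M YM W \<Longrightarrow> x \<in> W \<Longrightarrow> YM v m x \<in> W"
  by (auto simp: submodule_def)

lemma submodule_span:
  assumes "A \<subseteq> M" "\<And>x a. x \<in> A \<Longrightarrow> a \<in> L \<Longrightarrow> opr a x \<in> mv.span A"
  shows "submodule scM M YM (mv.span A)"
proof -
  have "YM v m x \<in> mv.span A" if "x \<in> mv.span A" for v m x
    using that assms(1) mv.subspace_span
  proof (rule YM_span2)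
    fix a assume "a \<in> A"
    then show "YM v m a \<in> mv.span A"
      using assms by (intro YM_by_letters mv.subspace_span) auto
  qed
  then show ?thesis
    unfolding submodule_def using mv.span_minimal[OF assms(1) M_sub] mv.subspace_span by blast
qed

lemma submodule_span_Union:
  assumes "\<And>W. W \<in> S \<Longrightarrow> submodule scM M YM W"
  shows "submodule scM M YM (mv.span (\<Union>S))"
proof (rule submodule_span)
  show "\<Union>S \<subseteq> M" using assms submodule_sub(2) by blast
  fix x a assume "x \<in> \<Union>S"
  then obtain W where W: "W \<in> S" "x \<in> W" by blast
  have "opr a x \<in> W" using submodule_sub(3)[OF assms[OF W(1)] W(2)] by (simp add: opr_def split: prod.splits)
  then show "opr a x \<in> mv.span (\<Union>S)" using W(1) by (intro mv.span_base) blast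
qed

lemma submodule_Int:
  "submodule scM M YM W \<Longrightarrow> submodule scM M YM W' \<Longrightarrow> submodule scM M YM (W \<inter> W')"
  unfolding submodule_def using mv.subspace_inter by blast

lemma submodule_iff:
  "submodule scM M YM W \<Longrightarrow> submodule scM W YM K \<longleftrightarrow> submodule scM M YM K \<and> K \<subseteq> W"
  by (auto simp: submodule_def)

lemma submodule_M: "submodule scM M YM M"
  by (auto simp: submodule_def M_sub YM_M)

lemma weak_submodule:
  assumes "submodule scM M YM W"
  shows "weak_tw_module sc Y vac Ve Vo g scM W YM"
proof -
  note W = submodule_sub[OF assms]
  note c = weak_conjuncts
  have "vector_space scM" by unfold_locales
  moreover have "\<forall>r. \<forall>v\<in>twsp sc g r. \<forall>m. m - of_int r / of_nat T \<notin> \<int> \<longrightarrow> (\<forall>w\<in>W. YM v m w = 0)"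
    using c[THEN conjunct2, THEN conjunct2, THEN conjunct2, THEN conjunct2, THEN conjunct2, THEN conjunct1] W(2) by blast
  moreover have "\<forall>v. \<forall>w\<in>W. \<exists>N. \<forall>m\<ge>N. YM v m w = 0" using YM_trunc W(2) by blast
  moreover have "\<forall>m. \<forall>w\<in>W. YM vac m w = (if m = -1 then w else 0)" using YM_vac W(2) by blast
  moreover have "\<forall>r u v l m n. \<forall>w\<in>W. u \<in> twsp sc g r \<longrightarrow> u \<in> Ve \<union> Vo \<longrightarrow> v \<in> Ve \<union> Vo \<longrightarrow>
        m - of_int r / of_nat T \<in> \<int> \<longrightarrow>
        fsum (\<lambda>i. ((-1) ^ i * ((of_int l :: complex) gchoose i)) *m
                  (YM u (of_int l + m - of_nat i) (YM v (n + of_nat i) w)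
                   - (ssign Vo u v * isign l) *m (YM v (of_int l + n - of_nat i) (YM u (m + of_nat i) w))))
      = fsum (\<lambda>i. ((of_rat m :: complex) gchoose i) *m (YM (Y u (l + int i) v) (m + n - of_nat i) w))"
    using c[THEN conjunct2, THEN conjunct2, THEN conjunct2, THEN conjunct2, THEN conjunct2,
          THEN conjunct2, THEN conjunct2, THEN conjunct2] W(2) by blast
  moreover have "\<forall>a u u' m. \<forall>w\<in>W. YM (a *s u + u') m w = a *m YM u m w + YM u' m w"
    using YM_lin1 W(2) by blast
  moreover have "\<forall>v m a. \<forall>w\<in>W. \<forall>w'\<in>W. YM v m (a *m w + w') = a *m YM v m w + YM v m w'"
    using YM_lin2 W(2) by blast
  moreover have "\<forall>v m. \<forall>w\<in>W. YM v m w \<in> W" using W(3) by blast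
  ultimately show ?thesis
    unfolding weak_tw_module_def using W(1) by (intro conjI) assumption+
qed

lemma opr_submodule: "submodule scM M YM W \<Longrightarrow> x \<in> W \<Longrightarrow> opr a x \<in> W"
  by (simp add: opr_def submodule_sub split: prod.splits)

lemma opr_M: "x \<in> M \<Longrightarrow> opr a x \<in> M"
  using opr_submodule submodule_M by blast

lemma word_submodule: "submodule scM M YM W \<Longrightarrow> x \<in> W \<Longrightarrow> foldr opr t x \<in> W"
  by (induction t) (auto simp: opr_submodule)

lemma simple_submodule:
  assumes "submodule scM M YM W" "irred_module scM W YM" "submodule scM M YM U"
  shows "W \<inter> U = {0} \<or> W \<subseteq> U"
proof -
  have "submodule scM W YM (W \<inter> U)"
    unfolding submodule_iff[OF assms(1)] using submodule_Int[OF assms(1,3)] by simp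
  then show ?thesis using assms(2) unfolding irred_module_def by blast
qed

lemma irreducibles_dsum:
  assumes "\<And>W. W \<in> Irr \<Longrightarrow> submodule scM M YM W \<and> irred_module scM W YM"
    and "M \<subseteq> mv.span (\<Union>Irr)"
  obtains S where "S \<subseteq> Irr" "is_dsum scM M S"
proof -
  have "\<exists>S\<subseteq>Irr. is_dsum scM M S"
  proof (rule mv.sum_of_simples_is_dsum[OF _ assms(2)])
    fix W assume "W \<in> Irr"
    then show "mv.subspace W \<and> W \<subseteq> M" using assms(1) submodule_sub by blast
  next
    fix W S assume "W \<in> Irr" "S \<subseteq> Irr"
    then show "W \<inter> mv.span (\<Union>S) = {0} \<or> W \<subseteq> mv.span (\<Union>S)"
      using assms(1) by (intro simple_submodule submodule_span_Union) blast+
  qed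
  then show ?thesis using that by blast
qed

lemma Xw_subspace: "mv.subspace (Xw w d)"
  by (simp add: Xw_def mv.subspace_span)

lemma Xw_submodule: "submodule scM M YM W \<Longrightarrow> w \<in> W \<Longrightarrow> Xw w d \<subseteq> W"
  unfolding Xw_def using word_submodule by (intro mv.span_minimal) (auto simp: submodule_sub)

lemma Xw_M: "w \<in> M \<Longrightarrow> Xw w d \<subseteq> M"
  using Xw_submodule submodule_M by blast

lemma Xw_base: "w \<in> Xw w 0"
proof -
  have "foldr opr [] w \<in> Xw w 0"
    unfolding Xw_def by (intro mv.span_base CollectI exI[of _ "[]"]) simp
  then show ?thesis by simp
qed

lemma Xw_opr:
  assumes "w \<in> M" "a \<in> L" "x \<in> Xw w d"
  shows "opr a x \<in> Xw w (d + deg a)"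
proof -
  obtain v k m where a: "a = (v, k, m)" by (metis surj_pair)
  have "YM v m x \<in> Xw w (d + deg a)"
    using assms(3) unfolding Xw_def[of w d]
  proof (rule YM_span2[OF _ _ Xw_subspace])
    show "{foldr opr t w | t. set t \<subseteq> L \<and> sum_list (map deg t) = d} \<subseteq> M"
      using word_submodule[OF submodule_M] assms(1) by blast
    fix y assume "y \<in> {foldr opr t w | t. set t \<subseteq> L \<and> sum_list (map deg t) = d}"
    then obtain t where "y = foldr opr t w" "set t \<subseteq> L" "sum_list (map deg t) = d" by blast
    then have "foldr opr (a # t) w \<in> Xw w (d + deg a)"
      unfolding Xw_def using assms(2) by (intro mv.span_base CollectI exI[of _ "a # t"]) simp
    then show "YM v m y \<in> Xw w (d + deg a)" by (simp add: \<open>y = _\<close> a opr_def)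
  qed
  then show ?thesis by (simp add: a opr_def)
qed

lemma Xw_YM:
  assumes "w \<in> M" "v \<in> Vw k" "x \<in> Xw w d"
  shows "YM v m x \<in> Xw w (d + k - m - 1)"
proof (rule YM_homogeneous[OF assms(2) _ Xw_subspace])
  show "x \<in> M" using assms Xw_M by blast
  fix h assume "(h, k, m) \<in> L"
  then show "YM h m x \<in> Xw w (d + k - m - 1)"
    using Xw_opr[OF assms(1) _ assms(3), of "(h, k, m)"] by (simp add: opr_def deg_def algebra_simps)
qed

lemma Xw_degree: "Xw w d \<noteq> {0} \<Longrightarrow> d * of_nat T' \<in> \<int>"
proof -
  assume "Xw w d \<noteq> {0}"
  have "\<exists>t. set t \<subseteq> L \<and> sum_list (map deg t) = d"
  proof (rule ccontr)
    assume "\<not> ?thesis"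
    then have "{foldr opr t w | t. set t \<subseteq> L \<and> sum_list (map deg t) = d} = {}" by blast
    then show False using \<open>Xw w d \<noteq> {0}\<close> by (simp only: Xw_def mv.span_empty)
  qed
  then obtain t where t: "set t \<subseteq> L" "sum_list (map deg t) = d" by blast
  have "sum_list (map deg t) * of_nat T' \<in> \<int>"
    using t(1) by (induction t) (auto simp: distrib_right deg_T'_int)
  then show "d * of_nat T' \<in> \<int>" using t(2) by simp
qed

definition cyc :: "'m \<Rightarrow> 'm set" where "cyc w = mv.span (\<Union>d. Xw w d)"

lemma cyc_submodule: "w \<in> M \<Longrightarrow> submodule scM M YM (cyc w)"
  unfolding cyc_def
proof (rule submodule_span)
  assume w: "w \<in> M"
  then show "(\<Union>d. Xw w d) \<subseteq> M" using Xw_M by blast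
  fix x a assume "x \<in> (\<Union>d. Xw w d)" "a \<in> L"
  then show "opr a x \<in> mv.span (\<Union>d. Xw w d)"
    using Xw_opr[OF w] by (blast intro: mv.span_base)
qed

lemma cyc_base: "w \<in> cyc w"
  unfolding cyc_def using Xw_base by (blast intro: mv.span_base)

lemma cyc_minimal: "submodule scM M YM W \<Longrightarrow> w \<in> W \<Longrightarrow> cyc w \<subseteq> W"
  unfolding cyc_def using Xw_submodule submodule_sub by (intro mv.span_minimal) blast+

abbreviation "genL0 \<equiv> endo_on.gen scM M L0"
abbreviation "stableL0 \<equiv> endo_on.stable scM L0"

lemma stable_L0: "stableL0 U \<longleftrightarrow> mv.subspace U \<and> (\<forall>x\<in>U. L0 x \<in> U)"
  by (rule endo_on.stable_def[OF endo_YM])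

lemma submodule_stable: "submodule scM M YM W \<Longrightarrow> stableL0 W"
  by (auto simp: stable_L0 submodule_def)

text \<open>\<open>L(0)\<close> is the mode \<open>om(1)\<close>, of degree
  \<open>2 - 1 - 1 = 0\<close>.\<close>

lemma Xw_stable: "w \<in> M \<Longrightarrow> stableL0 (Xw w d)"
  using Xw_YM[of w om 2 _ d 1] om_Vw by (auto simp: stable_L0 Xw_subspace)

text \<open>By \<open>L0_YM\<close>, \<open>L(0) - \<nu> - deg a\<close> after \<open>a\<close>
  equals \<open>a\<close> after \<open>L(0) - \<nu>\<close>, and this passes to powers.\<close>

lemma opr_gen:
  assumes "a \<in> L" "x \<in> genL0 \<nu>"
  shows "opr a x \<in> genL0 (\<nu> + of_rat (deg a))"
proof -
  interpret Z: endo_on scM M L0 by (rule endo_YM)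
  obtain v k m where a: "a = (v, k, m)" by (metis surj_pair)
  let ?\<nu> = "\<nu> + of_rat (deg a)"
  have sh: "Z.sh ?\<nu> (opr a y) = opr a (Z.sh \<nu> y)" if "y \<in> M" for y
  proof -
    have "L0 (opr a y) = opr a (L0 y) + of_rat (deg a) *m opr a y"
      using L0_YM[OF _ _ _ that, of v k m] assms(1) by (simp add: a opr_def deg_def L_def)
    moreover have "opr a (Z.sh \<nu> y) = opr a (L0 y) - \<nu> *m opr a y"
      using that YM_M by (simp add: a opr_def Z.sh_def endo_on.phi_diff[OF endo_YM] endo_on.phi_scale[OF endo_YM]
          mv.subspace_scale[OF M_sub])
    ultimately show ?thesis by (simp add: Z.sh_def algebra_simps)
  qed
  have pow: "(Z.sh ?\<nu> ^^ n) (opr a y) = opr a ((Z.sh \<nu> ^^ n) y)" if "y \<in> M" for n y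
    by (induction n) (simp_all add: sh Z.sh_pow_M that)
  obtain n where n: "x \<in> M" "(Z.sh \<nu> ^^ n) x = 0" using assms(2) by (auto simp: Z.gen_def)
  have "opr a 0 = 0" by (simp add: a opr_def)
  then have "(Z.sh ?\<nu> ^^ n) (opr a x) = 0" using pow[OF n(1), of n] n(2) by simp
  then show ?thesis unfolding Z.gen_def using opr_M[OF n(1)] by blast
qed

lemma word_gen:
  "set t \<subseteq> L \<Longrightarrow> w \<in> genL0 \<nu> \<Longrightarrow> foldr opr t w \<in> genL0 (\<nu> + of_rat (sum_list (map deg t)))"
proof (induction t)
  case (Cons a t)
  then have "opr a (foldr opr t w) \<in> genL0 (\<nu> + of_rat (sum_list (map deg t)) + of_rat (deg a))"
    by (intro opr_gen) auto
  then show ?case by (simp add: of_rat_add algebra_simps)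
qed simp

lemma Xw_gen: "w \<in> genL0 \<nu> \<Longrightarrow> Xw w d \<subseteq> genL0 (\<nu> + of_rat d)"
  unfolding Xw_def using word_gen
  by (intro mv.span_minimal endo_on.gen_subspace[OF endo_YM]) blast

definition EL0 :: "complex \<Rightarrow> 'm set" where "EL0 \<nu> = {x \<in> M. L0 x = \<nu> *m x}"

lemma EL0_subspace: "mv.subspace (EL0 \<nu>)"
  unfolding EL0_def mv.subspace_def
  using M_sub endo_on.phi_0[OF endo_YM] endo_on.phi_add[OF endo_YM] endo_on.phi_scale[OF endo_YM]
  by (auto simp: mv.subspace_def mv.scale_right_distrib)

lemma EL0_gen: "EL0 \<nu> \<subseteq> genL0 \<nu>"
  using endo_on.eigen_gen[OF endo_YM] by (auto simp: EL0_def)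

lemma EL0_opr:
  assumes "a \<in> L" "x \<in> EL0 \<nu>"
  shows "opr a x \<in> EL0 (\<nu> + of_rat (deg a))"
proof -
  obtain v k m where a: "a = (v, k, m)" by (metis surj_pair)
  have x: "x \<in> M" "L0 x = \<nu> *m x" using assms(2) by (auto simp: EL0_def)
  have "L0 (YM v m x) = YM v m (L0 x) + of_rat (deg a) *m YM v m x"
    using L0_YM[OF _ _ _ x(1), of v k m] assms(1) by (simp add: a deg_def L_def)
  then have "L0 (opr a x) = (\<nu> + of_rat (deg a)) *m opr a x"
    using x endo_on.phi_scale[OF endo_YM x(1)] by (simp add: a opr_def mv.scale_left_distrib)
  then show ?thesis using opr_M[OF x(1)] by (simp add: EL0_def)
qed

lemma Xw_EL0: "w \<in> EL0 \<nu> \<Longrightarrow> Xw w d \<subseteq> EL0 (\<nu> + of_rat d)"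
proof -
  assume w: "w \<in> EL0 \<nu>"
  have "foldr opr t w \<in> EL0 (\<nu> + of_rat (sum_list (map deg t)))" if "set t \<subseteq> L" for t
    using that
  proof (induction t)
    case (Cons a t)
    then have "opr a (foldr opr t w) \<in> EL0 (\<nu> + of_rat (sum_list (map deg t)) + of_rat (deg a))"
      by (intro EL0_opr) auto
    then show ?case by (simp add: of_rat_add algebra_simps)
  qed (use w in simp)
  then show ?thesis
    unfolding Xw_def by (intro mv.span_minimal EL0_subspace) blast
qed

lemma inj_shift_rat: "inj_on (\<lambda>d. \<nu> + (of_rat (d + b) :: complex)) I"
  by (auto intro: inj_onI)

lemma adm_grading_submodule:
  assumes "adm_grading sc Ve Vo Vw g scM M YM Mg" "graded_submodule scM M YM Mg W"
  shows "adm_grading sc Ve Vo Vw g scM W YM (\<lambda>n. W \<inter> Mg n)"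
proof -
  have W: "submodule scM M YM W" "W \<subseteq> mv.span (\<Union>n. W \<inter> Mg n)"
    using assms(2) by (auto simp: graded_submodule_def)
  have Mg: "\<forall>n. mv.subspace (Mg n) \<and> Mg n \<subseteq> M" "\<forall>n. Mg n \<noteq> {0} \<longrightarrow> n \<ge> 0 \<and> n * of_nat T' \<in> \<int>"
    "\<forall>n. Mg n \<inter> mv.span (\<Union>k\<in>UNIV - {n}. Mg k) = {0}"
    "\<forall>k v m n w. v \<in> Vw k \<longrightarrow> w \<in> Mg n \<longrightarrow> YM v m w \<in> Mg (n + k - m - 1)"
    using assms(1) unfolding adm_grading_def by blast+
  have "0 \<in> W" using submodule_sub(1)[OF W(1)] mv.subspace_0 by blast
  have "W \<inter> Mg n \<inter> mv.span (\<Union>k\<in>UNIV - {n}. W \<inter> Mg k) = {0}" for n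
  proof -
    have "mv.span (\<Union>k\<in>UNIV - {n}. W \<inter> Mg k) \<subseteq> mv.span (\<Union>k\<in>UNIV - {n}. Mg k)"
      by (intro mv.span_mono) blast
    moreover have "0 \<in> Mg n" using Mg(1) mv.subspace_0 by blast
    ultimately show ?thesis using Mg(3) \<open>0 \<in> W\<close> mv.span_zero by blast
  qed
  moreover have "n \<ge> 0 \<and> n * of_nat T' \<in> \<int>" if "W \<inter> Mg n \<noteq> {0}" for n
  proof -
    have "Mg n \<noteq> {0}" using that \<open>0 \<in> W\<close> by blast
    then show ?thesis using Mg(2) by blast
  qed
  moreover have "mv.subspace (W \<inter> Mg n)" for n
    using submodule_sub(1)[OF W(1)] Mg(1) mv.subspace_inter by blast
  moreover have "YM v m w \<in> W \<inter> Mg (n + k - m - 1)" if "v \<in> Vw k" "w \<in> W \<inter> Mg n" for k v m n w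
    using that Mg(4) submodule_sub(3)[OF W(1)] by blast
  ultimately show ?thesis
    unfolding adm_grading_def by (intro conjI allI impI W(2) Int_lower1) (assumption | simp only: | blast)+
qed

section \<open>Rationality implies regularity\<close>

context
  assumes C2: "C2_cofinite sc Y"
begin

text \<open>For an arbitrary \<open>x\<close>, word spaces of different degrees could overlap. For a
  generalized eigenvector, \<open>Xw x d\<close> lies in the generalized eigenspace of
  \<open>\<nu> + d\<close>, and these are independent.\<close>

lemma cyc_admissible:
  assumes "x \<in> genL0 \<nu>"
  obtains b where "adm_grading sc Ve Vo Vw g scM (cyc x) YM (\<lambda>n. Xw x (n + b))"
proof -
  have xM: "x \<in> M" using assms by (simp add: endo_on.gen_def[OF endo_YM])
  obtain c where c: "\<forall>d<c. Xw x d = {0}" using word_spaces(2)[OF C2 xM] by blast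
  \<comment> \<open>The origin of the degrees must lie below all nonzero pieces and must be an
    integer, so that the degrees remain multiples of \<open>1 / T'\<close>.\<close>
  define b :: rat where "b = of_int \<lfloor>c\<rfloor>"
  have b: "b \<le> c" "b * of_nat T' \<in> \<int>" by (simp_all add: b_def)
  have "mv.subspace (Xw x (n + b)) \<and> Xw x (n + b) \<subseteq> cyc x" for n
    using Xw_submodule[OF cyc_submodule[OF xM] cyc_base] Xw_subspace by simp
  moreover have "0 \<le> n \<and> n * of_nat T' \<in> \<int>" if "Xw x (n + b) \<noteq> {0}" for n
  proof
    have "c \<le> n + b" using that c by (meson not_le)
    then show "0 \<le> n" using b(1) by linarith
    have "(n + b) * of_nat T' - b * of_nat T' \<in> \<int>" using Xw_degree[OF that] b(2) by (rule Ints_diff)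
    then show "n * of_nat T' \<in> \<int>" by (simp add: distrib_right)
  qed
  moreover have "cyc x \<subseteq> mv.span (\<Union>n. Xw x (n + b))"
  proof -
    have "Xw x d \<subseteq> (\<Union>n. Xw x (n + b))" for d
      using UN_upper[of "d - b" UNIV "\<lambda>n. Xw x (n + b)"] by simp
    then show ?thesis unfolding cyc_def by (intro mv.span_mono) blast
  qed
  moreover have "Xw x (n + b) \<inter> mv.span (\<Union>k\<in>UNIV - {n}. Xw x (k + b)) = {0}" for n
    using Xw_subspace Xw_gen[OF assms]
    by (intro endo_on.gen_indep[OF endo_YM inj_shift_rat[of \<nu> b]]) auto
  moreover have "YM v m w \<in> Xw x (n + k - m - 1 + b)" if "v \<in> Vw k" "w \<in> Xw x (n + b)" for k v m n w
    using Xw_YM[OF xM that, of m] by (simp add: algebra_simps)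
  ultimately have "adm_grading sc Ve Vo Vw g scM (cyc x) YM (\<lambda>n. Xw x (n + b))"
    unfolding adm_grading_def by (intro conjI allI impI) (assumption | simp only: | blast)+
  then show ?thesis by (rule that)
qed

lemma graded_simple_in_cyc:
  assumes x: "x \<in> genL0 \<nu>"
    and W: "submodule scM M YM W" "W \<noteq> {0}" "W \<subseteq> mv.span (\<Union>n. W \<inter> Xw x (n + b))"
    and simple: "\<And>K. graded_submodule scM W YM (\<lambda>n. W \<inter> Xw x (n + b)) K \<Longrightarrow> K = {0} \<or> K = W"
  shows "ordinary_tw_module sc Y vac om Ve Vo g scM W YM \<and> irred_module scM W YM"
proof -
  interpret Z: endo_on scM M L0 by (rule endo_YM)
  note Ws = submodule_sub[OF W(1)]
  have xM: "x \<in> M" using x by (simp add: Z.gen_def)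
  have W0: "0 \<in> W" using Ws(1) mv.subspace_0 by blast
  have "\<exists>n. W \<inter> Xw x (n + b) \<noteq> {0}"
  proof (rule ccontr)
    assume "\<not> ?thesis"
    then have "mv.span (\<Union>n. W \<inter> Xw x (n + b)) \<subseteq> {0}" by (intro mv.span_minimal mv.subspace_single_0) blast
    then show False using W(2,3) W0 by blast
  qed
  then obtain n0 where n0: "W \<inter> Xw x (n0 + b) \<noteq> {0}" by blast
  let ?U = "W \<inter> Xw x (n0 + b)"
  have st: "stableL0 ?U"
    using submodule_stable[OF W(1)] Xw_stable[OF xM, of "n0 + b"] mv.subspace_inter by (auto simp: stable_L0)
  have fin: "fin_dim scM ?U" using word_spaces(1)[OF C2 xM, of "n0 + b"] unfolding fin_dim_def by blast
  have UM: "?U \<subseteq> M" using Ws(2) by blast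
  obtain y \<mu> where y: "y \<in> ?U" "y \<noteq> 0" "L0 y = \<mu> *m y"
    by (rule Z.eigenvector_exists[OF st UM fin n0])
  have yE: "y \<in> EL0 \<mu>" and yM: "y \<in> M" and yW: "y \<in> W" using y UM by (auto simp: EL0_def)
  have word: "foldr opr t y \<in> Xw x (n0 + b + sum_list (map deg t))" if "set t \<subseteq> L" for t
    using that
  proof (induction t)
    case Nil
    then show ?case using y(1) by simp
  next
    case (Cons a t)
    then have "opr a (foldr opr t y) \<in> Xw x (n0 + b + sum_list (map deg t) + deg a)"
      by (intro Xw_opr xM) auto
    then show ?case by (simp add: algebra_simps)
  qed
  have Xy: "Xw y d \<subseteq> W \<inter> Xw x ((n0 + d) + b)" for d
  proof
    have "Xw y d \<subseteq> Xw x ((n0 + d) + b)"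
      unfolding Xw_def[of y] using word by (intro mv.span_minimal Xw_subspace) (auto simp: algebra_simps)
    then show "z \<in> W \<inter> Xw x ((n0 + d) + b)" if "z \<in> Xw y d" for z
      using that Xw_submodule[OF W(1) yW] by blast
  qed
  \<comment> \<open>Inside \<open>cyc y\<close> the operator \<open>L(0)\<close> acts on
    \<open>Xw y d\<close> by the scalar \<open>\<mu> + d\<close>, so every stable subspace splits
    along these pieces. The claim is used first for \<open>cyc y\<close> itself, to obtain
    \<open>cyc y = W\<close>, and then for all submodules of \<open>W\<close>.\<close>
  have graded: "graded_submodule scM W YM (\<lambda>n. W \<inter> Xw x (n + b)) K"
    if K: "submodule scM M YM K" "K \<subseteq> W" "K \<subseteq> cyc y" for K
  proof -
    have "K \<subseteq> mv.span (\<Union>n. K \<inter> (W \<inter> Xw x (n + b)))"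
    proof
      fix z assume z: "z \<in> K"
      have "z \<in> mv.span (\<Union>d\<in>UNIV. K \<inter> Xw y d)"
      proof (rule Z.stable_decomp[where ev = "\<lambda>d. \<mu> + of_rat (d + 0)"])
        show "stableL0 K" using submodule_stable K by blast
        show "Xw y d \<subseteq> Z.gen (\<mu> + of_rat (d + 0))" for d
          using Xw_EL0[OF yE, of d] EL0_gen by auto
        show "z \<in> mv.span (\<Union>d\<in>UNIV. Xw y d)" using z K(3) unfolding cyc_def by blast
      qed (rule inj_shift_rat Xw_subspace z)+
      also have "\<dots> \<subseteq> mv.span (\<Union>n. K \<inter> (W \<inter> Xw x (n + b)))"
        using Xy by (intro mv.span_mono) blast
      finally show "z \<in> mv.span (\<Union>n. K \<inter> (W \<inter> Xw x (n + b)))" .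
    qed
    then show ?thesis
      unfolding graded_submodule_def submodule_iff[OF W(1)] using K by blast
  qed
  have cycW: "cyc y = W"
  proof -
    have "cyc y = {0} \<or> cyc y = W"
      using cyc_minimal[OF W(1) yW] by (intro simple graded cyc_submodule yM) auto
    then show ?thesis using cyc_base[of y] y(2) by auto
  qed
  have "irred_module scM W YM"
    unfolding irred_module_def submodule_iff[OF W(1)]
    using W(2) simple graded cycW by blast
  moreover have "ordinary_tw_module sc Y vac om Ve Vo g scM W YM"
  proof -
    define EW where "EW = (\<lambda>lam. {w\<in>W. L0 w = lam *m w})"
    have EWX: "z \<in> mv.span (\<Union>d\<in>{d\<in>UNIV. \<mu> + of_rat (d + 0) = lam}. Xw y d)" if z: "z \<in> EW lam" for lam z
    proof (rule Z.eigen_component[OF inj_shift_rat])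
      show "Xw y d \<subseteq> Z.gen (\<mu> + of_rat (d + 0))" for d
        using Xw_EL0[OF yE, of d] EL0_gen by auto
      have "z \<in> EL0 lam" using z Ws(2) by (auto simp: EW_def EL0_def)
      then show "z \<in> Z.gen lam" using EL0_gen by blast
      have "z \<in> cyc y" using z by (simp add: cycW EW_def)
      then show "z \<in> mv.span (\<Union>d\<in>UNIV. Xw y d)" unfolding cyc_def .
    qed (rule Xw_subspace)
    \<comment> \<open>The eigenspace of \<open>\<mu> + d\<close> in \<open>W\<close> sits in one
      word space of \<open>y\<close>, so finite dimension and the lower bound on eigenvalues follow
      from \<open>word_spaces\<close> for \<open>y\<close>.\<close>
    have EWd: "EW (\<mu> + of_rat d) \<subseteq> Xw y d" for d
    proof
      fix z assume "z \<in> EW (\<mu> + of_rat d)"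
      from EWX[OF this] have "z \<in> mv.span (\<Union>d\<in>{d}. Xw y d)" by simp
      also have "\<dots> = Xw y d" using Xw_subspace mv.span_eq_iff by simp
      finally show "z \<in> Xw y d" .
    qed
    have EW0: "EW lam \<subseteq> {0}" if "\<And>d. lam \<noteq> \<mu> + of_rat d" for lam
    proof
      fix z assume "z \<in> EW lam"
      from EWX[OF this] have "z \<in> mv.span (\<Union>d\<in>{d\<in>UNIV. \<mu> + of_rat (d + 0) = lam}. Xw y d)" .
      moreover have "{d\<in>UNIV. \<mu> + of_rat (d + 0) = lam} = {}" using that by auto
      ultimately show "z \<in> {0}" by (simp only: UN_empty mv.span_empty)
    qed
    have zEW: "0 \<in> EW lam" for lam using W0 by (simp add: EW_def)
    have "W \<subseteq> mv.span (\<Union>(range EW))"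
    proof -
      have "Xw y d \<subseteq> EW (\<mu> + of_rat d)" for d
        using Xw_EL0[OF yE, of d] Xy[of d] by (auto simp: EW_def EL0_def)
      then have "cyc y \<subseteq> mv.span (\<Union>(range EW))" unfolding cyc_def by (intro mv.span_mono) blast
      then show ?thesis by (simp only: cycW)
    qed
    moreover have "fin_dim scM (EW lam)" for lam
    proof (cases "\<exists>d. lam = \<mu> + of_rat d")
      case True
      then obtain d where "lam = \<mu> + of_rat d" by blast
      then show ?thesis using word_spaces(1)[OF C2 yM, of d] EWd[of d] unfolding fin_dim_def by blast
    next
      case False
      then have "EW lam \<subseteq> mv.span {}" using EW0 by (simp add: mv.span_empty)
      then show ?thesis unfolding fin_dim_def by blast
    qed
    moreover have "\<exists>N::int. \<forall>n\<le>N. EW (lam + of_rat (of_int n / of_nat T')) = {0}" for lam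
    proof (cases "\<exists>d. lam = \<mu> + of_rat d")
      case True
      then obtain q where q: "lam = \<mu> + of_rat q" by blast
      obtain c where c: "\<forall>d<c. Xw y d = {0}" using word_spaces(2)[OF C2 yM] by blast
      have "EW (lam + of_rat (of_int n / of_nat T')) = {0}" if "n \<le> \<lfloor>(c - q) * of_nat T'\<rfloor> - 1" for n
      proof -
        have "(of_int n :: rat) < (c - q) * of_nat T'" using that by linarith
        then have "of_int n / of_nat T' < c - q" using T'_pos by (simp add: pos_divide_less_eq)
        then have "q + of_int n / of_nat T' < c" by linarith
        then have "Xw y (q + of_int n / of_nat T') = {0}" using c by blast
        moreover have "lam + of_rat (of_int n / of_nat T') = \<mu> + of_rat (q + of_int n / of_nat T')"
          by (simp add: q of_rat_add)
        ultimately show ?thesis using EWd[of "q + of_int n / of_nat T'"] zEW by auto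
      qed
      then show ?thesis by blast
    next
      case False
      have "EW (lam + of_rat r) = {0}" for r
      proof -
        have "lam + of_rat r \<noteq> \<mu> + of_rat d" for d
        proof
          assume "lam + of_rat r = \<mu> + of_rat d"
          then have "lam = \<mu> + of_rat (d - r)" by (simp add: of_rat_diff algebra_simps)
          then show False using False by blast
        qed
        then show ?thesis using EW0 zEW by blast
      qed
      then show ?thesis by blast
    qed
    ultimately show ?thesis
      unfolding ordinary_tw_module_def Let_def using weak_submodule[OF W(1)] by (simp only: EW_def) blast
  qed
  ultimately show ?thesis by blast
qed

lemma rational_decomposes_weak:
  assumes rat: "g_rational TYPE('m) sc Y vac Ve Vo Vw g"
  shows "\<exists>S. is_dsum scM M S \<and>
             (\<forall>W\<in>S. submodule scM M YM W \<and> ordinary_tw_module sc Y vac om Ve Vo g scM W YM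
                    \<and> irred_module scM W YM)"
proof -
  interpret Z: endo_on scM M L0 by (rule endo_YM)
  define Irr where "Irr = {W. submodule scM M YM W \<and> ordinary_tw_module sc Y vac om Ve Vo g scM W YM
                    \<and> irred_module scM W YM}"
  have gens: "x \<in> mv.span (\<Union>Irr)" if x: "x \<in> genL0 \<nu>" for x \<nu>
  proof -
    have xM: "x \<in> M" using x by (simp add: Z.gen_def)
    obtain b where b: "adm_grading sc Ve Vo Vw g scM (cyc x) YM (\<lambda>n. Xw x (n + b))"
      by (rule cyc_admissible[OF x])
    note cycsub = cyc_submodule[OF xM]
    have "admissible_tw_module sc Y vac Ve Vo Vw g scM (cyc x) YM (\<lambda>n. Xw x (n + b))"
      unfolding admissible_tw_module_def using weak_submodule[OF cycsub] b by blast
    then obtain S where S: "is_dsum scM (cyc x) S"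
        "\<And>W. W \<in> S \<Longrightarrow> graded_submodule scM (cyc x) YM (\<lambda>n. Xw x (n + b)) W \<and>
          irred_admissible_tw_module sc Y vac Ve Vo Vw g scM W YM (\<lambda>n. W \<inter> Xw x (n + b))"
      using rat unfolding g_rational_def by blast
    have "S \<subseteq> Irr"
    proof
      fix W assume "W \<in> S"
      note W = S(2)[OF this]
      have "submodule scM M YM W"
        using W submodule_iff[OF cycsub] unfolding graded_submodule_def by blast
      moreover have "W \<subseteq> mv.span (\<Union>n. W \<inter> Xw x (n + b))" using W unfolding graded_submodule_def by blast
      moreover have "W \<noteq> {0}" "\<And>K. graded_submodule scM W YM (\<lambda>n. W \<inter> Xw x (n + b)) K \<Longrightarrow> K = {0} \<or> K = W"
        using W unfolding irred_admissible_tw_module_def by blast+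
      ultimately show "W \<in> Irr" unfolding Irr_def using graded_simple_in_cyc[OF x] by blast
    qed
    then have "mv.span (\<Union>S) \<subseteq> mv.span (\<Union>Irr)" by (intro mv.span_mono) blast
    moreover have "cyc x \<subseteq> mv.span (\<Union>S)" using S(1) unfolding is_dsum_def by blast
    ultimately show ?thesis using cyc_base by blast
  qed
  have "M \<subseteq> mv.span (\<Union>Irr)"
  proof
    fix w assume w: "w \<in> M"
    have "w \<in> mv.span (\<Union>\<nu>. Xw w 0 \<inter> genL0 \<nu>)"
      using Xw_base Xw_stable[OF w] Xw_M[OF w] word_spaces(1)[OF C2 w] by (intro Z.fin_dim_gen_decomp)
    also have "\<dots> \<subseteq> mv.span (\<Union>Irr)" using gens by (intro mv.span_minimal mv.subspace_span) blast
    finally show "w \<in> mv.span (\<Union>Irr)" .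
  qed
  then obtain S where "S \<subseteq> Irr" "is_dsum scM M S"
    using irreducibles_dsum[of Irr] unfolding Irr_def by blast
  then show ?thesis unfolding Irr_def by blast
qed

end

section \<open>Regularity implies rationality\<close>

text \<open>
  For an admissible module that is a sum of irreducible ordinary modules, \<open>L0\<close> is semisimple and the
  difference between its eigenvalue and the given degree splits the module into submodules \<open>A t\<close>. On each of them
  the grading is determined by \<open>L0\<close>, so that every submodule is graded.
\<close>

context
  fixes Mg :: "rat \<Rightarrow> 'm set"
  assumes grading: "adm_grading sc Ve Vo Vw g scM M YM Mg"
begin

lemma Mg_subspace: "mv.subspace (Mg n)" and Mg_M: "Mg n \<subseteq> M"
  and Mg_span: "M \<subseteq> mv.span (\<Union>(range Mg))"
  and Mg_indep: "Mg n \<inter> mv.span (\<Union>k\<in>UNIV - {n}. Mg k) = {0}"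
  and Mg_YM: "v \<in> Vw k \<Longrightarrow> w \<in> Mg n \<Longrightarrow> YM v m w \<in> Mg (n + k - m - 1)"
  using grading unfolding adm_grading_def by blast+

lemma Mg_opr: "a \<in> L \<Longrightarrow> x \<in> Mg n \<Longrightarrow> opr a x \<in> Mg (n + deg a)"
  using Mg_YM by (force simp: L_def opr_def deg_def algebra_simps)

lemma Mg_stable: "stableL0 (Mg n)"
  using Mg_YM[OF om_Vw, of _ n 1] by (auto simp: stable_L0 Mg_subspace)

definition P :: "complex \<Rightarrow> rat \<Rightarrow> 'm set" where "P t n = Mg n \<inter> EL0 (t + of_rat n)"
definition A :: "complex \<Rightarrow> 'm set" where "A t = mv.span (\<Union>n. P t n)"
definition B :: "complex \<Rightarrow> 'm set" where "B t = mv.span (\<Union>s\<in>UNIV - {t}. A s)"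

lemma P_subspace: "mv.subspace (P t n)"
  by (simp add: P_def mv.subspace_inter Mg_subspace EL0_subspace)

lemma A_submodule: "submodule scM M YM (A t)"
  unfolding A_def
proof (rule submodule_span)
  show "(\<Union>n. P t n) \<subseteq> M" using Mg_M by (auto simp: P_def)
  fix x a assume "x \<in> (\<Union>n. P t n)" and a: "a \<in> L"
  then obtain n where x: "x \<in> Mg n" "x \<in> EL0 (t + of_rat n)" by (auto simp: P_def)
  have "opr a x \<in> P t (n + deg a)"
    using Mg_opr[OF a x(1)] EL0_opr[OF a x(2)] by (simp add: P_def of_rat_add add.assoc)
  then show "opr a x \<in> mv.span (\<Union>n. P t n)" by (intro mv.span_base) blast
qed

lemma B_submodule: "submodule scM M YM (B t)"
  unfolding B_def by (rule submodule_span_Union) (use A_submodule in blast)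

text \<open>Eigenvalues alone do not separate the \<open>A t\<close>, since
  \<open>t + n = s + m\<close> may hold in different degrees. Components are therefore compared
  degree by degree through \<open>Mg_indep\<close>; within degree \<open>n\<close>, the eigenvalue
  \<open>t + n\<close> is then separated from the others, which are collected in
  \<open>Q n\<close>.\<close>

lemma A_B_disjoint: "A t \<inter> B t = {0}"
proof -
  interpret Z: endo_on scM M L0 by (rule endo_YM)
  define Q where "Q = (\<lambda>n. Mg n \<inter> mv.span (\<Union>\<nu>\<in>UNIV - {t + of_rat n}. EL0 \<nu>))"
  have Qsub: "mv.subspace (Q n)" for n
    unfolding Q_def by (intro mv.subspace_inter Mg_subspace mv.subspace_span)
  have "B t \<subseteq> mv.span (\<Union>n. Q n)"
  proof -
    have "P s n \<subseteq> Q n" if "s \<noteq> t" for s n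
    proof -
      have "EL0 (s + of_rat n) \<subseteq> mv.span (\<Union>\<nu>\<in>UNIV - {t + of_rat n}. EL0 \<nu>)"
        using that by (intro order.trans[OF _ mv.span_superset] UN_upper) simp
      then show ?thesis by (auto simp: P_def Q_def)
    qed
    then have "A s \<subseteq> mv.span (\<Union>n. Q n)" if "s \<noteq> t" for s
      unfolding A_def using that by (intro mv.span_mono) blast
    then show ?thesis unfolding B_def by (intro mv.span_minimal mv.subspace_span) blast
  qed
  have disj: "P t n \<inter> Q n \<subseteq> {0}" for n
  proof -
    have "EL0 (t + of_rat n) \<inter> mv.span (\<Union>\<nu>\<in>UNIV - {t + of_rat n}. EL0 \<nu>) = {0}"
      using EL0_gen by (intro Z.gen_indep[where ev = "\<lambda>\<nu>. \<nu>"] EL0_subspace) auto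
    then show ?thesis by (auto simp: P_def Q_def)
  qed
  have "x = 0" if x: "x \<in> A t" "x \<in> B t" for x
  proof -
    obtain J a where J: "finite J" "\<And>n. n \<in> J \<Longrightarrow> a n \<in> P t n" "x = sum a J"
      using mv.span_UN_subspaces[of x "P t" UNIV] x(1) P_subspace unfolding A_def by metis
    have "x \<in> mv.span (\<Union>n\<in>UNIV. Q n)" using x(2) \<open>B t \<subseteq> _\<close> by blast
    then obtain K c where K: "finite K" "\<And>n. n \<in> K \<Longrightarrow> c n \<in> Q n" "x = sum c K"
      using mv.span_UN_subspaces[of x Q UNIV] Qsub by metis
    define a' where "a' = (\<lambda>n. if n \<in> J then a n else 0)"
    define c' where "c' = (\<lambda>n. if n \<in> K then c n else 0)"
    have a': "a' n \<in> P t n" and c': "c' n \<in> Q n" for n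
      using J K P_subspace Qsub mv.subspace_0 by (auto simp: a'_def c'_def)
    have xa: "x = sum a' (J \<union> K)" unfolding J(3) a'_def
      using J(1) K(1) by (simp add: sum.If_cases Int_absorb1 Int_commute)
    have xc: "x = sum c' (J \<union> K)" unfolding K(3) c'_def
      using J(1) K(1) by (simp add: sum.If_cases Int_absorb1 Int_commute)
    have eq: "a' n = c' n" if "n \<in> J \<union> K" for n
    proof -
      have "a' n - c' n = 0"
      proof (rule mv.indep_sum_zero[where D = Mg and J = "J \<union> K" and c = "\<lambda>n. a' n - c' n", OF Mg_subspace Mg_indep])
        show "a' n - c' n \<in> Mg n" for n
          using a'[of n] c'[of n] Mg_subspace mv.subspace_diff by (auto simp: P_def Q_def)
        show "(\<Sum>n\<in>J \<union> K. a' n - c' n) = 0" unfolding sum_subtractf using xa xc by simp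
      qed (use J K that in auto)
      then show ?thesis by simp
    qed
    have "a' n = 0" if "n \<in> J \<union> K" for n using eq[OF that] a'[of n] c'[of n] disj[of n] by auto
    then show "x = 0" unfolding xa by (intro sum.neutral) blast
  qed
  moreover have "0 \<in> A t" "0 \<in> B t" by (simp_all add: A_def B_def mv.span_zero)
  ultimately show ?thesis by blast
qed

lemma submodule_A_graded:
  assumes "submodule scM M YM W" "W \<subseteq> A t"
  shows "graded_submodule scM M YM Mg W"
proof -
  interpret Z: endo_on scM M L0 by (rule endo_YM)
  have "W \<subseteq> mv.span (\<Union>n. W \<inter> Mg n)"
  proof
    fix z assume z: "z \<in> W"
    have "z \<in> mv.span (\<Union>n\<in>UNIV. W \<inter> P t n)"
    proof (rule Z.stable_decomp[where ev = "\<lambda>n. t + of_rat (n + 0)"])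
      show "stableL0 W" by (rule submodule_stable[OF assms(1)])
      show "P t n \<subseteq> Z.gen (t + of_rat (n + 0))" for n using EL0_gen[of "t + of_rat n"] by (auto simp: P_def)
      show "z \<in> mv.span (\<Union>n\<in>UNIV. P t n)" using z assms(2) unfolding A_def by blast
    qed (rule inj_shift_rat P_subspace z)+
    also have "\<dots> \<subseteq> mv.span (\<Union>n. W \<inter> Mg n)" by (intro mv.span_mono) (auto simp: P_def)
    finally show "z \<in> mv.span (\<Union>n. W \<inter> Mg n)" .
  qed
  then show ?thesis using assms(1) by (simp add: graded_submodule_def)
qed

text \<open>Each \<open>Mg n\<close> is stable under \<open>L(0)\<close> and so inherits the
  eigenspace decomposition of \<open>M\<close>; in degree \<open>n\<close> the eigenvalue
  \<open>\<nu>\<close> belongs to \<open>t = \<nu> - n\<close>.\<close>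

lemma span_A:
  assumes "M \<subseteq> mv.span (\<Union>\<nu>. EL0 \<nu>)"
  shows "M \<subseteq> mv.span (\<Union>t. A t)"
proof -
  interpret Z: endo_on scM M L0 by (rule endo_YM)
  have "Mg n \<subseteq> mv.span (\<Union>t. A t)" for n
  proof
    fix z assume z: "z \<in> Mg n"
    have "z \<in> mv.span (\<Union>\<nu>\<in>UNIV. Mg n \<inter> EL0 \<nu>)"
    proof (rule Z.stable_decomp[where ev = "\<lambda>\<nu>. \<nu>", OF Mg_stable _ EL0_subspace EL0_gen z])
      show "z \<in> mv.span (\<Union>\<nu>\<in>UNIV. EL0 \<nu>)" using z Mg_M assms by blast
    qed auto
    also have "\<dots> \<subseteq> mv.span (\<Union>t. A t)"
    proof (intro mv.span_mono UN_least)
      fix \<nu>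
      have "Mg n \<inter> EL0 \<nu> = P (\<nu> - of_rat n) n" by (simp add: P_def)
      also have "\<dots> \<subseteq> A (\<nu> - of_rat n)" unfolding A_def by (intro order.trans[OF _ mv.span_superset]) blast
      finally show "Mg n \<inter> EL0 \<nu> \<subseteq> (\<Union>t. A t)" by blast
    qed
    finally show "z \<in> mv.span (\<Union>t. A t)" .
  qed
  then have "mv.span (\<Union>(range Mg)) \<subseteq> mv.span (\<Union>t. A t)"
    by (intro mv.span_minimal mv.subspace_span) blast
  then show ?thesis using Mg_span by blast
qed

text \<open>The image of \<open>W\<close> under the projection onto \<open>A t\<close> along \<open>B t\<close>.\<close>

definition pr :: "complex \<Rightarrow> 'm set \<Rightarrow> 'm set" where
  "pr t W = A t \<inter> mv.span (W \<union> B t)"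

lemma span_submodules_Un:
  assumes "submodule scM M YM K" "submodule scM M YM K'"
  shows "mv.span (K \<union> K') = {x + y | x y. x \<in> K \<and> y \<in> K'}"
proof -
  have "mv.span K = K" "mv.span K' = K'" using assms submodule_sub(1) mv.span_eq_iff by blast+
  then show ?thesis by (simp only: mv.span_Un)
qed

lemma submodule_Un: "submodule scM M YM K \<Longrightarrow> submodule scM M YM K' \<Longrightarrow> submodule scM M YM (mv.span (K \<union> K'))"
  using submodule_span_Union[of "{K, K'}"] by auto

lemma pr_submodule: "submodule scM M YM W \<Longrightarrow> submodule scM M YM (pr t W)"
  unfolding pr_def by (intro submodule_Int A_submodule submodule_Un B_submodule)

text \<open>A lattice argument replaces the projection map. Given \<open>K\<close> inside
  \<open>pr t W\<close>, irreducibility of \<open>W\<close> leaves two cases. If \<open>W\<close>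
  meets \<open>K + B t\<close> trivially, then \<open>K\<close> lies in
  \<open>A t \<inter> B t = {0}\<close>. If \<open>W\<close> lies in \<open>K + B t\<close>, then so
  does \<open>pr t W\<close>, and intersecting with \<open>A t\<close> gives
  \<open>K\<close>.\<close>

lemma pr_simple:
  assumes W: "submodule scM M YM W" "irred_module scM W YM" and nz: "pr t W \<noteq> {0}"
  shows "irred_module scM (pr t W) YM"
  unfolding irred_module_def submodule_iff[OF pr_submodule[OF W(1)]]
proof (intro conjI allI impI nz)
  fix K assume K: "submodule scM M YM K \<and> K \<subseteq> pr t W"
  note WB = span_submodules_Un[OF W(1) B_submodule] and KB = span_submodules_Un[OF conjunct1[OF K] B_submodule]
  have KA: "K \<subseteq> A t" using K by (auto simp: pr_def)
  have K0: "0 \<in> K" using K submodule_sub(1) mv.subspace_0 by blast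
  have B0: "mv.subspace (B t)" using B_submodule submodule_sub(1) by blast
  have "submodule scM M YM (mv.span (K \<union> B t))" using K B_submodule by (intro submodule_Un) auto
  from simple_submodule[OF W this] show "K = {0} \<or> K = pr t W"
  proof
    assume W0: "W \<inter> mv.span (K \<union> B t) = {0}"
    have "x = 0" if x: "x \<in> K" for x
    proof -
      have "x \<in> mv.span (W \<union> B t)" using x K by (auto simp: pr_def)
      then obtain w b where wb: "x = w + b" "w \<in> W" "b \<in> B t" unfolding WB by blast
      then have "w = x + (- b)" "- b \<in> B t" using B0 mv.subspace_neg by auto
      then have "w \<in> mv.span (K \<union> B t)" unfolding KB using x by blast
      then have "w = 0" using W0 wb(2) by blast
      then have "x \<in> A t \<inter> B t" using wb x KA by auto
      then show ?thesis unfolding A_B_disjoint by simp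
    qed
    then show ?thesis using K0 by blast
  next
    assume WK: "W \<subseteq> mv.span (K \<union> B t)"
    have "x \<in> K" if x: "x \<in> pr t W" for x
    proof -
      have "B t \<subseteq> mv.span (K \<union> B t)" by (intro order.trans[OF _ mv.span_superset]) blast
      then have "mv.span (W \<union> B t) \<subseteq> mv.span (K \<union> B t)"
        using WK by (intro mv.span_minimal mv.subspace_span) blast
      then have "x \<in> mv.span (K \<union> B t)" using x unfolding pr_def by blast
      then obtain y b where yb: "x = y + b" "y \<in> K" "b \<in> B t" unfolding KB by blast
      have "x \<in> A t" "y \<in> A t" using x yb KA by (auto simp: pr_def)
      then have "x - y \<in> A t" using A_submodule submodule_sub(1) mv.subspace_diff by blast
      then have "b \<in> A t \<inter> B t" using yb by simp
      then show ?thesis using yb unfolding A_B_disjoint by simp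
    qed
    then show ?thesis using K by blast
  qed
qed

lemma regular_decomposes_admissible:
  assumes reg: "g_regular TYPE('m) sc Y vac om Ve Vo g"
  shows "\<exists>S. is_dsum scM M S \<and>
             (\<forall>W\<in>S. graded_submodule scM M YM Mg W \<and>
                     irred_admissible_tw_module sc Y vac Ve Vo Vw g scM W YM (\<lambda>n. W \<inter> Mg n))"
proof -
  obtain S0 where S0: "is_dsum scM M S0"
    and S0W: "\<And>W. W \<in> S0 \<Longrightarrow> submodule scM M YM W \<and> ordinary_tw_module sc Y vac om Ve Vo g scM W YM
                    \<and> irred_module scM W YM"
    using reg weak unfolding g_regular_def by blast
  have MS0: "M \<subseteq> mv.span (\<Union>S0)" using S0 by (simp add: is_dsum_def)
  have "W \<subseteq> mv.span (\<Union>\<nu>. EL0 \<nu>)" if W: "W \<in> S0" for W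
  proof -
    have "W \<subseteq> mv.span (\<Union>\<nu>. {w\<in>W. L0 w = \<nu> *m w})"
      using S0W[OF W] unfolding ordinary_tw_module_def Let_def by blast
    also have "\<dots> \<subseteq> mv.span (\<Union>\<nu>. EL0 \<nu>)"
      using submodule_sub(2) S0W[OF W] by (intro mv.span_mono) (auto simp: EL0_def)
    finally show ?thesis .
  qed
  then have "mv.span (\<Union>S0) \<subseteq> mv.span (\<Union>\<nu>. EL0 \<nu>)" by (intro mv.span_minimal mv.subspace_span) blast
  then have MA: "M \<subseteq> mv.span (\<Union>t. A t)" using MS0 by (intro span_A) blast
  define Irr where "Irr = {pr t W | t W. W \<in> S0 \<and> pr t W \<noteq> {0}}"
  have Irr: "submodule scM M YM V \<and> irred_module scM V YM \<and> graded_submodule scM M YM Mg V" if "V \<in> Irr" for V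
  proof -
    obtain t W where V: "V = pr t W" "W \<in> S0" "pr t W \<noteq> {0}" using \<open>V \<in> Irr\<close> by (auto simp: Irr_def)
    have "submodule scM M YM V" using S0W V pr_submodule by blast
    moreover have "V \<subseteq> A t" by (auto simp: V pr_def)
    ultimately show ?thesis using submodule_A_graded pr_simple S0W V by blast
  qed
  have "W \<subseteq> mv.span (\<Union>Irr)" if W: "W \<in> S0" for W
  proof
    fix w assume w: "w \<in> W"
    have sub: "submodule scM M YM W" using S0W[OF W] by blast
    then have "w \<in> mv.span (\<Union>t\<in>UNIV. A t)" using w submodule_sub(2) MA by blast
    then obtain J a where J: "finite J" "\<And>t. t \<in> J \<Longrightarrow> a t \<in> A t" "w = sum a J"
      using mv.span_UN_subspaces[of w A UNIV] submodule_sub(1)[OF A_submodule] by metis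
    have "a t \<in> mv.span (\<Union>Irr)" if t: "t \<in> J" for t
    proof -
      \<comment> \<open>The component \<open>a t\<close> differs from \<open>w\<close> by an element
        of \<open>B t\<close>, so it lies in \<open>pr t W\<close>; thus the images of
        \<open>W\<close> together span at least \<open>W\<close>.\<close>
      have "w = a t + sum a (J - {t})" using J t by (simp add: sum.remove)
      then have at: "a t = w - sum a (J - {t})" by simp
      have "sum a (J - {t}) \<in> B t"
        unfolding B_def using J by (intro mv.span_sum mv.span_base) blast
      then have "a t \<in> mv.span (W \<union> B t)"
        unfolding at using w by (intro mv.span_diff mv.span_base) auto
      then have pr: "a t \<in> pr t W" using J(2)[OF t] by (simp add: pr_def)
      show ?thesis
      proof (cases "pr t W = {0}")
        case True
        then show ?thesis using pr mv.span_zero by auto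
      next
        case False
        then have "pr t W \<in> Irr" using W by (auto simp: Irr_def)
        then show ?thesis using pr by (intro mv.span_base) blast
      qed
    qed
    then show "w \<in> mv.span (\<Union>Irr)" unfolding J(3) by (intro mv.span_sum)
  qed
  then have "mv.span (\<Union>S0) \<subseteq> mv.span (\<Union>Irr)" by (intro mv.span_minimal mv.subspace_span) blast
  then have MIrr: "M \<subseteq> mv.span (\<Union>Irr)" using MS0 by (rule order.trans[rotated])
  have "submodule scM M YM V \<and> irred_module scM V YM" if "V \<in> Irr" for V using Irr[OF that] by blast
  then obtain S where S: "S \<subseteq> Irr" "is_dsum scM M S"
    by (rule irreducibles_dsum[OF _ MIrr])
  have "irred_admissible_tw_module sc Y vac Ve Vo Vw g scM W YM (\<lambda>n. W \<inter> Mg n)" if "W \<in> S" for W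
  proof -
    have W: "submodule scM M YM W" "irred_module scM W YM" "graded_submodule scM M YM Mg W"
      using Irr S(1) \<open>W \<in> S\<close> by blast+
    have "admissible_tw_module sc Y vac Ve Vo Vw g scM W YM (\<lambda>n. W \<inter> Mg n)"
      unfolding admissible_tw_module_def
      using weak_submodule[OF W(1)] adm_grading_submodule[OF grading W(3)] by blast
    then show ?thesis
      using W(2) unfolding irred_admissible_tw_module_def irred_module_def graded_submodule_def by blast
  qed
  then show ?thesis using S Irr by blast
qed

end

end

theorem theorem4p7:
  fixes sc :: "complex \<Rightarrow> 'v::ab_group_add \<Rightarrow> 'v"
    and Y :: "'v \<Rightarrow> int \<Rightarrow> 'v \<Rightarrow> 'v"
    and vac om :: 'v
    and Ve Vo :: "'v set"
    and Vw :: "rat \<Rightarrow> 'v set"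
    and g :: "'v \<Rightarrow> 'v"
  assumes "is_VOSA sc Y vac om Ve Vo Vw"
    and "C2_cofinite sc Y"
    and "is_aut sc Y vac om g"
    and "\<exists>T>0. g ^^ T = id"
  shows "g_rational TYPE('m::ab_group_add) sc Y vac Ve Vo Vw g
         \<longleftrightarrow> g_regular TYPE('m) sc Y vac om Ve Vo g"
proof -
  have vs: "vector_space sc" using assms(1) unfolding is_VOSA_def by blast
  have V: "vosa sc Y vac om Ve Vo Vw g"
    using vs assms by (intro vosa.intro complex_vector_space.intro vosa_axioms.intro)
  have mod: "tw_module sc Y vac om Ve Vo Vw g scM M YM"
    if "weak_tw_module sc Y vac Ve Vo g scM M YM" for scM :: "complex \<Rightarrow> 'm \<Rightarrow> 'm" and M YM
  proof -
    have "vector_space scM" using that unfolding weak_tw_module_def by blast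
    then show ?thesis
      using V that by (intro tw_module.intro complex_vector_space.intro tw_module_axioms.intro)
  qed
  show ?thesis
  proof
    assume "g_rational TYPE('m) sc Y vac Ve Vo Vw g"
    then show "g_regular TYPE('m) sc Y vac om Ve Vo g"
      unfolding g_regular_def
      by (intro allI impI tw_module.rational_decomposes_weak[OF mod assms(2)])
  next
    assume reg: "g_regular TYPE('m) sc Y vac om Ve Vo g"
    show "g_rational TYPE('m) sc Y vac Ve Vo Vw g"
      unfolding g_rational_def admissible_tw_module_def
      by (intro allI impI, elim conjE) (rule tw_module.regular_decomposes_admissible[OF mod _ reg])
  qed
qed

end
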